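(* For every $\lambda>0$ there exists a critical point $(q_1^s,q_2^s,q_3^s)$ of the energy functional $J$ in the admissible space $\mathcal{A}_0$ such that $q_1^s=0$ on the square diagonals $y=x$ and $y=-x$ (within $\Omega$), and $q_2^s=0$ on $x=0$ and on $y=0$ (within $\Omega$).
   Context: Parameters: $A<0$, $B,C,L,\lambda>0$ and $L_2\in(-1,\infty)$ are real constants, and $s_+=\frac{B+\sqrt{B^2+24|A|C}}{4C}>0$. Domain: for a fixed small $\epsilon>0$ ($\epsilon\ll1$), $\Omega=\{(x,y)\in\mathbb{R}^2:|x|<1,|y|<1,|x+y|<2-\epsilon,|x-y|<2-\epsilon\}$. Its boundary consists of four long edges, labelled clockwise, $C_1$ (on $y=1$), $C_2$ (on $x=1$), $C_3$ (on $y=-1$), $C_4$ (on $x=-1$), and four short edges, labelled clockwise from the top left, $S_1$ (on $y-x=2-\epsilon$), $S_2$ (on $x+y=2-\epsilon$), $S_3$ (on $x-y=2-\epsilon$), $S_4$ (on $x+y=-(2-\epsilon)$). Boundary function: with $g(l)=\frac{s_+}{2\epsilon}l$ for $-\epsilon\le l\le\epsilon$, define $q_b=s_+/2$ on $C_1\cup C_3$, $q_b=-s_+/2$ on $C_2\cup C_4$, $q_b=g(x+y)$ on $S_1$, $q_b=g(y-x)$ on $S_2$, $q_b=g(-x-y)$ on $S_3$, $q_b=g(x-y)$ on $S_4$. Energy: $J[q_1,q_2,q_3]=\int_\Omega f_{el}(q_1,q_2,q_3)+\frac{\lambda^2}{L}f_b(q_1,q_2,q_3)\,\mathrm{dA}$,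 where \begin{align*} f_{el}=&\Big(1+\tfrac{L_2}{2}\Big)|\nabla q_1|^2+\Big(1+\tfrac{L_2}{2}\Big)|\nabla q_2|^2+\Big(3+\tfrac{L_2}{2}\Big)|\nabla q_3|^2\\&+L_2(q_{1,y}q_{3,y}-q_{1,x}q_{3,x}-q_{2,y}q_{3,x}-q_{2,x}q_{3,y})+|L_2|(q_{2,y}q_{1,x}-q_{1,y}q_{2,x}),\\ f_b=&A(q_1^2+q_2^2+3q_3^2)+C(q_1^2+q_2^2+3q_3^2)^2+2Bq_3(q_1^2+q_2^2-q_3^2). \end{align*} The admissible space is $\mathcal{A}_0=\{(q_1,q_2,q_3)\in W^{1,2}(\Omega;\mathbb{R}^3):q_1=q_b,\ q_2=0,\ q_3=-s_+/6\text{ on }\partial\Omega\}$. A critical point of $J$ in $\mathcal{A}_0$ is a (weak) solution in $\mathcal{A}_0$ of the Euler-Lagrange equations of $J$. *)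

theory Defs
  imports "HOL-Analysis.Analysis"
begin

section \<open>Smooth functions and test functions\<close>

definition dir_deriv :: "'a::real_normed_vector \<Rightarrow> ('a \<Rightarrow> 'b::real_normed_vector) \<Rightarrow> 'a \<Rightarrow> 'b"
  where "dir_deriv e f z = frechet_derivative f (at z) e"

text \<open>All iterated directional derivatives (including the function itself, for the
  empty list of directions) exist and are differentiable everywhere; on a Euclidean
  space this is the class of infinitely differentiable functions.\<close>

definition smooth :: "('a::real_normed_vector \<Rightarrow> 'b::real_normed_vector) \<Rightarrow> bool"
  where "smooth f \<longleftrightarrow> (\<forall>ds z. foldr dir_deriv ds f differentiable (at z))"

definition test_function :: "'a::euclidean_space set \<Rightarrow> ('a \<Rightarrow> 'b::euclidean_space) \<Rightarrow> bool"
  where "test_function S \<phi> \<longleftrightarrow>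
    smooth \<phi> \<and> (\<exists>K. compact K \<and> K \<subseteq> S \<and> (\<forall>z. z \<notin> K \<longrightarrow> \<phi> z = 0))"

section \<open>The Sobolev space of square integrable functions with square integrable weak derivatives\<close>

definition square_integrable :: "'a measure \<Rightarrow> ('a \<Rightarrow> 'b::euclidean_space) \<Rightarrow> bool"
  where "square_integrable M f \<longleftrightarrow>
    f \<in> borel_measurable M \<and> integrable M (\<lambda>z. (norm (f z))\<^sup>2)"

definition locally_integrable :: "'a::euclidean_space set \<Rightarrow> ('a \<Rightarrow> 'b::euclidean_space) \<Rightarrow> bool"
  where "locally_integrable S f \<longleftrightarrow>
    (\<forall>K. compact K \<and> K \<subseteq> S \<longrightarrow> f absolutely_integrable_on K)"

definition has_weak_deriv ::
    "'a::euclidean_space set \<Rightarrow> 'a \<Rightarrow> ('a \<Rightarrow> 'b::euclidean_space) \<Rightarrow> ('a \<Rightarrow> 'b) \<Rightarrow> bool"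
  where "has_weak_deriv S e u v \<longleftrightarrow>
    locally_integrable S u \<and> locally_integrable S v \<and>
    (\<forall>\<phi> :: 'a \<Rightarrow> real. test_function S \<phi> \<longrightarrow>
       (LINT z|lebesgue_on S. dir_deriv e \<phi> z *\<^sub>R u z) = - (LINT z|lebesgue_on S. \<phi> z *\<^sub>R v z))"

text \<open>Weak derivatives on an open set are unique up to null sets, so that integrals
  involving the following do not depend on the choice.\<close>

definition weak_deriv ::
    "'a::euclidean_space set \<Rightarrow> 'a \<Rightarrow> ('a \<Rightarrow> 'b::euclidean_space) \<Rightarrow> 'a \<Rightarrow> 'b"
  where "weak_deriv S e u = (SOME v. has_weak_deriv S e u v)"

definition W12 :: "'a::euclidean_space set \<Rightarrow> ('a \<Rightarrow> 'b::euclidean_space) set"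
  where "W12 S = {u. square_integrable (lebesgue_on S) u \<and>
    (\<forall>e\<in>Basis. \<exists>v. has_weak_deriv S e u v \<and> square_integrable (lebesgue_on S) v)}"

definition W12_norm :: "'a::euclidean_space set \<Rightarrow> ('a \<Rightarrow> 'b::euclidean_space) \<Rightarrow> real"
  where "W12_norm S u = sqrt ((LINT z|lebesgue_on S. (norm (u z))\<^sup>2)
    + (\<Sum>e\<in>Basis. LINT z|lebesgue_on S. (norm (weak_deriv S e u z))\<^sup>2))"

section \<open>Traces on line segments\<close>

text \<open>A segment is given by its end points. The trace operator is the continuous extension,
  from the \<open>W12\<close> norm to the \<open>L\<^sup>2\<close> norm with respect to arc length, of the restriction map
  defined for those Sobolev functions that are continuous up to the boundary. The segments
  may lie on the boundary of the domain or run through its interior.\<close>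

definition has_trace ::
    "'a::euclidean_space set \<Rightarrow> ('a \<times> 'a) set \<Rightarrow> ('a \<Rightarrow> 'b::euclidean_space) \<Rightarrow> ('a \<Rightarrow> 'b) \<Rightarrow> bool"
  where "has_trace S \<Gamma> u g \<longleftrightarrow> u \<in> W12 S \<and>
    (\<exists>U :: nat \<Rightarrow> 'a \<Rightarrow> 'b.
       (\<forall>n. U n \<in> W12 S \<and> continuous_on (closure S) (U n)) \<and>
       (\<lambda>n. W12_norm S (\<lambda>z. U n z - u z)) \<longlonglongrightarrow> 0 \<and>
       (\<forall>(a, b)\<in>\<Gamma>.
          (\<forall>n. square_integrable (lebesgue_on {0..1})
                 (\<lambda>t. U n (linepath a b t) - g (linepath a b t))) \<and>
          (\<lambda>n. dist a b * (LINT t|lebesgue_on {0..1}.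
                 (norm (U n (linepath a b t) - g (linepath a b t)))\<^sup>2)) \<longlonglongrightarrow> 0))"

section \<open>The truncated square and the boundary data\<close>

definition Omega :: "real \<Rightarrow> (real \<times> real) set"
  where "Omega \<epsilon> = {(x, y). \<bar>x\<bar> < 1 \<and> \<bar>y\<bar> < 1 \<and> \<bar>x + y\<bar> < 2 - \<epsilon> \<and> \<bar>x - y\<bar> < 2 - \<epsilon>}"

type_synonym segment = "(real \<times> real) \<times> (real \<times> real)"

definition C1 :: "real \<Rightarrow> segment" where "C1 \<epsilon> = ((-1 + \<epsilon>, 1), (1 - \<epsilon>, 1))"
definition C2 :: "real \<Rightarrow> segment" where "C2 \<epsilon> = ((1, 1 - \<epsilon>), (1, -1 + \<epsilon>))"
definition C3 :: "real \<Rightarrow> segment" where "C3 \<epsilon> = ((1 - \<epsilon>, -1), (-1 + \<epsilon>, -1))"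
definition C4 :: "real \<Rightarrow> segment" where "C4 \<epsilon> = ((-1, -1 + \<epsilon>), (-1, 1 - \<epsilon>))"
definition S1 :: "real \<Rightarrow> segment" where "S1 \<epsilon> = ((-1, 1 - \<epsilon>), (-1 + \<epsilon>, 1))"
definition S2 :: "real \<Rightarrow> segment" where "S2 \<epsilon> = ((1 - \<epsilon>, 1), (1, 1 - \<epsilon>))"
definition S3 :: "real \<Rightarrow> segment" where "S3 \<epsilon> = ((1, -1 + \<epsilon>), (1 - \<epsilon>, -1))"
definition S4 :: "real \<Rightarrow> segment" where "S4 \<epsilon> = ((-1 + \<epsilon>, -1), (-1, -1 + \<epsilon>))"

definition boundary_edges :: "real \<Rightarrow> segment set"
  where "boundary_edges \<epsilon> =
    {C1 \<epsilon>, C2 \<epsilon>, C3 \<epsilon>, C4 \<epsilon>, S1 \<epsilon>, S2 \<epsilon>, S3 \<epsilon>, S4 \<epsilon>}"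

definition points_of :: "segment \<Rightarrow> (real \<times> real) set"
  where "points_of e = closed_segment (fst e) (snd e)"

definition s_plus :: "real \<Rightarrow> real \<Rightarrow> real \<Rightarrow> real"
  where "s_plus A B C = (B + sqrt (B\<^sup>2 + 24 * \<bar>A\<bar> * C)) / (4 * C)"

definition g_short :: "real \<Rightarrow> real \<Rightarrow> real \<Rightarrow> real"
  where "g_short s \<epsilon> l = s / (2 * \<epsilon>) * l"

text \<open>The clauses agree at the eight corners; the value \<open>0\<close> off the boundary is irrelevant.\<close>

definition q_b :: "real \<Rightarrow> real \<Rightarrow> real \<times> real \<Rightarrow> real"
  where "q_b s \<epsilon> = (\<lambda>(x, y).
    if (x, y) \<in> points_of (C1 \<epsilon>) \<union> points_of (C3 \<epsilon>) then s / 2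
    else if (x, y) \<in> points_of (C2 \<epsilon>) \<union> points_of (C4 \<epsilon>) then - s / 2
    else if (x, y) \<in> points_of (S1 \<epsilon>) then g_short s \<epsilon> (x + y)
    else if (x, y) \<in> points_of (S2 \<epsilon>) then g_short s \<epsilon> (y - x)
    else if (x, y) \<in> points_of (S3 \<epsilon>) then g_short s \<epsilon> (- x - y)
    else if (x, y) \<in> points_of (S4 \<epsilon>) then g_short s \<epsilon> (x - y)
    else 0)"

definition admissible :: "real \<Rightarrow> real \<Rightarrow> (real \<times> real \<Rightarrow> real ^ 3) set"
  where "admissible s \<epsilon> = {q \<in> W12 (Omega \<epsilon>).
    has_trace (Omega \<epsilon>) (boundary_edges \<epsilon>) q (\<lambda>z. vector [q_b s \<epsilon> z, 0, - s / 6])}"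

section \<open>The energy and its critical points\<close>

text \<open>Below, \<open>qx\<close> and \<open>qy\<close> stand for the partial derivatives of the field \<open>q\<close>.\<close>

definition f_el :: "real \<Rightarrow> real ^ 3 \<Rightarrow> real ^ 3 \<Rightarrow> real"
  where "f_el L2 qx qy =
      (1 + L2 / 2) * ((qx $ 1)\<^sup>2 + (qy $ 1)\<^sup>2)
    + (1 + L2 / 2) * ((qx $ 2)\<^sup>2 + (qy $ 2)\<^sup>2)
    + (3 + L2 / 2) * ((qx $ 3)\<^sup>2 + (qy $ 3)\<^sup>2)
    + L2 * (qy $ 1 * qy $ 3 - qx $ 1 * qx $ 3 - qy $ 2 * qx $ 3 - qx $ 2 * qy $ 3)
    + \<bar>L2\<bar> * (qy $ 2 * qx $ 1 - qy $ 1 * qx $ 2)"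

definition f_b :: "real \<Rightarrow> real \<Rightarrow> real \<Rightarrow> real ^ 3 \<Rightarrow> real"
  where "f_b A B C q =
      A * ((q $ 1)\<^sup>2 + (q $ 2)\<^sup>2 + 3 * (q $ 3)\<^sup>2)
    + C * ((q $ 1)\<^sup>2 + (q $ 2)\<^sup>2 + 3 * (q $ 3)\<^sup>2)\<^sup>2
    + 2 * B * q $ 3 * ((q $ 1)\<^sup>2 + (q $ 2)\<^sup>2 - (q $ 3)\<^sup>2)"

definition energy_density ::
    "real \<Rightarrow> real \<Rightarrow> real \<Rightarrow> real \<Rightarrow> real \<Rightarrow> real \<Rightarrow> (real ^ 3) \<times> (real ^ 3) \<times> (real ^ 3) \<Rightarrow> real"
  where "energy_density A B C L L2 lam =
    (\<lambda>(q, qx, qy). f_el L2 qx qy + lam\<^sup>2 / L * f_b A B C q)"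

definition functional :: "(real \<times> real) set \<Rightarrow> ((real ^ 3) \<times> (real ^ 3) \<times> (real ^ 3) \<Rightarrow> real)
    \<Rightarrow> (real \<times> real \<Rightarrow> real ^ 3) \<Rightarrow> real"
  where "functional S F q =
    (LINT z|lebesgue_on S. F (q z, weak_deriv S (1, 0) q z, weak_deriv S (0, 1) q z))"

definition J :: "real \<Rightarrow> real \<Rightarrow> real \<Rightarrow> real \<Rightarrow> real \<Rightarrow> real \<Rightarrow> real
    \<Rightarrow> (real \<times> real \<Rightarrow> real ^ 3) \<Rightarrow> real"
  where "J A B C L L2 lam \<epsilon> = functional (Omega \<epsilon>) (energy_density A B C L L2 lam)"

text \<open>Weak form of the Euler-Lagrange equations of \<open>functional S F\<close>. The derivative of \<open>F\<close>,
  applied to \<open>(\<phi>, \<phi>_x, \<phi>_y)\<close>, is the usual sum of the partial derivatives of \<open>F\<close> with respect to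
  \<open>q_i\<close>, \<open>q_{i,x}\<close>, \<open>q_{i,y}\<close> times the corresponding \<open>\<phi>_i\<close>, \<open>\<phi>_{i,x}\<close>, \<open>\<phi>_{i,y}\<close>.
  Integrability is demanded since the Bochner integral of a non-integrable function is \<open>0\<close>.\<close>

definition weak_Euler_Lagrange :: "(real \<times> real) set
    \<Rightarrow> ((real ^ 3) \<times> (real ^ 3) \<times> (real ^ 3) \<Rightarrow> real) \<Rightarrow> (real \<times> real \<Rightarrow> real ^ 3) \<Rightarrow> bool"
  where "weak_Euler_Lagrange S F q \<longleftrightarrow>
    (\<forall>\<phi> :: real \<times> real \<Rightarrow> real ^ 3. test_function S \<phi> \<longrightarrow>
      (let h = (\<lambda>z. frechet_derivative F
                 (at (q z, weak_deriv S (1, 0) q z, weak_deriv S (0, 1) q z))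
                 (\<phi> z, dir_deriv (1, 0) \<phi> z, dir_deriv (0, 1) \<phi> z))
       in integrable (lebesgue_on S) h \<and> (LINT z|lebesgue_on S. h z) = 0))"

definition critical_point_J :: "real \<Rightarrow> real \<Rightarrow> real \<Rightarrow> real \<Rightarrow> real \<Rightarrow> real \<Rightarrow> real
    \<Rightarrow> (real \<times> real \<Rightarrow> real ^ 3) \<Rightarrow> bool"
  where "critical_point_J A B C L L2 lam \<epsilon> q \<longleftrightarrow>
    q \<in> admissible (s_plus A B C) \<epsilon> \<and>
    weak_Euler_Lagrange (Omega \<epsilon>) (energy_density A B C L L2 lam) q"

section \<open>The symmetry lines\<close>

text \<open>The parts of \<open>y = x\<close> and \<open>y = -x\<close>, and of \<open>x = 0\<close> and \<open>y = 0\<close>, in \<open>closure (Omega \<epsilon>)\<close>.\<close>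

definition diagonals :: "real \<Rightarrow> segment set"
  where "diagonals \<epsilon> =
    {((-1 + \<epsilon> / 2, -1 + \<epsilon> / 2), (1 - \<epsilon> / 2, 1 - \<epsilon> / 2)),
     ((-1 + \<epsilon> / 2, 1 - \<epsilon> / 2), (1 - \<epsilon> / 2, -1 + \<epsilon> / 2))}"

definition axes :: "segment set"
  where "axes = {((0, -1), (0, 1)), ((-1, 0), (1, 0))}"

end

theory Submission
  imports Defs "HOL-Complex_Analysis.Great_Picard"
begin

text \<open>
  The critical point is obtained by minimizing the energy among fields with the symmetry of the square, and by
  the principle of symmetric criticality. The group is generated by the reflections in the two axes and in the
  diagonal; it acts on the domain and, by sign changes of the components, on the values of a field. Both the
  energy and the boundary data are invariant. A field with this symmetry has \<open>q\<^sub>1\<close> odd under the reflections in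
  the diagonals and \<open>q\<^sub>2\<close> odd under those in the axes, which is what the two conditions on the lines express.

  Competitors are the sums of one fixed Lipschitz extension of the boundary data (\<open>boundary_lift\<close>) and symmetric
  test functions. They satisfy the boundary condition and vanish on the symmetry lines pointwise, so that the
  traces of their limit need no trace theorem: the minimizing sequence itself is the approximating sequence that
  the definition of a trace asks for (\<open>has_trace_limit\<close>).

  A minimizing sequence converges strongly in \<open>W\<^sup>1\<^sup>,\<^sup>2\<close>, and no weak topology is involved. The elastic density is a
  positive definite quadratic form in the gradient, because \<open>L\<^sub>2 > -1\<close> (\<open>f_el_ge_gradient\<close>), and the bulk density
  becomes convex after adding a multiple of \<open>|q|\<^sup>2\<close> (\<open>f_b_midpoint\<close>). The energy at the midpoint of two members of the
  sequence is at least the infimum, which bounds the \<open>L\<^sup>2\<close> distance of their gradients by that of their values.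
  The latter is made small by Rellich's theorem, proved here for test functions from Poincare inequalities on the
  cells of a grid (\<open>Rellich_test_functions\<close>).

  The Euler-Lagrange equation is derived along the sequence. Taylor expansion at an almost minimal field shows
  that the first variation in symmetric directions tends to \<open>0\<close>. For an arbitrary test function, averaging over
  the group does not change the first variation at a symmetric field (\<open>first_variation_symmetrize\<close>), so that it
  tends to \<open>0\<close> as well. Finally the first variations converge to that of the limit: the derivative of the
  bulk energy is cubic, and the energy bounds the fields in \<open>L\<^sup>4\<close> (\<open>direct_method\<close>).
\<close>

section \<open>Smooth functions and test functions\<close>

lemma smooth_differentiable: "smooth f \<Longrightarrow> f differentiable (at z)"
  unfolding smooth_def using foldr.simps(1) by (metis id_apply)

lemma smooth_dir_deriv: "smooth f \<Longrightarrow> smooth (dir_deriv e f)"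
  unfolding smooth_def
proof (intro allI)
  fix ds z
  assume "\<forall>ds z. foldr dir_deriv ds f differentiable at z"
  then have "foldr dir_deriv (ds @ [e]) f differentiable at z" by blast
  then show "foldr dir_deriv ds (dir_deriv e f) differentiable at z" by simp
qed

text \<open>Iterated derivatives never have to be computed: it suffices to exhibit a class of differentiable functions that
  is closed under directional derivatives.\<close>

lemma smooth_coinduct:
  assumes "f \<in> F"
    and diff: "\<And>f z. f \<in> F \<Longrightarrow> f differentiable (at z)"
    and deriv: "\<And>f e. f \<in> F \<Longrightarrow> dir_deriv e f \<in> F"
  shows "smooth f"
proof -
  have "foldr dir_deriv ds f \<in> F" for ds
    by (induction ds) (use assms in auto)
  then show ?thesis unfolding smooth_def using diff by blast
qed

lemma dir_deriv_eqI: "(f has_derivative D) (at z) \<Longrightarrow> dir_deriv e f z = D e"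
  unfolding dir_deriv_def by (metis frechet_derivative_at)

lemma smooth_has_derivative:
  "smooth f \<Longrightarrow> (f has_derivative (\<lambda>e. dir_deriv e f z)) (at z)"
  using frechet_derivative_works smooth_differentiable unfolding dir_deriv_def by blast

lemma smooth_continuous: "smooth f \<Longrightarrow> continuous_on S f"
  by (meson continuous_at_imp_continuous_on differentiable_imp_continuous_within smooth_differentiable)

lemma smooth_const: "smooth (\<lambda>_. c)"
proof (rule smooth_coinduct[where F = "{f. \<exists>c. f = (\<lambda>_. c)}"])
  fix f :: "'a \<Rightarrow> 'b" and e
  assume "f \<in> {f. \<exists>c. f = (\<lambda>_. c)}"
  then obtain c where f: "f = (\<lambda>_. c)" by auto
  have "dir_deriv e f = (\<lambda>_. 0)"
    unfolding f by (rule ext, rule dir_deriv_eqI[where D = "\<lambda>_. 0"]) (auto intro: derivative_eq_intros)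
  then show "dir_deriv e f \<in> {f. \<exists>c. f = (\<lambda>_. c)}" by auto
qed auto

lemma dir_deriv_bounded_linear:
  assumes "bounded_linear L" "smooth f"
  shows "dir_deriv e (\<lambda>z. L (f z)) z = L (dir_deriv e f z)"
  by (rule dir_deriv_eqI) (rule bounded_linear.has_derivative[OF assms(1) smooth_has_derivative[OF assms(2)]])

lemma smooth_bounded_linear:
  fixes f :: "'a::real_normed_vector \<Rightarrow> 'b::real_normed_vector"
    and L :: "'b \<Rightarrow> 'c::real_normed_vector"
  assumes L: "bounded_linear L" and "smooth f"
  shows "smooth (\<lambda>z. L (f z))"
proof (rule smooth_coinduct[where F = "{g. \<exists>f. smooth f \<and> g = (\<lambda>z. L (f z))}"])
  show "(\<lambda>z. L (f z)) \<in> {g. \<exists>f. smooth f \<and> g = (\<lambda>z. L (f z))}" using assms by auto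
next
  fix g :: "'a \<Rightarrow> 'c" and z
  assume "g \<in> {g. \<exists>f. smooth f \<and> g = (\<lambda>z. L (f z))}"
  then obtain f where "smooth f" "g = (\<lambda>z. L (f z))" by auto
  then show "g differentiable at z"
    unfolding differentiable_def
    using bounded_linear.has_derivative[OF L smooth_has_derivative] by blast
next
  fix g :: "'a \<Rightarrow> 'c" and e
  assume "g \<in> {g. \<exists>f. smooth f \<and> g = (\<lambda>z. L (f z))}"
  then show "dir_deriv e g \<in> {g. \<exists>f. smooth f \<and> g = (\<lambda>z. L (f z))}"
    using dir_deriv_bounded_linear[OF L] smooth_dir_deriv by blast
qed

lemma dir_deriv_add:
  assumes "smooth f" "smooth g"
  shows "dir_deriv e (\<lambda>z. f z + g z) z = dir_deriv e f z + dir_deriv e g z"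
  by (rule dir_deriv_eqI) (rule has_derivative_add[OF assms[THEN smooth_has_derivative]])

lemma smooth_add:
  fixes f g :: "'a::real_normed_vector \<Rightarrow> 'b::real_normed_vector"
  assumes "smooth f" "smooth g"
  shows "smooth (\<lambda>z. f z + g z)"
proof (rule smooth_coinduct[where F = "{h. \<exists>f g. smooth f \<and> smooth g \<and> h = (\<lambda>z. f z + g z)}"])
  fix h :: "'a \<Rightarrow> 'b" and e
  assume "h \<in> {h. \<exists>f g. smooth f \<and> smooth g \<and> h = (\<lambda>z. f z + g z)}"
  then show "dir_deriv e h \<in> {h. \<exists>f g. smooth f \<and> smooth g \<and> h = (\<lambda>z. f z + g z)}"
    using dir_deriv_add smooth_dir_deriv by blast
next
  fix h :: "'a \<Rightarrow> 'b" and z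
  assume "h \<in> {h. \<exists>f g. smooth f \<and> smooth g \<and> h = (\<lambda>z. f z + g z)}"
  then show "h differentiable (at z)" by (auto intro: differentiable_add smooth_differentiable)
next
  show "(\<lambda>z. f z + g z) \<in> {h. \<exists>f g. smooth f \<and> smooth g \<and> h = (\<lambda>z. f z + g z)}"
    using assms by blast
qed

lemma smooth_scaleR: "smooth f \<Longrightarrow> smooth (\<lambda>z. c *\<^sub>R f z)"
  using smooth_bounded_linear[OF bounded_linear_scaleR_right] .

lemma dir_deriv_compose_affine:
  assumes "bounded_linear T" "smooth f"
  shows "dir_deriv e (\<lambda>z. f (c + T z)) z = dir_deriv (T e) f (c + T z)"
proof (rule dir_deriv_eqI[where D = "\<lambda>e. dir_deriv (T e) f (c + T z)"])
  have "((\<lambda>z. c + T z) has_derivative T) (at z)"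
    using bounded_linear.has_derivative[OF assms(1) has_derivative_ident]
    by (auto intro!: derivative_eq_intros)
  from has_derivative_compose[OF this smooth_has_derivative[OF assms(2)]]
  show "((\<lambda>z. f (c + T z)) has_derivative (\<lambda>e. dir_deriv (T e) f (c + T z))) (at z)" .
qed

lemma smooth_compose_affine:
  fixes T :: "'a::real_normed_vector \<Rightarrow> 'b::real_normed_vector"
    and f :: "'b \<Rightarrow> 'c::real_normed_vector"
  assumes T: "bounded_linear T" and "smooth f"
  shows "smooth (\<lambda>z. f (c + T z))"
proof (rule smooth_coinduct[where F = "{h. \<exists>f. smooth f \<and> h = (\<lambda>z. f (c + T z))}"])
  fix h :: "'a \<Rightarrow> 'c" and e
  assume "h \<in> {h. \<exists>f. smooth f \<and> h = (\<lambda>z. f (c + T z))}"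
  then show "dir_deriv e h \<in> {h. \<exists>f. smooth f \<and> h = (\<lambda>z. f (c + T z))}"
    using dir_deriv_compose_affine[OF T] smooth_dir_deriv by blast
next
  fix h :: "'a \<Rightarrow> 'c" and z
  assume "h \<in> {h. \<exists>f. smooth f \<and> h = (\<lambda>z. f (c + T z))}"
  then obtain f where f: "smooth f" and h: "h = (\<lambda>z. f (c + T z))" by auto
  have "(\<lambda>z. c + T z) differentiable at z"
    using bounded_linear.has_derivative[OF T has_derivative_ident]
    by (auto simp: differentiable_def intro!: derivative_eq_intros exI)
  then show "h differentiable at z"
    unfolding h using smooth_differentiable[OF f] by (rule differentiable_compose[rotated])
qed (use assms in auto)

text \<open>The class used for the product rule. A derivative of a product is no longer a product, but a sum of products is
  mapped to sums of products.\<close>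

inductive sum_of_products :: "('a::real_normed_vector \<Rightarrow> real) \<Rightarrow> bool" where
  product: "smooth f \<Longrightarrow> smooth g \<Longrightarrow> sum_of_products (\<lambda>z. f z * g z)"
| sum: "sum_of_products f \<Longrightarrow> sum_of_products g \<Longrightarrow> sum_of_products (\<lambda>z. f z + g z)"

lemma smooth_mult:
  fixes f g :: "'a::real_normed_vector \<Rightarrow> real"
  assumes "smooth f" "smooth g"
  shows "smooth (\<lambda>z. f z * g z)"
proof -
  have *: "(\<forall>z. h differentiable (at z)) \<and> (\<forall>e. sum_of_products (dir_deriv e h))"
    if "sum_of_products h" for h :: "'a \<Rightarrow> real"
    using that
  proof induction
    case (product f g)
    have "dir_deriv e (\<lambda>z. f z * g z) = (\<lambda>z. f z * dir_deriv e g z + dir_deriv e f z * g z)" for e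
      by (rule ext, rule dir_deriv_eqI)
        (rule has_derivative_mult[OF product.hyps[THEN smooth_has_derivative]])
    then show ?case
      by (simp only:) (intro conjI allI differentiable_mult smooth_differentiable
          sum_of_products.intros smooth_dir_deriv product.hyps)
  next
    case (sum f g)
    have "dir_deriv e (\<lambda>z. f z + g z) = (\<lambda>z. dir_deriv e f z + dir_deriv e g z)" for e
    proof
      fix z
      have "(f has_derivative (\<lambda>e. dir_deriv e f z)) (at z)"
        "(g has_derivative (\<lambda>e. dir_deriv e g z)) (at z)"
        using sum.IH unfolding dir_deriv_def by (auto simp: frechet_derivative_works[symmetric])
      from has_derivative_add[OF this]
      show "dir_deriv e (\<lambda>z. f z + g z) z = dir_deriv e f z + dir_deriv e g z"
        by (rule dir_deriv_eqI)
    qed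
    then show ?case
      using sum.IH by (simp add: sum_of_products.sum differentiable_add)
  qed
  show ?thesis
    by (rule smooth_coinduct[where F = "Collect sum_of_products"])
      (use * assms in \<open>simp_all add: sum_of_products.product\<close>)
qed

lemma smooth_prod:
  fixes f :: "'i \<Rightarrow> 'a::real_normed_vector \<Rightarrow> real"
  assumes "finite I" "\<And>i. i \<in> I \<Longrightarrow> smooth (f i)"
  shows "smooth (\<lambda>z. \<Prod>i\<in>I. f i z)"
  using assms by (induction I rule: finite_induct) (auto intro: smooth_const smooth_mult)

lemma smooth_power:
  fixes f :: "'a::real_normed_vector \<Rightarrow> real"
  assumes "smooth f" shows "smooth (\<lambda>z. f z ^ n)"
  by (induction n) (auto intro: smooth_const smooth_mult assms)

lemma test_function_smooth: "test_function S \<phi> \<Longrightarrow> smooth \<phi>"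
  by (simp add: test_function_def)

lemma test_functionI:
  "smooth \<phi> \<Longrightarrow> compact K \<Longrightarrow> K \<subseteq> S \<Longrightarrow> (\<And>z. z \<notin> K \<Longrightarrow> \<phi> z = 0) \<Longrightarrow> test_function S \<phi>"
  unfolding test_function_def by blast

lemma test_function_add:
  assumes "test_function S \<phi>" "test_function S \<psi>" shows "test_function S (\<lambda>z. \<phi> z + \<psi> z)"
proof -
  obtain K K' where "compact K" "K \<subseteq> S" "\<And>z. z \<notin> K \<Longrightarrow> \<phi> z = 0" "compact K'" "K' \<subseteq> S" "\<And>z. z \<notin> K' \<Longrightarrow> \<psi> z = 0"
    using assms unfolding test_function_def by metis
  then show ?thesis
    using assms by (intro test_functionI[where K = "K \<union> K'"]) (auto intro: smooth_add test_function_smooth)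
qed

lemma test_function_act:
  assumes T: "bounded_linear T" "\<And>z. T (T z) = z" "\<And>z. T z \<in> S \<longleftrightarrow> z \<in> S"
    and D: "bounded_linear D" and \<phi>: "test_function S \<phi>"
  shows "test_function S (\<lambda>z. D (\<phi> (T z)))"
proof -
  obtain K where K: "smooth \<phi>" "compact K" "K \<subseteq> S" "\<And>z. z \<notin> K \<Longrightarrow> \<phi> z = 0"
    using \<phi> unfolding test_function_def by blast
  have "smooth (\<lambda>z. D (\<phi> (0 + T z)))"
    by (intro smooth_bounded_linear[OF D] smooth_compose_affine[OF T(1)] K(1))
  then have "smooth (\<lambda>z. D (\<phi> (T z)))" by simp
  moreover have "compact (T ` K)"
    by (intro compact_continuous_image linear_continuous_on T(1) K(2))
  moreover have "T ` K \<subseteq> S" using K(3) T(3) by blast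
  moreover have "D (\<phi> (T z)) = 0" if "z \<notin> T ` K" for z
  proof -
    have "T z \<notin> K" using that T(2) by (metis imageI)
    then show ?thesis using K(4) linear_0[OF bounded_linear.linear[OF D]] by simp
  qed
  ultimately show ?thesis by (rule test_functionI)
qed

lemma dir_deriv_act:
  assumes T: "bounded_linear T" and D: "bounded_linear D" and \<phi>: "smooth \<phi>"
  shows "dir_deriv e (\<lambda>z. D (\<phi> (T z))) z = D (dir_deriv (T e) \<phi> (T z))"
proof -
  have s: "smooth (\<lambda>z. \<phi> (T z))" using smooth_compose_affine[OF T \<phi>, of 0] by simp
  show ?thesis
    unfolding dir_deriv_bounded_linear[OF D s]
    using dir_deriv_compose_affine[OF T \<phi>, of e 0 z] by simp
qed

lemma dir_deriv_minus: "smooth \<phi> \<Longrightarrow> dir_deriv (- e) \<phi> z = - dir_deriv e \<phi> z"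
  using linear_neg[OF has_derivative_linear[OF smooth_has_derivative]] .

text \<open>The functions \<open>p (1 / x) exp (- 1 / x)\<close> on the positive half line, extended by \<open>0\<close>. Allowing an arbitrary
  polynomial \<open>p\<close> makes the family closed under differentiation, hence smooth by coinduction.\<close>

definition flat_exp :: "real poly \<Rightarrow> real \<Rightarrow> real"
  where "flat_exp p x = (if x > 0 then poly p (1 / x) * exp (- 1 / x) else 0)"

lemma poly_times_exp_tendsto_0: "((\<lambda>x. poly p x * exp (- x)) \<longlongrightarrow> 0) (at_top :: real filter)"
proof -
  have "((\<lambda>x. \<Sum>i\<le>degree p. coeff p i * (x ^ i / exp x)) \<longlongrightarrow> (\<Sum>i\<le>degree p. coeff p i * 0)) at_top"
    by (intro tendsto_sum tendsto_mult tendsto_const tendsto_power_div_exp_0)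
  then show ?thesis
    by (simp add: poly_altdef exp_minus divide_inverse sum_distrib_right mult.assoc)
qed

lemma flat_exp_over_tendsto_0: "((\<lambda>x. flat_exp p x / x) \<longlongrightarrow> 0) (at 0)"
proof -
  have "((\<lambda>x. poly (pCons 0 p) (inverse x) * exp (- inverse x)) \<longlongrightarrow> 0) (at_right 0)"
    by (rule filterlim_compose[OF poly_times_exp_tendsto_0 filterlim_inverse_at_top_right])
  then have "((\<lambda>x. flat_exp p x / x) \<longlongrightarrow> 0) (at_right 0)"
    by (rule Lim_transform_eventually)
      (auto simp: eventually_at_filter flat_exp_def field_simps)
  moreover have "((\<lambda>x. flat_exp p x / x) \<longlongrightarrow> 0) (at_left 0)"
    by (rule Lim_transform_eventually[OF tendsto_const])
      (auto simp: eventually_at_filter flat_exp_def)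
  ultimately show ?thesis by (simp add: filterlim_split_at)
qed

lemma flat_exp_has_derivative:
  "(flat_exp p has_real_derivative flat_exp ([:0, 0, 1:] * (p - pderiv p)) x) (at x)"
proof -
  consider "x > 0" | "x < 0" | "x = 0" by linarith
  then show ?thesis
  proof cases
    case 1
    have "((\<lambda>x. poly p (1 / x) * exp (- 1 / x)) has_real_derivative
        flat_exp ([:0, 0, 1:] * (p - pderiv p)) x) (at x)"
      using 1 by (auto intro!: derivative_eq_intros DERIV_chain2[OF poly_DERIV]
          simp: flat_exp_def field_simps power2_eq_square)
    then show ?thesis
      by (rule has_field_derivative_transform_within_open[where S = "{0<..}"])
        (use 1 in \<open>auto simp: flat_exp_def\<close>)
  next
    case 2
    have "((\<lambda>_. 0) has_real_derivative flat_exp ([:0, 0, 1:] * (p - pderiv p)) x) (at x)"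
      using 2 by (auto simp: flat_exp_def)
    then show ?thesis
      by (rule has_field_derivative_transform_within_open[where S = "{..<0}"])
        (use 2 in \<open>auto simp: flat_exp_def\<close>)
  next
    case 3
    show ?thesis
      using flat_exp_over_tendsto_0[of p] unfolding 3 has_field_derivative_iff
      by (simp add: flat_exp_def[of _ 0])
  qed
qed

lemma smooth_flat_exp: "smooth (flat_exp p)"
proof (rule smooth_coinduct[where F = "{f. \<exists>c p. f = (\<lambda>x. c * flat_exp p x)}"])
  have "flat_exp p = (\<lambda>x. 1 * flat_exp p x)" by simp
  then show "flat_exp p \<in> {f. \<exists>c p. f = (\<lambda>x. c * flat_exp p x)}" by blast
next
  fix f :: "real \<Rightarrow> real" and z
  assume "f \<in> {f. \<exists>c p. f = (\<lambda>x. c * flat_exp p x)}"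
  then obtain c p where "f = (\<lambda>x. c * flat_exp p x)" by auto
  then show "f differentiable at z"
    using DERIV_cmult[OF flat_exp_has_derivative] real_differentiable_def by blast
next
  fix f :: "real \<Rightarrow> real" and e
  assume "f \<in> {f. \<exists>c p. f = (\<lambda>x. c * flat_exp p x)}"
  then obtain c p where f: "f = (\<lambda>x. c * flat_exp p x)" by auto
  have "dir_deriv e f x = (c * e) * flat_exp ([:0, 0, 1:] * (p - pderiv p)) x" for x
    using dir_deriv_eqI[OF DERIV_cmult[OF flat_exp_has_derivative[of p x], of c,
          unfolded has_field_derivative_def], of e]
    unfolding f by simp
  then show "dir_deriv e f \<in> {f. \<exists>c p. f = (\<lambda>x. c * flat_exp p x)}" by blast
qed

definition bump :: "'a::euclidean_space \<Rightarrow> 'a \<Rightarrow> 'a \<Rightarrow> real"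
  where "bump a b z = (\<Prod>i\<in>Basis. flat_exp 1 (z \<bullet> i - a \<bullet> i) * flat_exp 1 (b \<bullet> i - z \<bullet> i))"

lemma smooth_bump: "smooth (bump a b)"
proof -
  have "smooth (\<lambda>z. flat_exp 1 (- (a \<bullet> i) + z \<bullet> i))" "smooth (\<lambda>z. flat_exp 1 (b \<bullet> i + - (z \<bullet> i)))" for i
    by (intro smooth_compose_affine smooth_flat_exp bounded_linear_inner_left
        bounded_linear_minus)+
  then have "smooth (\<lambda>z. \<Prod>i\<in>Basis. flat_exp 1 (- (a \<bullet> i) + z \<bullet> i) * flat_exp 1 (b \<bullet> i + - (z \<bullet> i)))"
    by (intro smooth_prod finite_Basis smooth_mult)
  then show ?thesis by (simp add: bump_def[abs_def] add.commute)
qed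

lemma flat_exp_1_bounds: "0 \<le> flat_exp 1 x" "flat_exp 1 x \<le> 1" "flat_exp 1 x > 0 \<longleftrightarrow> x > 0"
  by (simp_all add: flat_exp_def)

lemma bump_bounds: "0 \<le> bump a b z" "bump a b z \<le> 1"
  unfolding bump_def
  by (rule prod_nonneg prod_le_1; simp add: mult_le_one flat_exp_1_bounds(1,2))+

lemma bump_pos_iff: "bump a b z > 0 \<longleftrightarrow> z \<in> box a b"
proof
  assume pos: "bump a b z > 0"
  have "a \<bullet> i < z \<bullet> i \<and> z \<bullet> i < b \<bullet> i" if "i \<in> Basis" for i
  proof -
    have "flat_exp 1 (z \<bullet> i - a \<bullet> i) * flat_exp 1 (b \<bullet> i - z \<bullet> i) \<noteq> 0"
    proof
      assume "flat_exp 1 (z \<bullet> i - a \<bullet> i) * flat_exp 1 (b \<bullet> i - z \<bullet> i) = 0"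
      then have "bump a b z = 0" unfolding bump_def by (intro prod_zero finite_Basis bexI[OF _ that])
      with pos show False by simp
    qed
    then have "flat_exp 1 (z \<bullet> i - a \<bullet> i) > 0" "flat_exp 1 (b \<bullet> i - z \<bullet> i) > 0"
      using flat_exp_1_bounds(1)[of "z \<bullet> i - a \<bullet> i"] flat_exp_1_bounds(1)[of "b \<bullet> i - z \<bullet> i"]
      by (simp_all add: less_le)
    then show ?thesis unfolding flat_exp_1_bounds(3) by simp
  qed
  then show "z \<in> box a b" by (simp add: mem_box)
next
  assume z: "z \<in> box a b"
  show "bump a b z > 0"
    unfolding bump_def
  proof (rule prod_pos, rule mult_pos_pos)
    fix i :: 'a assume "i \<in> Basis"
    with z show "flat_exp 1 (z \<bullet> i - a \<bullet> i) > 0" "flat_exp 1 (b \<bullet> i - z \<bullet> i) > 0"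
      unfolding flat_exp_1_bounds(3) by (simp_all add: mem_box)
  qed
qed

section \<open>The fundamental lemma of the calculus of variations\<close>

lemma absolutely_integrable_iff_lebesgue_on:
  fixes f :: "'a::euclidean_space \<Rightarrow> 'b::euclidean_space"
  assumes "S \<in> sets lebesgue"
  shows "f absolutely_integrable_on S \<longleftrightarrow> integrable (lebesgue_on S) f"
  using assms by (simp add: set_integrable_def integrable_restrict_space)

lemma LINT_lebesgue_on_zero_outside:
  fixes f :: "'a::euclidean_space \<Rightarrow> 'b::euclidean_space"
  assumes "S \<in> sets lebesgue" "T \<in> sets lebesgue" "\<And>z. z \<notin> S \<inter> T \<Longrightarrow> f z = 0"
  shows "(LINT z|lebesgue_on S. f z) = (LINT z|lebesgue_on T. f z)"
proof -
  have eq: "indicator S z *\<^sub>R f z = indicator T z *\<^sub>R f z" for z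
    using assms(3)[of z] by (auto simp: indicator_def)
  show ?thesis using assms(1,2) by (subst (1 2) integral_restrict_space) (simp_all add: eq)
qed

text \<open>A polynomial in the bump function, hence smooth, with the same zero set; as \<open>n\<close> grows it tends boundedly to the
  indicator of the open box. This replaces mollification below.\<close>

definition box_cutoff :: "'a::euclidean_space \<Rightarrow> 'a \<Rightarrow> nat \<Rightarrow> 'a \<Rightarrow> real"
  where "box_cutoff a b n z = 1 - (1 - bump a b z) ^ n"

lemma box_cutoff_outside: "z \<notin> box a b \<Longrightarrow> box_cutoff a b n z = 0"
  using bump_pos_iff[of a b z] bump_bounds(1)[of a b z] by (simp add: box_cutoff_def)

lemma box_cutoff_bounds: "0 \<le> box_cutoff a b n z" "box_cutoff a b n z \<le> 1"
  using bump_bounds[of a b z] by (auto simp: box_cutoff_def intro: power_le_one)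

lemma box_cutoff_tendsto: "(\<lambda>n. box_cutoff a b n z) \<longlonglongrightarrow> indicator (box a b) z"
proof (cases "z \<in> box a b")
  case True
  then have "(\<lambda>n. (1 - bump a b z) ^ n) \<longlonglongrightarrow> 0"
    using bump_pos_iff[of a b z] bump_bounds(2)[of a b z] by (intro LIMSEQ_power_zero) auto
  from tendsto_diff[OF tendsto_const[of 1] this] True show ?thesis
    unfolding box_cutoff_def by simp
qed (simp add: box_cutoff_outside)

lemma test_function_box_cutoff:
  assumes "cbox a b \<subseteq> S"
  shows "test_function S (box_cutoff a b n)"
proof (rule test_functionI[OF _ compact_cbox assms])
  have "smooth (\<lambda>z. 1 + (-1) *\<^sub>R (1 + (-1) *\<^sub>R bump a b z) ^ n)"
    by (intro smooth_add smooth_const smooth_scaleR smooth_power smooth_bump)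
  then show "smooth (box_cutoff a b n)" by (simp add: box_cutoff_def[abs_def])
qed (use box_subset_cbox box_cutoff_outside in blast)

text \<open>The boxes are an intersection-stable generator of the Borel sets, and a Lebesgue set differs from a Borel set by
  a null set.\<close>

lemma AE_zero_if_box_integrals_zero:
  fixes f :: "'a::euclidean_space \<Rightarrow> 'b::euclidean_space"
  assumes f: "integrable lebesgue f"
    and box: "\<And>a b. (LINT z:box a b|lebesgue. f z) = 0"
    and total: "(LINT z|lebesgue. f z) = 0"
  shows "AE z in lebesgue. f z = 0"
proof -
  have borel: "set_integrable lebesgue A f" if "A \<in> sets lebesgue" for A
    using f that unfolding set_integrable_def by (rule integrable_mult_indicator[rotated])
  have zero: "(LINT z:A|lebesgue. f z) = 0" if "A \<in> sets borel" for A :: "'a set"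
  proof -
    have "Int_stable (range (\<lambda>(a::'a, b). box a b))"
    proof (rule Int_stableI)
      fix X Y :: "'a set"
      assume "X \<in> range (\<lambda>(a, b). box a b)" "Y \<in> range (\<lambda>(a, b). box a b)"
      then obtain a b c d where XY: "X = box a b" "Y = box c d" by auto
      show "X \<inter> Y \<in> range (\<lambda>(a, b). box a b)"
        unfolding XY box_Int_box by (rule range_eqI[where x = "(p, q)" for p q]) simp
    qed
    moreover have "range (\<lambda>(a::'a, b). box a b) \<subseteq> Pow UNIV" by simp
    moreover have "A \<in> sigma_sets UNIV (range (\<lambda>(a, b). box a b))"
      using that by (simp add: borel_eq_box)
    ultimately show ?thesis
    proof (induction rule: sigma_sets_induct_disjoint)
      case (basic A)
      then show ?case using box by auto
    next
      case empty
      then show ?case by (simp add: set_lebesgue_integral_def)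
    next
      case (compl A)
      then have A: "A \<in> sets borel" by (simp add: borel_eq_box)
      have "(LINT z|lebesgue. f z) = (LINT z:A \<union> (UNIV - A)|lebesgue. f z)"
        by (simp add: set_lebesgue_integral_def)
      also have "\<dots> = (LINT z:A|lebesgue. f z) + (LINT z:UNIV - A|lebesgue. f z)"
        by (rule set_integral_Un) (use A borel in auto)
      finally show ?case using compl total by simp
    next
      case (union A)
      then have A: "A i \<in> sets borel" for i by (auto simp: borel_eq_box)
      have "(LINT z:(\<Union>i. A i)|lebesgue. f z) = (\<Sum>i. (LINT z:A i|lebesgue. f z))"
        by (rule lebesgue_integral_countable_add) (use A union borel in \<open>auto simp: disjoint_family_on_def\<close>)
      then show ?case using union by simp
    qed
  qed
  have lebesgue_zero: "(LINT z:A|lebesgue. f z) = 0" if A: "A \<in> sets lebesgue" for A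
  proof -
    have "(LINT z:A|lebesgue. f z) = (LINT z:main_part lborel A|lebesgue. f z)"
    proof (rule set_integral_null_delta[OF f A])
      show "main_part lborel A \<in> sets lebesgue" using main_part_sets[OF A] by simp
      have "A - main_part lborel A \<union> (main_part lborel A - A) \<subseteq> null_part lborel A"
        using main_part_null_part_Un[OF A] by auto
      moreover obtain N where "N \<in> null_sets lborel" "null_part lborel A \<subseteq> N"
        using null_part[OF A] by blast
      ultimately show "sym_diff A (main_part lborel A) \<in> null_sets lebesgue"
        by (meson null_sets_completion_subset null_sets_completionI order_trans)
    qed
    also have "\<dots> = 0" using zero main_part_sets[OF A] by simp
    finally show ?thesis .
  qed
  have "AE z in lebesgue. f z \<bullet> b = 0" for b
  proof (rule density_unique_real)
    show "integrable lebesgue (\<lambda>z. f z \<bullet> b)" using f by simp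
    fix A :: "'a set" assume A: "A \<in> sets lebesgue"
    have "(LINT z:A|lebesgue. f z \<bullet> b) = (LINT z:A|lebesgue. f z) \<bullet> b"
      using borel[OF A] unfolding set_lebesgue_integral_def set_integrable_def
      by (simp flip: integral_inner_left)
    then show "(LINT z:A|lebesgue. f z \<bullet> b) = (LINT z:A|lebesgue. 0)"
      using lebesgue_zero[OF A] by (simp add: set_lebesgue_integral_def)
  qed simp
  then have "AE z in lebesgue. \<forall>b\<in>Basis. f z \<bullet> b = 0"
    by (simp add: AE_finite_all)
  then show ?thesis by eventually_elim (simp add: euclidean_all_zero_iff)
qed

text \<open>Testing against the cutoffs of a box and passing to the limit gives the vanishing of the integral over the box;
  countably many boxes cover the open set.\<close>

lemma AE_zero_if_orthogonal_to_test_functions: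
  fixes v :: "'a::euclidean_space \<Rightarrow> 'b::euclidean_space"
  assumes "open S" and v: "locally_integrable S v"
    and orth: "\<And>\<phi> :: 'a \<Rightarrow> real. test_function S \<phi> \<Longrightarrow> (LINT z|lebesgue_on S. \<phi> z *\<^sub>R v z) = 0"
  shows "AE z in lebesgue_on S. v z = 0"
proof -
  have S: "S \<in> sets lebesgue" using \<open>open S\<close> by simp
  have box_zero: "(LINT z:box a b|lebesgue. v z) = 0" if ab: "cbox a b \<subseteq> S" for a b
  proof -
    have vi: "integrable lebesgue (\<lambda>z. indicator (cbox a b) z *\<^sub>R v z)"
      using v that unfolding locally_integrable_def set_integrable_def by auto
    have "(\<lambda>n. LINT z|lebesgue. box_cutoff a b n z *\<^sub>R indicator (cbox a b) z *\<^sub>R v z)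
      \<longlonglongrightarrow> (LINT z|lebesgue. indicator (box a b) z *\<^sub>R indicator (cbox a b) z *\<^sub>R v z)"
    proof (rule integral_dominated_convergence[where w = "\<lambda>z. norm (indicator (cbox a b) z *\<^sub>R v z)"])
      have "box_cutoff a b n \<in> borel_measurable lebesgue" for n
        using smooth_continuous[OF test_function_smooth[OF test_function_box_cutoff[OF ab]], of UNIV n]
        by (intro measurable_completion) (simp add: borel_measurable_continuous_onI)
      then show "(\<lambda>z. box_cutoff a b n z *\<^sub>R indicator (cbox a b) z *\<^sub>R v z) \<in> borel_measurable lebesgue" for n
        by (intro borel_measurable_scaleR[OF _ borel_measurable_integrable[OF vi]])
      show "(\<lambda>z. indicator (box a b) z *\<^sub>R indicator (cbox a b) z *\<^sub>R v z) \<in> borel_measurable lebesgue"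
        by (intro borel_measurable_scaleR[OF _ borel_measurable_integrable[OF vi]]
            borel_measurable_indicator) simp
      show "AE z in lebesgue. (\<lambda>n. box_cutoff a b n z *\<^sub>R indicator (cbox a b) z *\<^sub>R v z)
          \<longlonglongrightarrow> indicator (box a b) z *\<^sub>R indicator (cbox a b) z *\<^sub>R v z"
        by (intro AE_I2 tendsto_scaleR box_cutoff_tendsto tendsto_const)
      show "AE z in lebesgue. norm (box_cutoff a b n z *\<^sub>R indicator (cbox a b) z *\<^sub>R v z)
          \<le> norm (indicator (cbox a b) z *\<^sub>R v z)" for n
      proof (intro AE_I2)
        fix z
        have "norm (box_cutoff a b n z *\<^sub>R indicator (cbox a b) z *\<^sub>R v z)
          = box_cutoff a b n z * norm (indicator (cbox a b) z *\<^sub>R v z)"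
          using box_cutoff_bounds(1)[of a b n z] by simp
        also have "\<dots> \<le> norm (indicator (cbox a b) z *\<^sub>R v z)"
          by (rule mult_left_le_one_le) (use box_cutoff_bounds in auto)
        finally show "norm (box_cutoff a b n z *\<^sub>R indicator (cbox a b) z *\<^sub>R v z)
          \<le> norm (indicator (cbox a b) z *\<^sub>R v z)" .
      qed
    qed (rule integrable_norm[OF vi])
    moreover have "(LINT z|lebesgue. box_cutoff a b n z *\<^sub>R indicator (cbox a b) z *\<^sub>R v z) = 0" for n
    proof -
      have "(LINT z|lebesgue. box_cutoff a b n z *\<^sub>R indicator (cbox a b) z *\<^sub>R v z)
        = (LINT z|lebesgue. indicator S z *\<^sub>R (box_cutoff a b n z *\<^sub>R v z))"
      proof (intro Bochner_Integration.integral_cong refl)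
        fix z
        show "box_cutoff a b n z *\<^sub>R indicator (cbox a b) z *\<^sub>R v z
          = indicator S z *\<^sub>R (box_cutoff a b n z *\<^sub>R v z)"
          using ab box_cutoff_outside[of z a b n] box_subset_cbox[of a b]
          by (cases "z \<in> box a b") (auto simp: indicator_def)
      qed
      also have "\<dots> = (LINT z|lebesgue_on S. box_cutoff a b n z *\<^sub>R v z)"
        using S by (simp add: integral_restrict_space)
      finally show ?thesis using orth[OF test_function_box_cutoff[OF ab]] by simp
    qed
    ultimately have "(\<lambda>_. 0) \<longlonglongrightarrow> (LINT z|lebesgue. indicator (box a b) z *\<^sub>R indicator (cbox a b) z *\<^sub>R v z)"
      by (simp only:)
    then have "(LINT z|lebesgue. indicator (box a b) z *\<^sub>R indicator (cbox a b) z *\<^sub>R v z) = 0"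
      by (rule LIMSEQ_unique[OF _ tendsto_const])
    moreover have "(\<lambda>z. indicator (box a b) z *\<^sub>R indicator (cbox a b) z *\<^sub>R v z)
      = (\<lambda>z. indicator (box a b) z *\<^sub>R v z)"
      using box_subset_cbox[of a b] by (intro ext) (auto simp: indicator_def)
    ultimately show ?thesis by (simp only: set_lebesgue_integral_def)
  qed
  have AE_box: "AE z in lebesgue. z \<in> box a b \<longrightarrow> v z = 0" if ab: "cbox a b \<subseteq> S" for a b
  proof -
    let ?f = "\<lambda>z. indicator (box a b) z *\<^sub>R v z"
    have "v absolutely_integrable_on cbox a b"
      using v ab unfolding locally_integrable_def by auto
    then have "v absolutely_integrable_on box a b"
      by (rule set_integrable_subset) (use box_subset_cbox in auto)
    then have "integrable lebesgue ?f"
      unfolding set_integrable_def .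
    moreover have "(LINT z:box c d|lebesgue. ?f z) = 0" for c d
    proof -
      obtain p q where pq: "box c d \<inter> box a b = box p q" using box_Int_box by blast
      show ?thesis
      proof (cases "box p q = {}")
        case True
        with pq have "(\<lambda>z. indicator (box c d) z *\<^sub>R ?f z) = (\<lambda>_. 0)"
          by (intro ext) (auto simp: indicator_def)
        then show ?thesis by (simp only: set_lebesgue_integral_def integral_zero)
      next
        case False
        have "box p q \<subseteq> box a b" using pq by auto
        then have "cbox p q \<subseteq> cbox a b" 
          unfolding closure_box[OF False, symmetric]
          by (intro closure_minimal) (use box_subset_cbox in auto)
        have "(\<lambda>z. indicator (box c d) z *\<^sub>R ?f z) = (\<lambda>z. indicator (box p q) z *\<^sub>R v z)"
          using pq by (intro ext) (auto simp: indicator_def)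
        then show ?thesis using box_zero[of p q] \<open>cbox p q \<subseteq> cbox a b\<close> ab
          by (simp only: set_lebesgue_integral_def)
      qed
    qed
    moreover have "(LINT z|lebesgue. ?f z) = 0"
      using box_zero[OF ab] by (simp only: set_lebesgue_integral_def)
    ultimately have "AE z in lebesgue. ?f z = 0" by (rule AE_zero_if_box_integrals_zero)
    then show ?thesis by eventually_elim (auto simp: indicator_def)
  qed
  \<comment> \<open>Closed boxes cover \<open>S\<close>; they differ from the open ones by null sets.\<close>
  obtain \<D> where \<D>: "countable \<D>" "\<D> \<subseteq> Pow S" "\<And>X. X \<in> \<D> \<Longrightarrow> \<exists>a b. X = cbox a b" "\<Union>\<D> = S"
    using open_countable_Union_open_cbox[OF \<open>open S\<close>] by blast
  have "AE z in lebesgue. z \<in> X \<longrightarrow> v z = 0" if X: "X \<in> \<D>" for X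
  proof -
    obtain a b where ab: "X = cbox a b" "cbox a b \<subseteq> S" using \<D>(2,3) X by blast
    have "cbox a b - box a b \<in> null_sets lebesgue"
      using negligible_frontier_interval by (simp add: negligible_iff_null_sets)
    from AE_not_in[OF this] AE_box[OF ab(2)] show ?thesis
      by eventually_elim (use ab in auto)
  qed
  then have "AE z in lebesgue. \<forall>X\<in>\<D>. z \<in> X \<longrightarrow> v z = 0"
    by (subst AE_ball_countable[OF \<D>(1)]) (intro ballI)
  then have "AE z in lebesgue. z \<in> S \<longrightarrow> v z = 0"
    by eventually_elim (use \<D>(4) in auto)
  then show ?thesis using S by (simp add: AE_restrict_space_iff)
qed

section \<open>Weak derivatives\<close>

lemma compact_in_lebesgue: "compact K \<Longrightarrow> K \<in> sets lebesgue"
  using lmeasurable_compact fmeasurableD by blast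

lemma test_function_bounded:
  fixes \<phi> :: "'a::euclidean_space \<Rightarrow> 'b::euclidean_space"
  assumes "continuous_on UNIV \<phi>" "compact K" "\<And>z. z \<notin> K \<Longrightarrow> \<phi> z = 0"
  obtains B where "\<And>z. norm (\<phi> z) \<le> B"
proof -
  have "compact (\<phi> ` K)" using assms by (meson compact_continuous_image continuous_on_subset subset_UNIV)
  then obtain B where B: "\<And>y. y \<in> \<phi> ` K \<Longrightarrow> norm y \<le> B" by (meson bounded_iff compact_imp_bounded)
  show thesis
  proof
    fix z show "norm (\<phi> z) \<le> max B 0" using B[of "\<phi> z"] assms(3)[of z] by (cases "z \<in> K") auto
  qed
qed

lemma dir_deriv_zero_outside:
  assumes "compact K" "\<And>z. z \<notin> K \<Longrightarrow> \<phi> z = 0" "z \<notin> K"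
  shows "dir_deriv e \<phi> z = 0"
proof (rule dir_deriv_eqI[where D = "\<lambda>_. 0"])
  have "((\<lambda>_. 0) has_derivative (\<lambda>_. 0)) (at z)" by simp
  then show "(\<phi> has_derivative (\<lambda>_. 0)) (at z)"
    by (rule has_derivative_transform_within_open[of _ _ z UNIV "- K"])
      (use assms compact_imp_closed in auto)
qed

lemma locally_integrable_mult:
  fixes v :: "'a::euclidean_space \<Rightarrow> 'b::euclidean_space" and \<psi> :: "'a \<Rightarrow> real"
  assumes S: "S \<in> sets lebesgue" and v: "locally_integrable S v"
    and \<psi>: "continuous_on UNIV \<psi>" and K: "compact K" "K \<subseteq> S" "\<And>z. z \<notin> K \<Longrightarrow> \<psi> z = 0"
  shows "integrable (lebesgue_on S) (\<lambda>z. \<psi> z *\<^sub>R v z)"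
proof -
  obtain B where B: "\<And>z. norm (\<psi> z) \<le> B" using test_function_bounded[OF \<psi> K(1,3)] by blast
  have vi: "integrable lebesgue (\<lambda>z. indicator K z *\<^sub>R v z)"
    using v K unfolding locally_integrable_def set_integrable_def by auto
  have "integrable lebesgue (\<lambda>z. \<psi> z *\<^sub>R indicator K z *\<^sub>R v z)"
  proof (rule Bochner_Integration.integrable_bound)
    show "integrable lebesgue (\<lambda>z. B *\<^sub>R indicator K z *\<^sub>R v z)" using vi by (rule integrable_scaleR_right)
    have "\<psi> \<in> borel_measurable lebesgue"
      using \<psi> by (intro measurable_completion) (simp add: borel_measurable_continuous_onI)
    then show "(\<lambda>z. \<psi> z *\<^sub>R indicator K z *\<^sub>R v z) \<in> borel_measurable lebesgue"
      by (rule borel_measurable_scaleR[OF _ borel_measurable_integrable[OF vi]])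
    show "AE z in lebesgue. norm (\<psi> z *\<^sub>R indicator K z *\<^sub>R v z) \<le> norm (B *\<^sub>R indicator K z *\<^sub>R v z)"
      using B by (intro AE_I2) (simp add: indicator_def mult_right_mono order_trans[OF _ abs_ge_self])
  qed
  moreover have "(\<lambda>z. \<psi> z *\<^sub>R indicator K z *\<^sub>R v z) = (\<lambda>z. indicator S z *\<^sub>R (\<psi> z *\<^sub>R v z))"
    using K by (intro ext) (auto simp: indicator_def)
  ultimately have "integrable lebesgue (\<lambda>z. indicator S z *\<^sub>R (\<psi> z *\<^sub>R v z))" by (simp only:)
  then show ?thesis using S by (simp add: integrable_restrict_space)
qed

lemma test_function_mult_integrable:
  fixes v :: "'a::euclidean_space \<Rightarrow> 'b::euclidean_space" and \<phi> :: "'a \<Rightarrow> real"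
  assumes "S \<in> sets lebesgue" "locally_integrable S v" "test_function S \<phi>"
  shows "integrable (lebesgue_on S) (\<lambda>z. \<phi> z *\<^sub>R v z)"
    "integrable (lebesgue_on S) (\<lambda>z. dir_deriv e \<phi> z *\<^sub>R v z)"
proof -
  obtain K where K: "smooth \<phi>" "compact K" "K \<subseteq> S" "\<And>z. z \<notin> K \<Longrightarrow> \<phi> z = 0"
    using assms(3) unfolding test_function_def by blast
  show "integrable (lebesgue_on S) (\<lambda>z. \<phi> z *\<^sub>R v z)"
    using locally_integrable_mult[OF assms(1,2) smooth_continuous[OF K(1)] K(2-4)] .
  show "integrable (lebesgue_on S) (\<lambda>z. dir_deriv e \<phi> z *\<^sub>R v z)"
    using locally_integrable_mult[OF assms(1,2) smooth_continuous[OF smooth_dir_deriv[OF K(1)]] K(2,3)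
        dir_deriv_zero_outside[OF K(2,4)]] .
qed

lemma locally_integrable_bounded_linear:
  fixes u :: "'a::euclidean_space \<Rightarrow> 'b::euclidean_space" and L :: "'b \<Rightarrow> 'c::euclidean_space"
  assumes "bounded_linear L" "locally_integrable S u"
  shows "locally_integrable S (\<lambda>z. L (u z))"
  using assms absolutely_integrable_linear[of _ u L] unfolding locally_integrable_def o_def by blast

lemma has_weak_deriv_bounded_linear:
  fixes u :: "'a::euclidean_space \<Rightarrow> 'b::euclidean_space" and L :: "'b \<Rightarrow> 'c::euclidean_space"
  assumes L: "bounded_linear L" and S: "S \<in> sets lebesgue" and uv: "has_weak_deriv S e u v"
  shows "has_weak_deriv S e (\<lambda>z. L (u z)) (\<lambda>z. L (v z))"
  unfolding has_weak_deriv_def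
proof (intro conjI allI impI)
  have u: "locally_integrable S u" and v: "locally_integrable S v"
    using uv by (auto simp: has_weak_deriv_def)
  show "locally_integrable S (\<lambda>z. L (u z))" "locally_integrable S (\<lambda>z. L (v z))"
    using locally_integrable_bounded_linear[OF L] u v by auto
  fix \<phi> :: "'a \<Rightarrow> real" assume \<phi>: "test_function S \<phi>"
  have 1: "(LINT z|lebesgue_on S. dir_deriv e \<phi> z *\<^sub>R L (u z)) = L (LINT z|lebesgue_on S. dir_deriv e \<phi> z *\<^sub>R u z)"
    using integral_bounded_linear[OF L test_function_mult_integrable(2)[OF S u \<phi>, of e]]
    by (simp add: linear_scale[OF bounded_linear.linear[OF L]])
  have 2: "(LINT z|lebesgue_on S. \<phi> z *\<^sub>R L (v z)) = L (LINT z|lebesgue_on S. \<phi> z *\<^sub>R v z)"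
    using integral_bounded_linear[OF L test_function_mult_integrable(1)[OF S v \<phi>]]
    by (simp add: linear_scale[OF bounded_linear.linear[OF L]])
  show "(LINT z|lebesgue_on S. dir_deriv e \<phi> z *\<^sub>R L (u z)) = - (LINT z|lebesgue_on S. \<phi> z *\<^sub>R L (v z))"
    unfolding 1 2 using uv \<phi> by (simp add: has_weak_deriv_def linear_neg[OF bounded_linear.linear[OF L]])
qed

lemma locally_integrable_diff:
  fixes u :: "'a::euclidean_space \<Rightarrow> 'b::euclidean_space"
  assumes "locally_integrable S u" "locally_integrable S v"
  shows "locally_integrable S (\<lambda>z. u z - v z)"
  using assms set_integral_diff(1) unfolding locally_integrable_def by blast

lemma has_weak_deriv_diff:
  fixes u :: "'a::euclidean_space \<Rightarrow> 'b::euclidean_space"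
  assumes S: "S \<in> sets lebesgue" and uv: "has_weak_deriv S e u v" and uv': "has_weak_deriv S e u' v'"
  shows "has_weak_deriv S e (\<lambda>z. u z - u' z) (\<lambda>z. v z - v' z)"
  unfolding has_weak_deriv_def
proof (intro conjI allI impI)
  have li: "locally_integrable S u" "locally_integrable S v" "locally_integrable S u'" "locally_integrable S v'"
    using uv uv' by (auto simp: has_weak_deriv_def)
  show "locally_integrable S (\<lambda>z. u z - u' z)" "locally_integrable S (\<lambda>z. v z - v' z)"
    using li by (auto intro: locally_integrable_diff)
  fix \<phi> :: "'a \<Rightarrow> real" assume \<phi>: "test_function S \<phi>"
  note int = test_function_mult_integrable[OF S _ \<phi>]
  show "(LINT z|lebesgue_on S. dir_deriv e \<phi> z *\<^sub>R (u z - u' z)) = - (LINT z|lebesgue_on S. \<phi> z *\<^sub>R (v z - v' z))"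
    using uv uv' \<phi>
    by (simp only: has_weak_deriv_def scaleR_diff_right Bochner_Integration.integral_diff[OF int(1) int(1)]
        Bochner_Integration.integral_diff[OF int(2) int(2)] li) simp
qed

lemma has_weak_deriv_unique:
  fixes u :: "'a::euclidean_space \<Rightarrow> 'b::euclidean_space"
  assumes "open S" and uv: "has_weak_deriv S e u v" and uv': "has_weak_deriv S e u v'"
  shows "AE z in lebesgue_on S. v z = v' z"
proof -
  have S: "S \<in> sets lebesgue" using assms(1) by simp
  have d: "has_weak_deriv S e (\<lambda>z. 0) (\<lambda>z. v z - v' z)"
    using has_weak_deriv_diff[OF S uv uv'] by (simp only: diff_self)
  have "AE z in lebesgue_on S. v z - v' z = 0"
  proof (rule AE_zero_if_orthogonal_to_test_functions[OF \<open>open S\<close>])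
    show "locally_integrable S (\<lambda>z. v z - v' z)" using d unfolding has_weak_deriv_def by blast
    fix \<phi> :: "'a \<Rightarrow> real" assume "test_function S \<phi>"
    then have "(LINT z|lebesgue_on S. dir_deriv e \<phi> z *\<^sub>R (0::'b)) = - (LINT z|lebesgue_on S. \<phi> z *\<^sub>R (v z - v' z))"
      using d unfolding has_weak_deriv_def by blast
    then show "(LINT z|lebesgue_on S. \<phi> z *\<^sub>R (v z - v' z)) = 0"
      by (simp only: scaleR_zero_right integral_zero neg_0_equal_iff_equal)
  qed
  then show ?thesis by (rule eventually_mono) (simp only: right_minus_eq)
qed

text \<open>By uniqueness, the choice made in \<open>weak_deriv\<close> is immaterial: any explicit weak derivative may be used instead.\<close>

lemma weak_deriv_AE_eq:
  fixes u :: "'a::euclidean_space \<Rightarrow> 'b::euclidean_space"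
  assumes "open S" "has_weak_deriv S e u v"
  shows "AE z in lebesgue_on S. weak_deriv S e u z = v z"
proof (rule has_weak_deriv_unique[OF assms(1) _ assms(2)])
  show "has_weak_deriv S e u (weak_deriv S e u)"
    unfolding weak_deriv_def by (rule someI[where P = "has_weak_deriv S e u", OF assms(2)])
qed

lemma Basis_real_prod: "(Basis :: (real \<times> real) set) = {(1, 0), (0, 1)}"
  by (auto simp: Basis_prod_def)

lemma has_weak_deriv_add:
  fixes u :: "'a::euclidean_space \<Rightarrow> 'b::euclidean_space"
  assumes S: "S \<in> sets lebesgue" and uv: "has_weak_deriv S e u v" and uv': "has_weak_deriv S e u' v'"
  shows "has_weak_deriv S e (\<lambda>z. u z + u' z) (\<lambda>z. v z + v' z)"
  using has_weak_deriv_diff[OF S uv has_weak_deriv_bounded_linear[OF bounded_linear_minus[OF bounded_linear_ident] S uv']]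
  by simp

lemma lborel_integral_zero_by_lines:
  fixes g :: "real \<times> real \<Rightarrow> 'b::euclidean_space"
  assumes g: "integrable lborel g" and e: "e \<in> Basis"
    and lines: "\<And>z. (LINT t|lborel. g (z + t *\<^sub>R e)) = 0"
  shows "(LINT z|lborel. g z) = 0"
proof -
  have gi: "integrable (lborel \<Otimes>\<^sub>M lborel) g" using g by (simp add: lborel_prod)
  consider "e = (1, 0)" | "e = (0, 1)" using e by (auto simp: Basis_real_prod)
  then show ?thesis
  proof cases
    case 1
    have "(LINT z|lborel. g z) = (LINT y|lborel. LINT x|lborel. g (x, y))"
      using lborel_pair.integral_snd[of "\<lambda>x y. g (x, y)"] gi by (simp add: lborel_prod)
    moreover have "(LINT x|lborel. g (x, y)) = 0" for y using lines[of "(0, y)"] 1 by simp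
    ultimately show ?thesis by simp
  next
    case 2
    have "(LINT z|lborel. g z) = (LINT x|lborel. LINT y|lborel. g (x, y))"
      using lborel_pair.integral_fst'[OF gi] by (simp add: lborel_prod)
    moreover have "(LINT y|lborel. g (x, y)) = 0" for x using lines[of "(x, 0)"] 2 by simp
    ultimately show ?thesis by simp
  qed
qed

lemma integral_of_derivative_compact_support:
  fixes G g :: "real \<Rightarrow> 'b::euclidean_space"
  assumes "continuous_on UNIV G" "finite E"
    and deriv: "\<And>t. t \<notin> E \<Longrightarrow> (G has_vector_derivative g t) (at t)"
    and supp: "\<And>t. R < \<bar>t\<bar> \<Longrightarrow> G t = 0" "\<And>t. R < \<bar>t\<bar> \<Longrightarrow> g t = 0"
    and int: "integrable lborel g"
  shows "(LINT t|lborel. g t) = 0"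
proof -
  \<comment> \<open>Beyond \<open>R\<close> everything vanishes, in particular at the ends of this interval.\<close>
  define r where "r = \<bar>R\<bar> + 1"
  have "(g has_integral (G r - G (- r))) {-r..r}"
    by (rule fundamental_theorem_of_calculus_interior_strong[OF \<open>finite E\<close>])
      (use assms in \<open>auto simp: r_def intro: continuous_on_subset\<close>)
  then have "(g has_integral 0) {-r..r}"
    using supp(1)[of r] supp(1)[of "-r"] by (simp add: r_def)
  then have "(g has_integral 0) UNIV"
    by (rule has_integral_on_superset) (use supp(2) in \<open>auto simp: r_def\<close>)
  then show ?thesis using has_integral_integral_lborel[OF int] has_integral_unique by blast
qed

lemma integrable_bounded_support:
  fixes f :: "'a::euclidean_space \<Rightarrow> 'b::euclidean_space"
  assumes "f \<in> borel_measurable borel" "\<And>z. norm (f z) \<le> B" "compact K" "\<And>z. z \<notin> K \<Longrightarrow> f z = 0"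
  shows "integrable lborel f"
proof (rule Bochner_Integration.integrable_bound)
  show "integrable lborel (\<lambda>z. B * indicator K z :: real)"
    using \<open>compact K\<close> by (intro integrable_mult_right integrable_real_indicator)
      (use emeasure_compact_finite in \<open>auto simp: borel_compact\<close>)
  show "AE z in lborel. norm (f z) \<le> norm (B * indicator K z :: real)"
  proof (intro AE_I2)
    fix z show "norm (f z) \<le> norm (B * indicator K z :: real)"
      using assms(2)[of z] assms(4)[of z] by (cases "z \<in> K") auto
  qed
qed (use assms(1) in simp)

lemma LINT_lebesgue_on_eq_lborel:
  fixes f :: "'a::euclidean_space \<Rightarrow> 'b::euclidean_space"
  assumes S: "S \<in> sets lebesgue" and f: "f \<in> borel_measurable borel" and "\<And>z. z \<notin> S \<Longrightarrow> f z = 0"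
  shows "(LINT z|lebesgue_on S. f z) = (LINT z|lborel. f z)"
proof -
  have "(\<lambda>z. indicator S z *\<^sub>R f z) = f" using assms(3) by (intro ext) (auto simp: indicator_def)
  then have "(LINT z|lebesgue_on S. f z) = (LINT z|lebesgue. f z)"
    using S by (simp add: integral_restrict_space)
  then show ?thesis using f by (simp add: integral_completion)
qed

text \<open>Integration by parts, by Fubini and the fundamental theorem of calculus on lines in the direction \<open>e\<close>. The latter
  tolerates finitely many exceptional points on each line, so that the statement covers smooth functions and
  continuous functions that are only piecewise smooth.\<close>

lemma has_weak_deriv_piecewise:
  fixes u v :: "real \<times> real \<Rightarrow> 'b::euclidean_space"
  assumes S: "S \<in> sets lebesgue" and e: "e \<in> Basis" and u: "continuous_on UNIV u"
    and v: "v \<in> borel_measurable borel" "\<And>z. norm (v z) \<le> B"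
    and lines: "\<And>z. \<exists>E. finite E \<and>
      (\<forall>t. t \<notin> E \<longrightarrow> ((\<lambda>t. u (z + t *\<^sub>R e)) has_vector_derivative v (z + t *\<^sub>R e)) (at t))"
  shows "has_weak_deriv S e u v"
  unfolding has_weak_deriv_def
proof (intro conjI allI impI)
  have bounded: "locally_integrable S w"
    if w: "w \<in> borel_measurable borel" and B: "\<And>K. compact K \<Longrightarrow> \<exists>B. \<forall>z\<in>K. norm (w z) \<le> B"
    for w :: "real \<times> real \<Rightarrow> 'b"
    unfolding locally_integrable_def
  proof (intro allI impI)
    fix K assume K: "compact K \<and> K \<subseteq> S"
    obtain B where B: "\<And>z. z \<in> K \<Longrightarrow> norm (w z) \<le> B" using B K by blast
    have "norm (indicator K z *\<^sub>R w z) \<le> \<bar>B\<bar>" for z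
      using B[of z] by (auto simp: indicator_def)
    moreover have m: "(\<lambda>z. indicator K z *\<^sub>R w z) \<in> borel_measurable borel"
      using K w by (auto intro!: borel_measurable_scaleR borel_measurable_indicator borel_compact)
    ultimately have "integrable lborel (\<lambda>z. indicator K z *\<^sub>R w z)"
      using K by (intro integrable_bounded_support[where K = K]) auto
    then show "w absolutely_integrable_on K"
      unfolding set_integrable_def using m by (simp add: integrable_completion)
  qed
  show "locally_integrable S u"
  proof (rule bounded)
    fix K :: "(real \<times> real) set" assume "compact K"
    then have "compact (u ` K)" using u by (meson compact_continuous_image continuous_on_subset subset_UNIV)
    then show "\<exists>B. \<forall>z\<in>K. norm (u z) \<le> B" by (meson bounded_iff compact_imp_bounded imageI)
  qed (use u in \<open>simp add: borel_measurable_continuous_onI\<close>)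
  show "locally_integrable S v" using v by (intro bounded) blast+
  fix \<phi> :: "real \<times> real \<Rightarrow> real" assume "test_function S \<phi>"
  then obtain K where K: "smooth \<phi>" "compact K" "K \<subseteq> S" "\<And>z. z \<notin> K \<Longrightarrow> \<phi> z = 0"
    unfolding test_function_def by blast
  have K': "dir_deriv e' \<phi> z = 0" if "z \<notin> K" for e' z
    by (rule dir_deriv_zero_outside[OF K(2) _ that]) (rule K(4))
  have \<phi>c: "continuous_on UNIV \<phi>" "continuous_on UNIV (dir_deriv e \<phi>)"
    using smooth_continuous smooth_dir_deriv K(1) by auto
  let ?a = "\<lambda>z. dir_deriv e \<phi> z *\<^sub>R u z" and ?b = "\<lambda>z. \<phi> z *\<^sub>R v z"
  have ac: "continuous_on UNIV ?a" by (intro continuous_intros \<phi>c u)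
  have ab: "?a \<in> borel_measurable borel" "?b \<in> borel_measurable borel"
    using borel_measurable_continuous_onI[OF ac] borel_measurable_continuous_onI[OF \<phi>c(1)] v(1)
    by (simp_all add: borel_measurable_scaleR)
  obtain Ba where Ba: "\<And>z. norm (?a z) \<le> Ba"
  proof -
    have "?a z = 0" if "z \<notin> K" for z using K'[OF that] by simp
    from test_function_bounded[OF ac K(2) this] show ?thesis using that by blast
  qed
  obtain Bp where Bp: "\<And>z. norm (\<phi> z) \<le> Bp" using test_function_bounded[OF \<phi>c(1) K(2,4)] by blast
  have Bb: "norm (?b z) \<le> Bp * B" for z
    unfolding norm_scaleR using Bp[of z] v(2)[of z] by (intro mult_mono) (auto intro: order_trans[OF abs_ge_zero])
  have ai: "integrable lborel ?a" using integrable_bounded_support[OF ab(1) Ba K(2)] K' by simp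
  have bi: "integrable lborel ?b" using integrable_bounded_support[OF ab(2) Bb K(2)] K(4) by simp
  have "(LINT z|lborel. ?a z + ?b z) = 0"
  proof (rule lborel_integral_zero_by_lines[OF _ e])
    show "integrable lborel (\<lambda>z. ?a z + ?b z)" using ai bi by simp
    fix z
    obtain E where E: "finite E"
      "\<And>t. t \<notin> E \<Longrightarrow> ((\<lambda>t. u (z + t *\<^sub>R e)) has_vector_derivative v (z + t *\<^sub>R e)) (at t)"
      using lines[of z] by blast
    obtain R where R: "\<And>y. y \<in> K \<Longrightarrow> norm y \<le> R" using K(2) by (meson bounded_iff compact_imp_bounded)
    have ne: "norm e = 1" using e by simp
    have out: "z + t *\<^sub>R e \<notin> K" if "R + norm z < \<bar>t\<bar>" for t
    proof
      assume "z + t *\<^sub>R e \<in> K"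
      then have "norm (z + t *\<^sub>R e) \<le> R" by (rule R)
      moreover have "norm (t *\<^sub>R e) \<le> norm (z + t *\<^sub>R e) + norm z"
        using norm_triangle_ineq4[of "z + t *\<^sub>R e" z] by simp
      ultimately show False using that ne by simp
    qed
    have line: "continuous_on UNIV (\<lambda>t. z + t *\<^sub>R e)" by (intro continuous_intros)
    have lm: "(\<lambda>t. z + t *\<^sub>R e) \<in> borel_measurable borel" using line by (rule borel_measurable_continuous_onI)
    show "(LINT t|lborel. ?a (z + t *\<^sub>R e) + ?b (z + t *\<^sub>R e)) = 0"
    proof (rule integral_of_derivative_compact_support[where G = "\<lambda>t. \<phi> (z + t *\<^sub>R e) *\<^sub>R u (z + t *\<^sub>R e)"
          and R = "R + norm z" and E = E])
      show "continuous_on UNIV (\<lambda>t. \<phi> (z + t *\<^sub>R e) *\<^sub>R u (z + t *\<^sub>R e))"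
        by (intro continuous_on_scaleR continuous_on_compose2[OF \<phi>c(1) line] continuous_on_compose2[OF u line]) auto
      fix t assume t: "t \<notin> E"
      have "((\<lambda>t. \<phi> (z + t *\<^sub>R e)) has_derivative (\<lambda>h. dir_deriv (h *\<^sub>R e) \<phi> (z + t *\<^sub>R e))) (at t)"
        by (rule has_derivative_compose[OF _ smooth_has_derivative[OF K(1)]])
          (auto intro!: derivative_eq_intros)
      then have "((\<lambda>t. \<phi> (z + t *\<^sub>R e)) has_real_derivative dir_deriv e \<phi> (z + t *\<^sub>R e)) (at t)"
        unfolding has_field_derivative_def
        by (rule has_derivative_eq_rhs)
          (simp add: fun_eq_iff linear_scale[OF has_derivative_linear[OF smooth_has_derivative[OF K(1)]]])
      from has_vector_derivative_scaleR[OF this E(2)[OF t]]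
      show "((\<lambda>t. \<phi> (z + t *\<^sub>R e) *\<^sub>R u (z + t *\<^sub>R e)) has_vector_derivative
          ?a (z + t *\<^sub>R e) + ?b (z + t *\<^sub>R e)) (at t)"
        by (simp add: add.commute)
    next
      fix t assume "R + norm z < \<bar>t\<bar>"
      from out[OF this] show "\<phi> (z + t *\<^sub>R e) *\<^sub>R u (z + t *\<^sub>R e) = 0"
        "?a (z + t *\<^sub>R e) + ?b (z + t *\<^sub>R e) = 0" using K(4) K' by simp_all
    next
      show "integrable lborel (\<lambda>t. ?a (z + t *\<^sub>R e) + ?b (z + t *\<^sub>R e))"
      proof (rule integrable_bounded_support[where B = "Ba + Bp * B" and K = "{-(R + norm z)..R + norm z}"])
        show "(\<lambda>t. ?a (z + t *\<^sub>R e) + ?b (z + t *\<^sub>R e)) \<in> borel_measurable borel"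
          using measurable_compose[OF lm borel_measurable_add[OF ab]] .
        show "norm (?a (z + t *\<^sub>R e) + ?b (z + t *\<^sub>R e)) \<le> Ba + Bp * B" for t
          using Ba Bb by (intro order_trans[OF norm_triangle_ineq] add_mono)
        show "?a (z + t *\<^sub>R e) + ?b (z + t *\<^sub>R e) = 0" if "t \<notin> {-(R + norm z)..R + norm z}" for t
        proof -
          have "R + norm z < \<bar>t\<bar>" using that by (auto simp: abs_less_iff not_le)
          from out[OF this] show ?thesis using K(4) K' by simp
        qed
      qed simp
    qed (fact E(1))
  qed
  then have sum0: "(LINT z|lborel. ?a z) + (LINT z|lborel. ?b z) = 0"
    using ai bi by simp
  have "(LINT z|lebesgue_on S. ?a z) = (LINT z|lborel. ?a z)"
  proof (rule LINT_lebesgue_on_eq_lborel[OF S ab(1)])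
    fix z assume "z \<notin> S"
    then have "z \<notin> K" using K(3) by blast
    then show "?a z = 0" using K' by simp
  qed
  moreover have "(LINT z|lebesgue_on S. ?b z) = (LINT z|lborel. ?b z)"
  proof (rule LINT_lebesgue_on_eq_lborel[OF S ab(2)])
    fix z assume "z \<notin> S"
    then have "z \<notin> K" using K(3) by blast
    then show "?b z = 0" using K(4) by simp
  qed
  ultimately show "(LINT z|lebesgue_on S. ?a z) = - (LINT z|lebesgue_on S. ?b z)"
    using sum0 by (simp add: eq_neg_iff_add_eq_0)
qed

lemma test_function_has_weak_deriv:
  fixes \<phi> :: "real \<times> real \<Rightarrow> 'b::euclidean_space"
  assumes "S \<in> sets lebesgue" "e \<in> Basis" "test_function S' \<phi>"
  shows "has_weak_deriv S e \<phi> (dir_deriv e \<phi>)"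
proof -
  obtain K where K: "smooth \<phi>" "compact K" "\<And>z. z \<notin> K \<Longrightarrow> \<phi> z = 0"
    using assms(3) unfolding test_function_def by blast
  have c: "continuous_on UNIV (dir_deriv e \<phi>)" using smooth_continuous[OF smooth_dir_deriv[OF K(1)]] .
  obtain B where B: "\<And>z. norm (dir_deriv e \<phi> z) \<le> B"
    using test_function_bounded[OF c K(2) dir_deriv_zero_outside[OF K(2,3)]] by blast
  show ?thesis
  proof (rule has_weak_deriv_piecewise[OF assms(1,2) smooth_continuous[OF K(1)] borel_measurable_continuous_onI[OF c] B])
    fix z
    have "((\<lambda>t. \<phi> (z + t *\<^sub>R e)) has_vector_derivative dir_deriv e \<phi> (z + t *\<^sub>R e)) (at t)" for t
    proof -
      have "((\<lambda>t. \<phi> (z + t *\<^sub>R e)) has_derivative (\<lambda>h. dir_deriv (h *\<^sub>R e) \<phi> (z + t *\<^sub>R e))) (at t)"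
        by (rule has_derivative_compose[OF _ smooth_has_derivative[OF K(1)]])
          (auto intro!: derivative_eq_intros)
      then show ?thesis
        unfolding has_vector_derivative_def
        by (rule has_derivative_eq_rhs)
          (simp add: fun_eq_iff linear_scale[OF has_derivative_linear[OF smooth_has_derivative[OF K(1)]]])
    qed
    then show "\<exists>E. finite E \<and> (\<forall>t. t \<notin> E \<longrightarrow>
      ((\<lambda>t. \<phi> (z + t *\<^sub>R e)) has_vector_derivative dir_deriv e \<phi> (z + t *\<^sub>R e)) (at t))"
      by (intro exI[of _ "{}"]) simp
  qed
qed

section \<open>Square integrable functions\<close>

lemma LINT_Fatou:
  fixes h :: "nat \<Rightarrow> 'a \<Rightarrow> real"
  assumes h: "\<And>m. integrable M (h m)" "\<And>m z. 0 \<le> h m z"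
    and H: "H \<in> borel_measurable M" and lim: "AE z in M. (\<lambda>m. h m z) \<longlonglongrightarrow> H z"
    and le: "\<forall>\<^sub>F m in sequentially. (LINT z|M. h m z) \<le> e"
  shows "integrable M H" "(LINT z|M. H z) \<le> e"
proof -
  have nonneg: "AE z in M. 0 \<le> H z"
    using lim by eventually_elim (rule LIMSEQ_le_const, auto simp: h)
  obtain m where "(LINT z|M. h m z) \<le> e" using le eventually_happens trivial_limit_sequentially by blast
  then have e: "0 \<le> e" using integral_nonneg_AE[of "h m" M] h(2) by (meson AE_I2 order_trans)
  have "(\<integral>\<^sup>+z. ennreal (H z) \<partial>M) = (\<integral>\<^sup>+z. liminf (\<lambda>m. ennreal (h m z)) \<partial>M)"
  proof (rule nn_integral_cong_AE)
    show "AE z in M. ennreal (H z) = liminf (\<lambda>m. ennreal (h m z))"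
      using lim by eventually_elim (metis lim_imp_Liminf tendsto_ennrealI trivial_limit_sequentially)
  qed
  also have "\<dots> \<le> liminf (\<lambda>m. \<integral>\<^sup>+z. ennreal (h m z) \<partial>M)"
    by (rule nn_integral_liminf) (use h in auto)
  also have "\<dots> \<le> ennreal e"
  proof -
    have "\<forall>\<^sub>F m in sequentially. (\<integral>\<^sup>+z. ennreal (h m z) \<partial>M) \<le> ennreal e"
      using le by eventually_elim (use h e in \<open>simp add: nn_integral_eq_integral ennreal_leI\<close>)
    then show ?thesis by (intro Liminf_le) auto
  qed
  finally have le_e: "(\<integral>\<^sup>+z. ennreal (H z) \<partial>M) \<le> ennreal e" .
  show "integrable M H"
    by (rule integrableI_nonneg[OF H nonneg]) (use le_e in \<open>simp add: ennreal_less_top le_less_trans\<close>)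
  then show "(LINT z|M. H z) \<le> e"
    using le_e nonneg e by (simp add: nn_integral_eq_integral)
qed

lemma square_integrable_scaleR: "square_integrable M f \<Longrightarrow> square_integrable M (\<lambda>z. c *\<^sub>R f z)"
  unfolding square_integrable_def by (auto simp: power_mult_distrib)

lemma norm_add_power2_le: "(norm (x + y :: 'b::real_normed_vector))\<^sup>2 \<le> 2 * (norm x)\<^sup>2 + 2 * (norm y)\<^sup>2"
proof -
  have "(norm (x + y))\<^sup>2 \<le> (norm x + norm y)\<^sup>2"
    by (intro power_mono norm_triangle_ineq norm_ge_zero)
  also have "\<dots> \<le> 2 * (norm x)\<^sup>2 + 2 * (norm y)\<^sup>2"
    using sum_squares_bound[of "norm x" "norm y"] by (simp add: power2_sum)
  finally show ?thesis .
qed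

lemma square_integrable_add:
  assumes "square_integrable M f" "square_integrable M g"
  shows "square_integrable M (\<lambda>z. f z + g z)"
  unfolding square_integrable_def
proof
  show m: "(\<lambda>z. f z + g z) \<in> borel_measurable M"
    using assms by (auto simp: square_integrable_def)
  show "integrable M (\<lambda>z. (norm (f z + g z))\<^sup>2)"
  proof (rule Bochner_Integration.integrable_bound)
    show "integrable M (\<lambda>z. 2 * (norm (f z))\<^sup>2 + 2 * (norm (g z))\<^sup>2)"
      using assms by (auto simp: square_integrable_def)
    show "AE z in M. norm ((norm (f z + g z))\<^sup>2) \<le> norm (2 * (norm (f z))\<^sup>2 + 2 * (norm (g z))\<^sup>2)"
      using norm_add_power2_le by (intro AE_I2) (simp add: order_trans[OF _ abs_ge_self])
  qed (use m in measurable)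
qed

lemma square_integrable_diff:
  assumes "square_integrable M f" "square_integrable M g"
  shows "square_integrable M (\<lambda>z. f z - g z)"
  using square_integrable_add[OF assms(1) square_integrable_scaleR[OF assms(2), of "-1"]] by simp

text \<open>From \<open>t \<le> \<delta> + t\<^sup>2 / \<delta>\<close>, which holds whether or not \<open>t\<close> exceeds \<open>\<delta>\<close>.\<close>

lemma LINT_norm_le_LINT_norm2:
  fixes f :: "'a \<Rightarrow> 'b::euclidean_space"
  assumes M: "finite_measure M" and f: "square_integrable M f" and "\<delta> > 0"
  shows "integrable M f" "(LINT z|M. norm (f z)) \<le> \<delta> * measure M (space M) + (LINT z|M. (norm (f z))\<^sup>2) / \<delta>"
proof -
  interpret finite_measure M by fact
  have f': "f \<in> borel_measurable M" "integrable M (\<lambda>z. (norm (f z))\<^sup>2)"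
    using f by (auto simp: square_integrable_def)
  have bound: "norm (f z) \<le> \<delta> + (norm (f z))\<^sup>2 / \<delta>" for z
  proof (cases "norm (f z) \<le> \<delta>")
    case True then show ?thesis using \<open>\<delta> > 0\<close> by (simp add: add_increasing2)
  next
    case False
    then have "norm (f z) * \<delta> \<le> norm (f z) * norm (f z)" by (intro mult_left_mono) auto
    then have "norm (f z) \<le> (norm (f z))\<^sup>2 / \<delta>" using \<open>\<delta> > 0\<close> by (simp add: field_simps power2_eq_square)
    then show ?thesis using \<open>\<delta> > 0\<close> by simp
  qed
  have i: "integrable M (\<lambda>z. \<delta> + (norm (f z))\<^sup>2 / \<delta>)" using f' by simp
  show int: "integrable M f"
    by (rule Bochner_Integration.integrable_bound[OF i f'(1)])
      (use bound in \<open>auto intro!: AE_I2 order_trans[OF _ abs_ge_self]\<close>)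
  have "(LINT z|M. norm (f z)) \<le> (LINT z|M. \<delta> + (norm (f z))\<^sup>2 / \<delta>)"
    using int i bound by (intro integral_mono) auto
  also have "\<dots> = \<delta> * measure M (space M) + (LINT z|M. (norm (f z))\<^sup>2) / \<delta>"
    using f' by simp
  finally show "(LINT z|M. norm (f z)) \<le> \<delta> * measure M (space M) + (LINT z|M. (norm (f z))\<^sup>2) / \<delta>" .
qed

text \<open>On a finite measure space an \<open>L\<^sup>2\<close> Cauchy sequence is Cauchy in \<open>L\<^sup>1\<close>, so that a subsequence converges almost
  everywhere; Fatou's lemma turns its limit into the limit in \<open>L\<^sup>2\<close>.\<close>

lemma L2_Cauchy_limit:
  fixes f :: "nat \<Rightarrow> 'a \<Rightarrow> 'b::euclidean_space"
  assumes M: "finite_measure M" and f: "\<And>n. square_integrable M (f n)"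
    and Cauchy: "\<And>e. e > 0 \<Longrightarrow> \<exists>N. \<forall>m\<ge>N. \<forall>n\<ge>N. (LINT z|M. (norm (f m z - f n z))\<^sup>2) < e"
  obtains g r where "square_integrable M g" "(\<lambda>n. LINT z|M. (norm (f n z - g z))\<^sup>2) \<longlonglongrightarrow> 0"
    "strict_mono r" "AE z in M. (\<lambda>n. f (r n) z) \<longlonglongrightarrow> g z"
proof -
  interpret finite_measure M by fact
  have L1: "\<exists>N. \<forall>i\<ge>N. \<forall>j\<ge>N. (LINT z|M. norm (f i z - f j z)) < e" if "e > 0" for e
  proof -
    \<comment> \<open>This choice makes the first term of the bound at most \<open>e / 2\<close>; the denominator is positive also for a null space.\<close>
    define \<delta> where "\<delta> = e / (2 * (measure M (space M) + 1))"
    have \<delta>: "\<delta> > 0" "\<delta> * measure M (space M) \<le> e / 2"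
    proof -
      have "measure M (space M) + 1 > 0" by (simp add: add_nonneg_pos)
      then show "\<delta> > 0" "\<delta> * measure M (space M) \<le> e / 2"
        using that by (simp_all add: \<delta>_def divide_simps)
    qed
    obtain N where N: "\<And>m n. m \<ge> N \<Longrightarrow> n \<ge> N \<Longrightarrow> (LINT z|M. (norm (f m z - f n z))\<^sup>2) < \<delta> * (e / 2)"
    proof -
      have "0 < \<delta> * (e / 2)" using \<delta>(1) \<open>e > 0\<close> by simp
      then show ?thesis using Cauchy[of "\<delta> * (e / 2)"] that by blast
    qed
    show ?thesis
    proof (intro exI allI impI)
      fix m n assume "N \<le> m" "N \<le> n"
      have "(LINT z|M. norm (f m z - f n z)) \<le> \<delta> * measure M (space M) + (LINT z|M. (norm (f m z - f n z))\<^sup>2) / \<delta>"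
        by (rule LINT_norm_le_LINT_norm2[OF M square_integrable_diff[OF f f] \<delta>(1)])
      also have "(LINT z|M. (norm (f m z - f n z))\<^sup>2) / \<delta> < e / 2"
        using N[OF \<open>N \<le> m\<close> \<open>N \<le> n\<close>] \<delta>(1) by (simp add: pos_divide_less_eq mult.commute)
      finally show "(LINT z|M. norm (f m z - f n z)) < e" using \<delta>(2) by simp
    qed
  qed
  obtain r where r: "strict_mono r" and "AE z in M. Cauchy (\<lambda>n. f (r n) z)"
    by (rule cauchy_L1_AE_cauchy_subseq[of M f])
      (use L1 LINT_norm_le_LINT_norm2(1)[OF M f zero_less_one] in auto)
  then have ae: "AE z in M. (\<lambda>n. f (r n) z) \<longlonglongrightarrow> lim (\<lambda>n. f (r n) z)"
    by (auto elim!: AE_mp intro!: AE_I2 simp: Cauchy_convergent_iff convergent_LIMSEQ_iff)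
  define g where "g z = lim (\<lambda>n. f (r n) z)" for z
  have fm: "f n \<in> borel_measurable M" for n using f by (simp add: square_integrable_def)
  have gm: "g \<in> borel_measurable M" unfolding g_def using fm by (intro borel_measurable_lim_metric)
  have key: "integrable M (\<lambda>z. (norm (f n z - g z))\<^sup>2) \<and> (LINT z|M. (norm (f n z - g z))\<^sup>2) \<le> e"
    if N: "\<And>m. m \<ge> N \<Longrightarrow> (LINT z|M. (norm (f n z - f m z))\<^sup>2) \<le> e" for n N e
  proof -
    have 1: "integrable M (\<lambda>z. (norm (f n z - f (r m) z))\<^sup>2)" for m
      using square_integrable_diff[OF f f] by (auto simp: square_integrable_def)
    have 2: "(\<lambda>z. (norm (f n z - g z))\<^sup>2) \<in> borel_measurable M" using fm gm by measurable
    have 3: "AE z in M. (\<lambda>m. (norm (f n z - f (r m) z))\<^sup>2) \<longlonglongrightarrow> (norm (f n z - g z))\<^sup>2"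
      using ae by eventually_elim (auto simp: g_def intro!: tendsto_intros)
    have 4: "\<forall>\<^sub>F m in sequentially. (LINT z|M. (norm (f n z - f (r m) z))\<^sup>2) \<le> e"
      using eventually_ge_at_top[of N] by eventually_elim (use N seq_suble[OF r] order_trans in blast)
    show ?thesis using LINT_Fatou[OF 1 _ 2 3 4] by auto
  qed
  have lim: "(\<lambda>n. LINT z|M. (norm (f n z - g z))\<^sup>2) \<longlonglongrightarrow> 0"
  proof (rule LIMSEQ_I)
    fix e :: real assume "e > 0"
    then obtain N where N: "\<And>m n. m \<ge> N \<Longrightarrow> n \<ge> N \<Longrightarrow> (LINT z|M. (norm (f m z - f n z))\<^sup>2) < e / 2"
      using Cauchy[of "e / 2"] by auto
    have "norm ((LINT z|M. (norm (f n z - g z))\<^sup>2) - 0) < e" if "n \<ge> N" for n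
    proof -
      have "(LINT z|M. (norm (f n z - g z))\<^sup>2) \<le> e / 2"
        using key[of N n "e / 2"] N[OF that] by (simp add: less_imp_le)
      moreover have "0 \<le> (LINT z|M. (norm (f n z - g z))\<^sup>2)" by (intro integral_nonneg_AE) auto
      ultimately show ?thesis using \<open>e > 0\<close> by simp
    qed
    then show "\<exists>no. \<forall>n\<ge>no. norm ((LINT z|M. (norm (f n z - g z))\<^sup>2) - 0) < e" by blast
  qed
  have "square_integrable M g"
  proof -
    obtain N where N: "\<And>m n. m \<ge> N \<Longrightarrow> n \<ge> N \<Longrightarrow> (LINT z|M. (norm (f m z - f n z))\<^sup>2) < 1"
      using Cauchy[of 1] by auto
    have "integrable M (\<lambda>z. (norm (f N z - g z))\<^sup>2)"
      using key[of N N 1] N[of N] by (simp add: less_imp_le)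
    then have "square_integrable M (\<lambda>z. f N z - g z)"
      using fm gm by (auto simp: square_integrable_def)
    from square_integrable_diff[OF f[of N] this] show ?thesis by simp
  qed
  with lim r ae show thesis using that[of g r] by (simp add: g_def)
qed

text \<open>The quadratic polynomial \<open>t \<mapsto> \<integral> (t |f| - |g|)\<^sup>2\<close> is nonnegative, in particular at its minimum.\<close>

lemma LINT_Cauchy_Schwarz:
  fixes f g :: "'a \<Rightarrow> real"
  assumes f: "square_integrable M f" and g: "square_integrable M g"
  shows "integrable M (\<lambda>z. f z * g z)"
    "(LINT z|M. \<bar>f z * g z\<bar>) \<le> sqrt (LINT z|M. (f z)\<^sup>2) * sqrt (LINT z|M. (g z)\<^sup>2)"
proof -
  have m: "f \<in> borel_measurable M" "g \<in> borel_measurable M"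
    and i: "integrable M (\<lambda>z. (f z)\<^sup>2)" "integrable M (\<lambda>z. (g z)\<^sup>2)"
    using f g by (auto simp: square_integrable_def)
  have ab: "2 * \<bar>x * y\<bar> \<le> x\<^sup>2 + y\<^sup>2" for x y :: real
    using sum_squares_bound[of "\<bar>x\<bar>" "\<bar>y\<bar>"] by (simp add: abs_mult)
  show fg: "integrable M (\<lambda>z. f z * g z)"
  proof (rule Bochner_Integration.integrable_bound)
    show "integrable M (\<lambda>z. (f z)\<^sup>2 + (g z)\<^sup>2)" using i by simp
    show "AE z in M. norm (f z * g z) \<le> norm ((f z)\<^sup>2 + (g z)\<^sup>2)"
    proof (intro AE_I2)
      fix z show "norm (f z * g z) \<le> norm ((f z)\<^sup>2 + (g z)\<^sup>2)"
        using ab[of "f z" "g z"] by simp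
    qed
  qed (use m in measurable)
  then have afg: "integrable M (\<lambda>z. \<bar>f z * g z\<bar>)" by simp
  define a b c where "a = (LINT z|M. (f z)\<^sup>2)" and "b = (LINT z|M. \<bar>f z * g z\<bar>)" and "c = (LINT z|M. (g z)\<^sup>2)"
  have nn: "a \<ge> 0" "b \<ge> 0" "c \<ge> 0" by (auto simp: a_def b_def c_def)
  have quad: "2 * t * b \<le> t\<^sup>2 * a + c" if "t \<ge> 0" for t
  proof -
    have "2 * t * b = (LINT z|M. 2 * t * \<bar>f z * g z\<bar>)" by (simp add: b_def)
    also have "\<dots> \<le> (LINT z|M. t\<^sup>2 * (f z)\<^sup>2 + (g z)\<^sup>2)"
    proof (rule integral_mono)
      fix z
      show "2 * t * \<bar>f z * g z\<bar> \<le> t\<^sup>2 * (f z)\<^sup>2 + (g z)\<^sup>2"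
        using ab[of "t * f z" "g z"] that by (simp add: abs_mult power_mult_distrib mult.assoc)
    qed (use i afg in auto)
    also have "\<dots> = t\<^sup>2 * a + c" using i by (simp add: a_def c_def)
    finally show ?thesis .
  qed
  have "b\<^sup>2 \<le> a * c"
  proof (cases "a = 0")
    case True
    have "b = 0"
    proof (rule ccontr)
      assume "b \<noteq> 0"
      then have "b > 0" using nn by simp
      then have "2 * ((c + 1) / b) * b \<le> c" using quad[of "(c + 1) / b"] True nn by simp
      then show False using \<open>b > 0\<close> nn by simp
    qed
    then show ?thesis using True by simp
  next
    case False
    then have "a > 0" using nn by simp
    from quad[of "b / a"] have "2 * b\<^sup>2 / a \<le> b\<^sup>2 / a + c"
      using nn \<open>a > 0\<close> by (simp add: power2_eq_square)
    then show ?thesis using \<open>a > 0\<close> by (simp add: field_simps)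
  qed
  then have "b \<le> sqrt (a * c)" using nn real_le_rsqrt by blast
  then show "b \<le> sqrt a * sqrt c" by (simp add: real_sqrt_mult)
qed

lemma L2_limit_contraction:
  fixes f :: "nat \<Rightarrow> 'a \<Rightarrow> 'b::euclidean_space" and T :: "'b \<Rightarrow> 'c::euclidean_space"
  assumes T: "bounded_linear T" "\<And>x. norm (T x) \<le> norm x"
    and f: "\<And>n. square_integrable M (f n)" and g: "square_integrable M g"
    and lim: "(\<lambda>n. LINT z|M. (norm (f n z - g z))\<^sup>2) \<longlonglongrightarrow> 0"
  shows "square_integrable M (\<lambda>z. T (f n z))" "square_integrable M (\<lambda>z. T (g z))"
    "(\<lambda>n. LINT z|M. (norm (T (f n z) - T (g z)))\<^sup>2) \<longlonglongrightarrow> 0"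
proof -
  have sq: "square_integrable M (\<lambda>z. T (h z))" and le: "(LINT z|M. (norm (T (h z)))\<^sup>2) \<le> (LINT z|M. (norm (h z))\<^sup>2)"
    if h: "square_integrable M h" for h
  proof -
    have hm: "h \<in> borel_measurable M" and hi: "integrable M (\<lambda>z. (norm (h z))\<^sup>2)" using h by (auto simp: square_integrable_def)
    have Tm: "(\<lambda>z. T (h z)) \<in> borel_measurable M"
      using measurable_compose[OF hm borel_measurable_continuous_onI[OF linear_continuous_on[OF T(1)]]] .
    have b: "(norm (T x))\<^sup>2 \<le> (norm x)\<^sup>2" for x using T(2) by (intro power_mono) auto
    have Ti: "integrable M (\<lambda>z. (norm (T (h z)))\<^sup>2)"
      by (rule Bochner_Integration.integrable_bound[OF hi]) (use Tm b in \<open>auto intro!: AE_I2\<close>)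
    show "square_integrable M (\<lambda>z. T (h z))" using Tm Ti by (simp add: square_integrable_def)
    show "(LINT z|M. (norm (T (h z)))\<^sup>2) \<le> (LINT z|M. (norm (h z))\<^sup>2)" by (rule integral_mono[OF Ti hi b])
  qed
  show "square_integrable M (\<lambda>z. T (f n z))" "square_integrable M (\<lambda>z. T (g z))" using sq f g by auto
  have "(LINT z|M. (norm (T (f n z) - T (g z)))\<^sup>2) \<le> (LINT z|M. (norm (f n z - g z))\<^sup>2)" for n
    using le[OF square_integrable_diff[OF f[of n] g]] by (simp add: linear_diff[OF bounded_linear.linear[OF T(1)]])
  then show "(\<lambda>n. LINT z|M. (norm (T (f n z) - T (g z)))\<^sup>2) \<longlonglongrightarrow> 0"
    by (intro tendsto_sandwich[OF _ _ tendsto_const lim]) auto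
qed

lemma L2_tendsto_imp_L1_tendsto:
  fixes f :: "nat \<Rightarrow> 'a \<Rightarrow> 'b::euclidean_space"
  assumes M: "finite_measure M" and f: "\<And>n. square_integrable M (f n)"
    and lim: "(\<lambda>n. LINT z|M. (norm (f n z))\<^sup>2) \<longlonglongrightarrow> 0"
  shows "(\<lambda>n. LINT z|M. norm (f n z)) \<longlonglongrightarrow> 0"
proof -
  interpret finite_measure M by fact
  have sq: "square_integrable M (\<lambda>z. norm (f n z))" for n
    using f[of n] by (auto simp: square_integrable_def)
  have one: "square_integrable M (\<lambda>_. 1 :: real)" by (simp add: square_integrable_def)
  have le: "(LINT z|M. norm (f n z)) \<le> sqrt (LINT z|M. (norm (f n z))\<^sup>2) * sqrt (LINT z|M. 1)" for n
    using LINT_Cauchy_Schwarz(2)[OF sq[of n] one] by simp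
  have "(\<lambda>n. sqrt (LINT z|M. (norm (f n z))\<^sup>2) * sqrt (LINT z|M. 1)) \<longlonglongrightarrow> sqrt 0 * sqrt (LINT z|M. 1)"
    by (intro tendsto_intros lim)
  then have z: "(\<lambda>n. sqrt (LINT z|M. (norm (f n z))\<^sup>2) * sqrt (LINT z|M. 1)) \<longlonglongrightarrow> 0" by simp
  show ?thesis
    by (rule tendsto_sandwich[OF _ _ tendsto_const z]) (use le in auto)
qed

lemma square_integrable_imp_locally_integrable:
  fixes u :: "'a::euclidean_space \<Rightarrow> 'b::euclidean_space"
  assumes S: "S \<in> sets lebesgue" and M: "finite_measure (lebesgue_on S)" and u: "square_integrable (lebesgue_on S) u"
  shows "locally_integrable S u"
proof -
  have "u absolutely_integrable_on S"
    using LINT_norm_le_LINT_norm2(1)[OF M u zero_less_one] S by (simp add: absolutely_integrable_iff_lebesgue_on)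
  then show ?thesis
    unfolding locally_integrable_def
    by (auto intro: set_integrable_subset compact_in_lebesgue)
qed

text \<open>Weak differentiation is a closed operator: for a fixed test function both sides of the defining identity are
  continuous in \<open>L\<^sup>2\<close>.\<close>

lemma has_weak_deriv_L2_limit:
  fixes u v :: "nat \<Rightarrow> 'a::euclidean_space \<Rightarrow> 'b::euclidean_space"
  assumes S: "S \<in> sets lebesgue" and M: "finite_measure (lebesgue_on S)"
    and uv: "\<And>n. has_weak_deriv S e (u n) (v n)"
    and u: "\<And>n. square_integrable (lebesgue_on S) (u n)" "square_integrable (lebesgue_on S) U"
    and v: "\<And>n. square_integrable (lebesgue_on S) (v n)" "square_integrable (lebesgue_on S) V"
    and limu: "(\<lambda>n. LINT z|lebesgue_on S. (norm (u n z - U z))\<^sup>2) \<longlonglongrightarrow> 0"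
    and limv: "(\<lambda>n. LINT z|lebesgue_on S. (norm (v n z - V z))\<^sup>2) \<longlonglongrightarrow> 0"
  shows "has_weak_deriv S e U V"
  unfolding has_weak_deriv_def
proof (intro conjI allI impI)
  show li: "locally_integrable S U" "locally_integrable S V"
    using square_integrable_imp_locally_integrable[OF S M] u v by auto
  fix \<phi> :: "'a \<Rightarrow> real" assume \<phi>: "test_function S \<phi>"
  then obtain K where K: "smooth \<phi>" "compact K" "K \<subseteq> S" "\<And>z. z \<notin> K \<Longrightarrow> \<phi> z = 0"
    unfolding test_function_def by blast
  have conv: "(\<lambda>n. LINT z|lebesgue_on S. \<psi> z *\<^sub>R f n z) \<longlonglongrightarrow> (LINT z|lebesgue_on S. \<psi> z *\<^sub>R g z)"
    if \<psi>: "continuous_on UNIV \<psi>" "\<And>z. z \<notin> K \<Longrightarrow> \<psi> z = 0"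
      and f: "\<And>n. square_integrable (lebesgue_on S) (f n)" and g: "square_integrable (lebesgue_on S) g"
      and lim: "(\<lambda>n. LINT z|lebesgue_on S. (norm (f n z - g z))\<^sup>2) \<longlonglongrightarrow> 0"
    for \<psi> :: "'a \<Rightarrow> real" and f :: "nat \<Rightarrow> 'a \<Rightarrow> 'b" and g
  proof -
    obtain B where B: "\<And>z. norm (\<psi> z) \<le> B" using test_function_bounded[OF \<psi>(1) K(2) \<psi>(2)] by blast
    note int = locally_integrable_mult[OF S square_integrable_imp_locally_integrable[OF S M] \<psi>(1) K(2,3) \<psi>(2)]
    have fg: "square_integrable (lebesgue_on S) (\<lambda>z. f n z - g z)" for n by (rule square_integrable_diff[OF f g])
    have le: "norm ((LINT z|lebesgue_on S. \<psi> z *\<^sub>R f n z) - (LINT z|lebesgue_on S. \<psi> z *\<^sub>R g z))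
      \<le> B * (LINT z|lebesgue_on S. norm (f n z - g z))" for n
    proof -
      have "norm ((LINT z|lebesgue_on S. \<psi> z *\<^sub>R f n z) - (LINT z|lebesgue_on S. \<psi> z *\<^sub>R g z))
        = norm (LINT z|lebesgue_on S. \<psi> z *\<^sub>R (f n z - g z))"
        using int[OF f[of n]] int[OF g] by (simp add: scaleR_diff_right)
      also have "\<dots> \<le> (LINT z|lebesgue_on S. norm (\<psi> z *\<^sub>R (f n z - g z)))" by (rule integral_norm_bound)
      also have "\<dots> \<le> (LINT z|lebesgue_on S. B * norm (f n z - g z))"
      proof (rule integral_mono)
        show "integrable (lebesgue_on S) (\<lambda>z. norm (\<psi> z *\<^sub>R (f n z - g z)))" by (rule integrable_norm[OF int[OF fg]])
        show "integrable (lebesgue_on S) (\<lambda>z. B * norm (f n z - g z))"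
          by (rule integrable_mult_right, rule integrable_norm, rule LINT_norm_le_LINT_norm2(1)[OF M fg zero_less_one])
        show "norm (\<psi> z *\<^sub>R (f n z - g z)) \<le> B * norm (f n z - g z)" for z
          using B[of z] by (simp add: mult_right_mono)
      qed
      finally show ?thesis by simp
    qed
    have "(\<lambda>n. B * (LINT z|lebesgue_on S. norm (f n z - g z))) \<longlonglongrightarrow> B * 0"
      by (intro tendsto_intros L2_tendsto_imp_L1_tendsto[OF M fg lim])
    then have z: "(\<lambda>n. B * (LINT z|lebesgue_on S. norm (f n z - g z))) \<longlonglongrightarrow> 0" by simp
    have "(\<lambda>n. (LINT z|lebesgue_on S. \<psi> z *\<^sub>R f n z) - (LINT z|lebesgue_on S. \<psi> z *\<^sub>R g z)) \<longlonglongrightarrow> 0"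
      by (rule tendsto_norm_zero_cancel, rule tendsto_sandwich[OF _ _ tendsto_const z]) (use le in auto)
    then show ?thesis by (simp add: LIM_zero_iff)
  qed
  have dz: "dir_deriv e \<phi> z = 0" if "z \<notin> K" for z
    by (rule dir_deriv_zero_outside[OF K(2) _ that]) (rule K(4))
  have "(\<lambda>n. LINT z|lebesgue_on S. dir_deriv e \<phi> z *\<^sub>R u n z) \<longlonglongrightarrow> (LINT z|lebesgue_on S. dir_deriv e \<phi> z *\<^sub>R U z)"
    by (rule conv[OF smooth_continuous[OF smooth_dir_deriv[OF K(1)]] dz u limu])
  moreover have "(\<lambda>n. LINT z|lebesgue_on S. dir_deriv e \<phi> z *\<^sub>R u n z) = (\<lambda>n. - (LINT z|lebesgue_on S. \<phi> z *\<^sub>R v n z))"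
    using uv \<phi> unfolding has_weak_deriv_def by blast
  moreover have "(\<lambda>n. - (LINT z|lebesgue_on S. \<phi> z *\<^sub>R v n z)) \<longlonglongrightarrow> - (LINT z|lebesgue_on S. \<phi> z *\<^sub>R V z)"
    by (intro tendsto_minus conv[OF smooth_continuous[OF K(1)] K(4) v limv])
  ultimately show "(LINT z|lebesgue_on S. dir_deriv e \<phi> z *\<^sub>R U z) = - (LINT z|lebesgue_on S. \<phi> z *\<^sub>R V z)"
    using LIMSEQ_unique by metis
qed

section \<open>Traces of limits of continuous functions\<close>

lemma borel_measurable_lebesgue_on_AE:
  fixes f g :: "'a::euclidean_space \<Rightarrow> 'b::euclidean_space"
  assumes S: "S \<in> sets lebesgue" and f: "f \<in> borel_measurable (lebesgue_on S)"
    and ae: "AE z in lebesgue_on S. f z = g z"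
  shows "g \<in> borel_measurable (lebesgue_on S)"
proof -
  have "(\<lambda>z. indicator S z *\<^sub>R f z) \<in> borel_measurable lebesgue"
    using f S by (simp add: borel_measurable_restrict_space_iff)
  moreover have "AE z in lebesgue. indicator S z *\<^sub>R f z = indicator S z *\<^sub>R g z"
  proof -
    have "AE z in lebesgue. z \<in> S \<longrightarrow> f z = g z" using ae S by (simp add: AE_restrict_space_iff)
    then show ?thesis by eventually_elim (auto simp: indicator_def)
  qed
  ultimately have "(\<lambda>z. indicator S z *\<^sub>R g z) \<in> borel_measurable lebesgue"
    by (rule borel_measurable_AE)
  then show ?thesis using S by (simp add: borel_measurable_restrict_space_iff)
qed

lemma W12_I:
  fixes u :: "real \<times> real \<Rightarrow> 'b::euclidean_space"
  assumes "square_integrable (lebesgue_on S) u"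
    "has_weak_deriv S (1, 0) u ux" "square_integrable (lebesgue_on S) ux"
    "has_weak_deriv S (0, 1) u uy" "square_integrable (lebesgue_on S) uy"
  shows "u \<in> W12 S"
  using assms unfolding W12_def Basis_real_prod by blast

lemma W12_norm_eq:
  fixes u :: "real \<times> real \<Rightarrow> 'b::euclidean_space"
  assumes "open S"
    and x: "has_weak_deriv S (1, 0) u ux" "ux \<in> borel_measurable (lebesgue_on S)"
    and y: "has_weak_deriv S (0, 1) u uy" "uy \<in> borel_measurable (lebesgue_on S)"
  shows "W12_norm S u = sqrt ((LINT z|lebesgue_on S. (norm (u z))\<^sup>2)
    + (LINT z|lebesgue_on S. (norm (ux z))\<^sup>2) + (LINT z|lebesgue_on S. (norm (uy z))\<^sup>2))"
proof -
  have *: "(LINT z|lebesgue_on S. (norm (weak_deriv S e u z))\<^sup>2) = (LINT z|lebesgue_on S. (norm (v z))\<^sup>2)"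
    if "has_weak_deriv S e u v" and v: "v \<in> borel_measurable (lebesgue_on S)" for e v
  proof -
    have ae: "AE z in lebesgue_on S. weak_deriv S e u z = v z"
      using weak_deriv_AE_eq[OF assms(1) that(1)] .
    then have "weak_deriv S e u \<in> borel_measurable (lebesgue_on S)"
    proof (intro borel_measurable_lebesgue_on_AE[OF _ v])
      show "AE z in lebesgue_on S. v z = weak_deriv S e u z" using ae by eventually_elim simp
    qed (use assms(1) in simp)
    moreover have "AE z in lebesgue_on S. (norm (weak_deriv S e u z))\<^sup>2 = (norm (v z))\<^sup>2"
      using ae by eventually_elim simp
    ultimately show ?thesis using v by (intro integral_cong_AE) auto
  qed
  show ?thesis unfolding W12_norm_def Basis_real_prod using *[OF x] *[OF y] by (simp add: add.assoc)
qed
text \<open>Here the approximating functions attain the values \<open>g\<close> on the segments exactly, so that the convergence of the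
  restrictions is trivial and only the convergence of the \<open>W12\<close> norms has to be checked.\<close>

lemma has_trace_limit:
  fixes u ux uy :: "nat \<Rightarrow> real \<times> real \<Rightarrow> 'b::euclidean_space"
  assumes "open S"
    and x: "\<And>n. has_weak_deriv S (1, 0) (u n) (ux n)" "has_weak_deriv S (1, 0) q qx"
    and y: "\<And>n. has_weak_deriv S (0, 1) (u n) (uy n)" "has_weak_deriv S (0, 1) q qy"
    and sq: "\<And>n. square_integrable (lebesgue_on S) (u n)" "\<And>n. square_integrable (lebesgue_on S) (ux n)"
      "\<And>n. square_integrable (lebesgue_on S) (uy n)"
      "square_integrable (lebesgue_on S) q" "square_integrable (lebesgue_on S) qx" "square_integrable (lebesgue_on S) qy"
    and lim: "(\<lambda>n. LINT z|lebesgue_on S. (norm (u n z - q z))\<^sup>2) \<longlonglongrightarrow> 0"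
      "(\<lambda>n. LINT z|lebesgue_on S. (norm (ux n z - qx z))\<^sup>2) \<longlonglongrightarrow> 0"
      "(\<lambda>n. LINT z|lebesgue_on S. (norm (uy n z - qy z))\<^sup>2) \<longlonglongrightarrow> 0"
    and cont: "\<And>n. continuous_on (closure S) (u n)"
    and eq: "\<And>a b n t. (a, b) \<in> \<Gamma> \<Longrightarrow> t \<in> {0..1} \<Longrightarrow> u n (linepath a b t) = g (linepath a b t)"
  shows "has_trace S \<Gamma> q g"
proof -
  have S: "S \<in> sets lebesgue" using assms(1) by simp
  have norm: "W12_norm S (\<lambda>z. u n z - q z) = sqrt ((LINT z|lebesgue_on S. (norm (u n z - q z))\<^sup>2)
    + (LINT z|lebesgue_on S. (norm (ux n z - qx z))\<^sup>2) + (LINT z|lebesgue_on S. (norm (uy n z - qy z))\<^sup>2))" for n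
    by (rule W12_norm_eq[OF assms(1) has_weak_deriv_diff[OF S x(1) x(2)] _ has_weak_deriv_diff[OF S y(1) y(2)]])
      (use square_integrable_diff[OF sq(2,5)] square_integrable_diff[OF sq(3,6)] in \<open>auto simp: square_integrable_def\<close>)
  have "(\<lambda>n. W12_norm S (\<lambda>z. u n z - q z)) \<longlonglongrightarrow> sqrt (0 + 0 + 0)"
    unfolding norm by (intro tendsto_intros lim)
  then have W: "(\<lambda>n. W12_norm S (\<lambda>z. u n z - q z)) \<longlonglongrightarrow> 0" by simp
  have zero: "square_integrable (lebesgue_on {0..1}) (\<lambda>t. u n (linepath a b t) - g (linepath a b t)) \<and>
    (LINT t|lebesgue_on {0..1}. (norm (u n (linepath a b t) - g (linepath a b t)))\<^sup>2) = 0"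
    if ab: "(a, b) \<in> \<Gamma>" for a b n
  proof -
    have z: "u n (linepath a b t) - g (linepath a b t) = 0" if "t \<in> space (lebesgue_on {0..1})" for t
      using eq[OF ab, of t n] that by simp
    have "(\<lambda>t. u n (linepath a b t) - g (linepath a b t)) \<in> borel_measurable (lebesgue_on {0..1})
      \<longleftrightarrow> (\<lambda>t :: real. 0 :: 'b) \<in> borel_measurable (lebesgue_on {0..1})"
      by (rule measurable_cong) (rule z)
    moreover have "integrable (lebesgue_on {0..1}) (\<lambda>t. (norm (u n (linepath a b t) - g (linepath a b t)))\<^sup>2)
      \<longleftrightarrow> integrable (lebesgue_on {0..1}) (\<lambda>t :: real. 0 :: real)"
      by (rule Bochner_Integration.integrable_cong) (auto simp: z)
    moreover have "(LINT t|lebesgue_on {0..1}. (norm (u n (linepath a b t) - g (linepath a b t)))\<^sup>2) = (LINT t :: real|lebesgue_on {0..1}. 0)"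
      by (rule Bochner_Integration.integral_cong) (auto simp: z)
    ultimately show ?thesis by (simp add: square_integrable_def)
  qed
  show ?thesis
    unfolding has_trace_def
  proof (intro conjI exI[of _ u] allI)
    show "q \<in> W12 S" by (rule W12_I[OF sq(4) x(2) sq(5) y(2) sq(6)])
    show "u n \<in> W12 S" for n by (rule W12_I[OF sq(1) x(1) sq(2) y(1) sq(3)])
    show "continuous_on (closure S) (u n)" for n by (rule cont)
    show "(\<lambda>n. W12_norm S (\<lambda>z. u n z - q z)) \<longlonglongrightarrow> 0" by (rule W)
    show "\<forall>(a, b)\<in>\<Gamma>.
       (\<forall>n. square_integrable (lebesgue_on {0..1}) (\<lambda>t. u n (linepath a b t) - g (linepath a b t))) \<and>
       (\<lambda>n. dist a b * (LINT t|lebesgue_on {0..1}. (norm (u n (linepath a b t) - g (linepath a b t)))\<^sup>2)) \<longlonglongrightarrow> 0"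
      using zero by auto
  qed
qed
section \<open>Compactness\<close>

lemma integral_square_Cauchy_Schwarz:
  fixes g :: "real \<Rightarrow> real"
  assumes "a < b" and g: "continuous_on {a..b} g"
  shows "(integral {a..b} g)\<^sup>2 \<le> (b - a) * integral {a..b} (\<lambda>x. (g x)\<^sup>2)"
proof -
  define m where "m = integral {a..b} g / (b - a)"
  have i: "g integrable_on {a..b}" "(\<lambda>x. (g x)\<^sup>2) integrable_on {a..b}"
    using g by (auto intro!: integrable_continuous_interval continuous_intros)
  have "0 \<le> integral {a..b} (\<lambda>x. (g x - m)\<^sup>2)"
    using g by (intro integral_nonneg integrable_continuous_interval continuous_intros) auto
  also have "integral {a..b} (\<lambda>x. (g x - m)\<^sup>2) = integral {a..b} (\<lambda>x. (g x)\<^sup>2 - 2 * m * g x + m\<^sup>2)"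
    by (rule arg_cong[where f = "integral {a..b}"]) (auto simp: power2_diff)
  also have "\<dots> = integral {a..b} (\<lambda>x. (g x)\<^sup>2) - 2 * m * integral {a..b} g + m\<^sup>2 * (b - a)"
    using i assms(1) by (subst integral_add, (auto intro!: integrable_diff integrable_on_mult_right)[2])
      (subst integral_diff, auto intro!: integrable_on_mult_right)
  also have "2 * m * integral {a..b} g = 2 * m\<^sup>2 * (b - a)"
    using assms(1) by (simp add: m_def power2_eq_square)
  finally have "m\<^sup>2 * (b - a) \<le> integral {a..b} (\<lambda>x. (g x)\<^sup>2)" by (simp add: mult.commute)
  then have "(b - a) * (m\<^sup>2 * (b - a)) \<le> (b - a) * integral {a..b} (\<lambda>x. (g x)\<^sup>2)"
    using assms(1) by (intro mult_left_mono) auto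
  moreover have "(b - a) * (m\<^sup>2 * (b - a)) = (integral {a..b} g)\<^sup>2"
    using assms(1) by (simp add: m_def power_divide power2_eq_square)
  ultimately show ?thesis by simp
qed

text \<open>Every value of \<open>f\<close> is within \<open>sqrt (h D)\<close> of every other one, where \<open>D\<close> is the Dirichlet integral, hence also
  within that distance of the mean.\<close>

lemma Poincare_interval:
  fixes f f' :: "real \<Rightarrow> real"
  assumes "h > 0" and f: "\<And>x. (f has_real_derivative f' x) (at x)" and f': "continuous_on UNIV f'"
  shows "integral {a..a + h} (\<lambda>x. (f x)\<^sup>2)
    \<le> (integral {a..a + h} f)\<^sup>2 / h + h\<^sup>2 * integral {a..a + h} (\<lambda>x. (f' x)\<^sup>2)"
proof -
  let ?I = "{a..a + h}"
  define m where "m = integral ?I f / h"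
  define D where "D = integral ?I (\<lambda>x. (f' x)\<^sup>2)"
  have cf: "continuous_on S f" for S
    using f by (meson DERIV_isCont continuous_at_imp_continuous_on)
  have cf': "continuous_on S f'" for S using f' continuous_on_subset by blast
  have i: "f integrable_on {x..y}" "(\<lambda>x. (f x)\<^sup>2) integrable_on {x..y}" "(\<lambda>x. (f' x)\<^sup>2) integrable_on {x..y}" for x y
    by (auto intro!: integrable_continuous_interval continuous_intros cf cf')
  have D: "0 \<le> D" unfolding D_def by (intro integral_nonneg i) auto
  have dist: "(f y - f x)\<^sup>2 \<le> h * D" if "x \<in> ?I" "y \<in> ?I" "x < y" for x y
  proof -
    have "(f' has_integral (f y - f x)) {x..y}"
      using that f by (intro fundamental_theorem_of_calculus)
        (auto simp: has_real_derivative_iff_has_vector_derivative[symmetric] intro: has_field_derivative_at_within)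
    then have "(f y - f x)\<^sup>2 = (integral {x..y} f')\<^sup>2" by (simp add: integral_unique)
    also have "\<dots> \<le> (y - x) * integral {x..y} (\<lambda>x. (f' x)\<^sup>2)"
      using that by (intro integral_square_Cauchy_Schwarz cf')
    also have "\<dots> \<le> h * D"
      unfolding D_def using that assms(1) i
      by (intro mult_mono integral_subset_le integral_nonneg) auto
    finally show ?thesis .
  qed
  have dist': "\<bar>f x - f y\<bar> \<le> sqrt (h * D)" if "x \<in> ?I" "y \<in> ?I" for x y
  proof -
    consider "x < y" | "y < x" | "x = y" by linarith
    then have "(f x - f y)\<^sup>2 \<le> h * D"
    proof cases
      case 1 then show ?thesis using dist[OF that] by (simp add: power2_commute)
    next
      case 2 then show ?thesis using dist[OF that(2,1)] by simp
    qed (use D assms(1) in simp)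
    then show ?thesis using real_sqrt_le_mono by fastforce
  qed
  have mean: "(f x - m)\<^sup>2 \<le> h * D" if x: "x \<in> ?I" for x
  proof -
    have "integral ?I f \<le> integral ?I (\<lambda>_. f x + sqrt (h * D))"
      by (intro integral_le i) (use dist'[OF x] in \<open>auto simp: abs_le_iff algebra_simps\<close>)
    moreover have "integral ?I (\<lambda>_. f x - sqrt (h * D)) \<le> integral ?I f"
      by (intro integral_le i) (use dist'[OF x] in \<open>auto simp: abs_le_iff algebra_simps\<close>)
    ultimately have "\<bar>f x - m\<bar> \<le> sqrt (h * D)"
      using assms(1) by (simp add: m_def abs_le_iff field_simps)
    then have "\<bar>f x - m\<bar>\<^sup>2 \<le> (sqrt (h * D))\<^sup>2" by (intro power_mono) auto
    then show ?thesis using D assms(1) by simp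
  qed
  have ptw: "(f x)\<^sup>2 \<le> 2 * m * f x - m\<^sup>2 + h * D" if "x \<in> ?I" for x
    using mean[OF that] by (simp add: power2_diff algebra_simps)
  have "integral ?I (\<lambda>x. (f x)\<^sup>2) \<le> integral ?I (\<lambda>x. 2 * m * f x + (h * D - m\<^sup>2))"
    by (intro integral_le i integrable_add integrable_on_mult_right) (use ptw in \<open>auto simp: algebra_simps\<close>)
  also have "\<dots> = 2 * m * integral ?I f + h * (h * D - m\<^sup>2)"
    using assms(1) by (subst integral_add) (auto intro!: integrable_on_mult_right i)
  also have "\<dots> = (integral ?I f)\<^sup>2 / h + h\<^sup>2 * D"
    using assms(1) by (simp add: m_def field_simps power2_eq_square)
  finally show ?thesis unfolding D_def .
qed

text \<open>The inequality on intervals is used twice: in \<open>x\<close> for each fixed \<open>y\<close>, and in \<open>y\<close> for the integrals over \<open>x\<close>,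
  which are differentiable under the integral sign.\<close>

lemma Poincare_square:
  fixes w wx wy :: "real \<times> real \<Rightarrow> real"
  assumes "h > 0"
    and c: "continuous_on UNIV w" "continuous_on UNIV wx" "continuous_on UNIV wy"
    and dx: "\<And>x y. ((\<lambda>x. w (x, y)) has_real_derivative wx (x, y)) (at x)"
    and dy: "\<And>x y. ((\<lambda>y. w (x, y)) has_real_derivative wy (x, y)) (at y)"
  defines "Q a b \<equiv> cbox (a, b) (a + h, b + h)"
  shows "integral (Q a b) (\<lambda>z. (w z)\<^sup>2)
    \<le> (integral (Q a b) w)\<^sup>2 / h\<^sup>2 + h\<^sup>2 * integral (Q a b) (\<lambda>z. (wx z)\<^sup>2 + (wy z)\<^sup>2)"
proof -
  let ?I = "{a..a + h}" and ?J = "{b..b + h}"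
  have iter: "integral (Q a b) g = integral ?J (\<lambda>y. integral ?I (\<lambda>x. g (x, y)))"
    and cJ: "continuous_on UNIV (\<lambda>y. integral ?I (\<lambda>x. g (x, y)))"
    if g: "continuous_on UNIV g" for g :: "real \<times> real \<Rightarrow> real"
  proof -
    have g': "continuous_on S (\<lambda>(x, y). g (x, y))" for S using g continuous_on_subset by auto
    have "integral (Q a b) g = integral ?I (\<lambda>x. integral ?J (\<lambda>y. g (x, y)))"
      unfolding Q_def using g'[of "cbox (a, b) (a + h, b + h)"] by (subst integral_prod_continuous) auto
    also have "\<dots> = integral ?J (\<lambda>y. integral ?I (\<lambda>x. g (x, y)))"
      using integral_swap_continuous[OF g'[of "cbox (a, b) (a + h, b + h)"]] by simp
    finally show "integral (Q a b) g = integral ?J (\<lambda>y. integral ?I (\<lambda>x. g (x, y)))" .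
    have "continuous_on (UNIV \<times> cbox a (a + h)) (\<lambda>(y, x). g (x, y))"
    proof -
      have "continuous_on (UNIV \<times> cbox a (a + h)) (\<lambda>p. g (snd p, fst p))"
        by (intro continuous_on_compose2[OF g] continuous_intros) auto
      then show ?thesis by (simp add: case_prod_beta')
    qed
    from integral_continuous_on_param[OF this] show "continuous_on UNIV (\<lambda>y. integral ?I (\<lambda>x. g (x, y)))" by simp
  qed
  have cc: "continuous_on UNIV (\<lambda>z. (w z)\<^sup>2)" "continuous_on UNIV (\<lambda>z. (wx z)\<^sup>2)" "continuous_on UNIV (\<lambda>z. (wy z)\<^sup>2)"
    using c by (auto intro: continuous_intros)
  have line: "continuous_on S (\<lambda>x. g (x, y))" if "continuous_on UNIV g" for g :: "real \<times> real \<Rightarrow> real" and y S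
    by (intro continuous_on_compose2[OF that] continuous_intros) auto
  define m where "m y = integral ?I (\<lambda>x. w (x, y))" for y
  define m' where "m' y = integral ?I (\<lambda>x. wy (x, y))" for y
  have m_deriv: "(m has_real_derivative m' y) (at y)" for y
  proof -
    have "((\<lambda>y. integral (cbox a (a + h)) (\<lambda>x. w (x, y))) has_vector_derivative
        integral (cbox a (a + h)) (\<lambda>x. wy (x, y))) (at y within UNIV)"
    proof (rule leibniz_rule_vector_derivative)
      show "((\<lambda>y. w (x, y)) has_vector_derivative wy (x, y)) (at y within UNIV)" for x y
        using dy[of x y] by (simp add: has_real_derivative_iff_has_vector_derivative)
      show "(\<lambda>x. w (x, y)) integrable_on cbox a (a + h)" for y
        by (rule integrable_continuous) (rule line[OF c(1)])
      have "continuous_on (UNIV \<times> cbox a (a + h)) (\<lambda>p. wy (snd p, fst p))"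
        by (intro continuous_on_compose2[OF c(3)] continuous_intros) auto
      then show "continuous_on (UNIV \<times> cbox a (a + h)) (\<lambda>(y, x). wy (x, y))"
        by (simp add: case_prod_beta')
    qed auto
    then show ?thesis
      by (simp add: m_def[abs_def] m'_def has_real_derivative_iff_has_vector_derivative)
  qed
  have cm: "continuous_on UNIV m" "continuous_on UNIV m'"
    using cJ[OF c(1)] cJ[OF c(3)] by (simp_all add: m_def[abs_def] m'_def[abs_def])
  note ii = integrable_continuous_interval[OF continuous_on_subset[OF _ subset_UNIV]]
  have step1: "integral ?I (\<lambda>x. (w (x, y))\<^sup>2) \<le> (m y)\<^sup>2 / h + h\<^sup>2 * integral ?I (\<lambda>x. (wx (x, y))\<^sup>2)" for y
    unfolding m_def by (rule Poincare_interval[OF assms(1) dx line[OF c(2)]])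
  have step2: "(m' y)\<^sup>2 \<le> h * integral ?I (\<lambda>x. (wy (x, y))\<^sup>2)" for y
    unfolding m'_def using integral_square_Cauchy_Schwarz[OF _ line[OF c(3)], of a "a + h" y] assms(1) by simp
  have ci: "(\<lambda>y. (m y)\<^sup>2) integrable_on ?J" "(\<lambda>y. (m' y)\<^sup>2) integrable_on ?J"
    by (intro ii continuous_intros cm)+
  have iJ: "(\<lambda>y. integral ?I (\<lambda>x. g (x, y))) integrable_on ?J" if "continuous_on UNIV g" for g :: "real \<times> real \<Rightarrow> real"
    by (intro ii cJ that)
  have "integral (Q a b) (\<lambda>z. (w z)\<^sup>2) = integral ?J (\<lambda>y. integral ?I (\<lambda>x. (w (x, y))\<^sup>2))"
    by (rule iter[OF cc(1)])
  also have "\<dots> \<le> integral ?J (\<lambda>y. (m y)\<^sup>2 / h + h\<^sup>2 * integral ?I (\<lambda>x. (wx (x, y))\<^sup>2))"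
    by (intro integral_le iJ[OF cc(1)] integrable_add integrable_on_mult_right integrable_on_divide ci iJ[OF cc(2)] step1)
  also have "\<dots> = integral ?J (\<lambda>y. (m y)\<^sup>2) / h + h\<^sup>2 * integral (Q a b) (\<lambda>z. (wx z)\<^sup>2)"
    unfolding iter[OF cc(2)]
    by (subst integral_add) (auto intro!: integrable_on_mult_right integrable_on_divide ci iJ[OF cc(2)])
  also have "integral ?J (\<lambda>y. (m y)\<^sup>2) \<le> (integral ?J m)\<^sup>2 / h + h\<^sup>2 * integral ?J (\<lambda>y. (m' y)\<^sup>2)"
    by (rule Poincare_interval[OF assms(1) m_deriv cm(2)])
  also have "integral ?J m = integral (Q a b) w"
    unfolding iter[OF c(1)] m_def ..
  also have "integral ?J (\<lambda>y. (m' y)\<^sup>2) \<le> integral ?J (\<lambda>y. h * integral ?I (\<lambda>x. (wy (x, y))\<^sup>2))"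
    by (intro integral_le ci integrable_on_mult_right iJ[OF cc(3)] step2)
  also have "\<dots> = h * integral (Q a b) (\<lambda>z. (wy z)\<^sup>2)"
    unfolding iter[OF cc(3)] by simp
  finally have "integral (Q a b) (\<lambda>z. (w z)\<^sup>2)
    \<le> ((integral (Q a b) w)\<^sup>2 / h + h\<^sup>2 * (h * integral (Q a b) (\<lambda>z. (wy z)\<^sup>2))) / h + h\<^sup>2 * integral (Q a b) (\<lambda>z. (wx z)\<^sup>2)"
    using assms(1) by (simp add: divide_right_mono)
  also have "\<dots> = (integral (Q a b) w)\<^sup>2 / h\<^sup>2 + h\<^sup>2 * integral (Q a b) (\<lambda>z. (wx z)\<^sup>2 + (wy z)\<^sup>2)"
  proof -
    have "integral (Q a b) (\<lambda>z. (wx z)\<^sup>2 + (wy z)\<^sup>2)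
      = integral (Q a b) (\<lambda>z. (wx z)\<^sup>2) + integral (Q a b) (\<lambda>z. (wy z)\<^sup>2)"
      unfolding Q_def
      by (intro integral_add integrable_continuous continuous_on_subset[OF cc(2)] continuous_on_subset[OF cc(3)]) auto
    then show ?thesis using assms(1) by (simp add: field_simps power2_eq_square)
  qed
  finally show ?thesis .
qed

lemma integral_subdivide_interval:
  fixes f :: "real \<Rightarrow> real"
  assumes "h > 0" "continuous_on UNIV f"
  shows "integral {a..a + real N * h} f = (\<Sum>i<N. integral {a + real i * h..a + real i * h + h} f)"
proof (induction N)
  case (Suc N)
  have "integral {a..a + real N * h} f + integral {a + real N * h..a + real N * h + h} f
    = integral {a..a + real N * h + h} f"
    using assms by (intro Henstock_Kurzweil_Integration.integral_combine integrable_continuous_interval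
        continuous_on_subset[OF assms(2)]) auto
  with Suc show ?case by (simp add: algebra_simps)
qed simp

lemma integral_subdivide_square:
  fixes g :: "real \<times> real \<Rightarrow> real"
  assumes "h > 0" and g: "continuous_on UNIV g"
  shows "integral (cbox (a, b) (a + real N * h, b + real N * h)) g
    = (\<Sum>i<N. \<Sum>j<N. integral (cbox (a + real i * h, b + real j * h) (a + real i * h + h, b + real j * h + h)) g)"
proof -
  have iter: "integral (cbox (a, c) (b, d)) g = integral {a..b} (\<lambda>x. integral {c..d} (\<lambda>y. g (x, y)))" for a b c d
    using integral_prod_continuous[OF continuous_on_subset[OF g subset_UNIV], of a c b d] by simp
  have c: "continuous_on UNIV (\<lambda>x. integral {c..d} (\<lambda>y. g (x, y)))" for c d
    using integral_continuous_on_param[of UNIV c d "\<lambda>x y. g (x, y)"] continuous_on_subset[OF g subset_UNIV]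
    by simp
  have l: "continuous_on UNIV (\<lambda>y. g (x, y))" for x
    by (intro continuous_on_compose2[OF g] continuous_intros) auto
  show ?thesis
    unfolding iter integral_subdivide_interval[OF assms(1) l] integral_subdivide_interval[OF assms(1) c]
    by (subst integral_sum) (auto intro!: integrable_continuous_interval continuous_on_subset[OF c]
        simp: integral_subdivide_interval[OF assms(1) c] intro: sum.swap)
qed

lemma Poincare_grid:
  fixes w wx wy :: "real \<times> real \<Rightarrow> real"
  assumes "N > 0"
    and c: "continuous_on UNIV w" "continuous_on UNIV wx" "continuous_on UNIV wy"
    and dx: "\<And>x y. ((\<lambda>x. w (x, y)) has_real_derivative wx (x, y)) (at x)"
    and dy: "\<And>x y. ((\<lambda>y. w (x, y)) has_real_derivative wy (x, y)) (at y)"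
  defines "h \<equiv> 2 / real N"
  defines "Q i j \<equiv> cbox (-1 + real i * h, -1 + real j * h) (-1 + real i * h + h, -1 + real j * h + h)"
  shows "integral (cbox (-1, -1) (1, 1)) (\<lambda>z. (w z)\<^sup>2)
    \<le> (\<Sum>i<N. \<Sum>j<N. (integral (Q i j) w)\<^sup>2) / h\<^sup>2
      + h\<^sup>2 * integral (cbox (-1, -1) (1, 1)) (\<lambda>z. (wx z)\<^sup>2 + (wy z)\<^sup>2)"
proof -
  have h: "h > 0" "-1 + real N * h = 1" using assms(1) by (simp_all add: h_def)
  note sub = integral_subdivide_square[OF h(1), of _ "-1" "-1" N, unfolded h(2), folded Q_def]
  have c2: "continuous_on UNIV (\<lambda>z. (w z)\<^sup>2)" "continuous_on UNIV (\<lambda>z. (wx z)\<^sup>2 + (wy z)\<^sup>2)"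
    using c by (auto intro: continuous_intros)
  have "integral (cbox (-1, -1) (1, 1)) (\<lambda>z. (w z)\<^sup>2)
    \<le> (\<Sum>i<N. \<Sum>j<N. (integral (Q i j) w)\<^sup>2 / h\<^sup>2 + h\<^sup>2 * integral (Q i j) (\<lambda>z. (wx z)\<^sup>2 + (wy z)\<^sup>2))"
    unfolding sub[OF c2(1)] Q_def by (intro sum_mono Poincare_square[OF h(1) c dx dy])
  also have "\<dots> = (\<Sum>i<N. \<Sum>j<N. (integral (Q i j) w)\<^sup>2) / h\<^sup>2
      + h\<^sup>2 * integral (cbox (-1, -1) (1, 1)) (\<lambda>z. (wx z)\<^sup>2 + (wy z)\<^sup>2)"
    unfolding sub[OF c2(2)] by (simp add: sum.distrib sum_divide_distrib sum_distrib_left)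
  finally show ?thesis .
qed

definition C1_plane :: "(real \<times> real \<Rightarrow> real) \<Rightarrow> (real \<times> real \<Rightarrow> real) \<Rightarrow> (real \<times> real \<Rightarrow> real) \<Rightarrow> bool"
  where "C1_plane w wx wy \<longleftrightarrow>
    continuous_on UNIV w \<and> continuous_on UNIV wx \<and> continuous_on UNIV wy \<and>
    (\<forall>x y. ((\<lambda>x. w (x, y)) has_real_derivative wx (x, y)) (at x)) \<and>
    (\<forall>x y. ((\<lambda>y. w (x, y)) has_real_derivative wy (x, y)) (at y))"

lemma C1_plane_diff:
  "C1_plane w wx wy \<Longrightarrow> C1_plane w' wx' wy' \<Longrightarrow>
    C1_plane (\<lambda>z. w z - w' z) (\<lambda>z. wx z - wx' z) (\<lambda>z. wy z - wy' z)"
  unfolding C1_plane_def by (auto intro!: continuous_intros DERIV_diff)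

lemma square_diff_le: "(x - y)\<^sup>2 \<le> 2 * x\<^sup>2 + 2 * y\<^sup>2" for x y :: real
  using zero_le_power2[of "x + y"] by (simp add: power2_eq_square algebra_simps)

text \<open>A diagonal subsequence makes the integrals over all cells of all grids converge. On a grid of mesh \<open>h\<close> the
  inequality \<open>Poincare_grid\<close> bounds the squared \<open>L\<^sup>2\<close> norm of a difference by finitely many such integrals and \<open>h\<^sup>2\<close>
  times the bounded Dirichlet integrals. The index \<open>k\<close> numbers the components of a field, which have to share
  one subsequence.\<close>

lemma Rellich_square:
  fixes w wx wy :: "nat \<Rightarrow> 'i::finite \<Rightarrow> real \<times> real \<Rightarrow> real"
  defines "Q \<equiv> cbox (-1, -1) (1, 1) :: (real \<times> real) set"
  assumes C1: "\<And>n k. C1_plane (w n k) (wx n k) (wy n k)"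
    and bound: "\<And>n k. integral Q (\<lambda>z. (w n k z)\<^sup>2) \<le> K"
    and grad: "\<And>n k. integral Q (\<lambda>z. (wx n k z)\<^sup>2 + (wy n k z)\<^sup>2) \<le> K"
  obtains r :: "nat \<Rightarrow> nat" where "strict_mono r"
    "\<And>e. e > 0 \<Longrightarrow> \<exists>N. \<forall>m\<ge>N. \<forall>n\<ge>N. \<forall>k. integral Q (\<lambda>z. (w (r m) k z - w (r n) k z)\<^sup>2) < e"
proof -
  define cell where "cell N i j = cbox (-1 + real i * (2 / real N), -1 + real j * (2 / real N))
      (-1 + real i * (2 / real N) + 2 / real N, -1 + real j * (2 / real N) + 2 / real N)" for N i j
  \<comment> \<open>The value \<open>0\<close> for indices outside the grid keeps the family bounded.\<close>
  define avg where "avg n p = (case p of (N, i, j, k) \<Rightarrow> if i < N \<and> j < N then integral (cell N i j) (w n k) else 0)"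
    for n and p :: "nat \<times> nat \<times> nat \<times> 'i"
  have c: "continuous_on S (w n k)" "continuous_on S (wx n k)" "continuous_on S (wy n k)" for S n k
    using C1[of n k] continuous_on_subset unfolding C1_plane_def by blast+
  have avg_bound: "norm (avg n p) \<le> (4 + K) / 2" for n p
  proof -
    obtain N i j k where p: "p = (N, i, j, k)" by (cases p)
    have K0: "0 \<le> K"
      using bound[of n k] by (rule order_trans[rotated]) (auto intro!: integral_nonneg integrable_continuous continuous_intros c simp: Q_def)
    show ?thesis
    proof (cases "i < N \<and> j < N")
      case True
      then have N: "real N > 0" "real (Suc i) \<le> real N" "real (Suc j) \<le> real N" by auto
      define h where "h = 2 / real N"
      have "real (Suc i) * h \<le> real N * h" "real (Suc j) * h \<le> real N * h"
        using N by (intro mult_right_mono; simp add: h_def)+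
      moreover have "real N * h = 2" "0 \<le> real i * h" "0 \<le> real j * h" using N by (simp_all add: h_def)
      moreover define s t where "s = real i * h" and "t = real j * h"
      ultimately have "0 \<le> s" "s + h \<le> 2" "0 \<le> t" "t + h \<le> 2"
        by (simp_all add: algebra_simps)
      then have sub: "cell N i j \<subseteq> Q"
        unfolding cell_def Q_def h_def[symmetric] s_def[symmetric] t_def[symmetric] by auto
      have i: "g integrable_on cell N i j" "g integrable_on Q" if "continuous_on UNIV g" for g :: "real \<times> real \<Rightarrow> real"
        unfolding cell_def Q_def using that by (auto intro: integrable_continuous continuous_on_subset)
      have cg: "continuous_on UNIV (\<lambda>z. (1 + (w n k z)\<^sup>2) / 2)" by (intro continuous_intros c) auto
      have b: "\<bar>x\<bar> \<le> (1 + x\<^sup>2) / 2" for x :: real using sum_squares_bound[of 1 "\<bar>x\<bar>"] by simp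
      have "norm (integral (cell N i j) (w n k)) \<le> integral (cell N i j) (\<lambda>z. (1 + (w n k z)\<^sup>2) / 2)"
        using b by (intro integral_norm_bound_integral i c cg) auto
      also have "\<dots> \<le> integral Q (\<lambda>z. (1 + (w n k z)\<^sup>2) / 2)"
        by (intro integral_subset_le sub i cg) auto
      also have "\<dots> = (4 + integral Q (\<lambda>z. (w n k z)\<^sup>2)) / 2"
      proof -
        have "integral Q (\<lambda>z. 1 + (w n k z)\<^sup>2) = integral Q (\<lambda>z. 1) + integral Q (\<lambda>z. (w n k z)\<^sup>2)"
          by (intro integral_add i continuous_intros c)
        also have "integral Q (\<lambda>z. 1::real) = 4" by (simp add: Q_def content_Pair)
        finally show ?thesis by simp
      qed
      also have "\<dots> \<le> (4 + K) / 2" using bound[of n k] by simp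
      finally show ?thesis using True by (simp add: p avg_def)
    next
      case False
      then show ?thesis using K0 by (auto simp: p avg_def)
    qed
  qed
  have "countable (UNIV :: (nat \<times> nat \<times> nat \<times> 'i) set)"
    using countable_SIGMA[of UNIV "\<lambda>_. UNIV"] by (metis UNIV_Times_UNIV countableI_type countable_SIGMA countable_finite finite)
  then obtain r where r: "strict_mono r" and conv: "\<And>p. \<exists>l. (\<lambda>n. avg (r n) p) \<longlonglongrightarrow> l"
    using function_convergent_subsequence[of UNIV avg, OF _ avg_bound] by (metis UNIV_I)
  have "\<exists>N. \<forall>m\<ge>N. \<forall>n\<ge>N. \<forall>k. integral Q (\<lambda>z. (w (r m) k z - w (r n) k z)\<^sup>2) < e" if "e > 0" for e
  proof -
    have K0: "0 \<le> K"
      using bound[of 0 undefined] by (rule order_trans[rotated]) (auto intro!: integral_nonneg integrable_continuous continuous_intros c simp: Q_def)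
    \<comment> \<open>With mesh \<open>h = 2 / N\<close>, the gradient term is at most \<open>4 K h\<^sup>2 = 16 K / N\<^sup>2\<close>, which is to be below \<open>e / 2\<close>.\<close>
    obtain N0 :: nat where N0: "32 * K / e < real N0" using reals_Archimedean2 by blast
    define N where "N = Suc N0"
    define h where "h = 2 / real N"
    have N: "N > 0" "real N \<ge> 1" "32 * K / e < real N" using N0 by (auto simp: N_def)
    have h: "h > 0" using N by (simp add: h_def)
    have small: "h\<^sup>2 * (4 * K) < e / 2"
    proof -
      have "32 * K < e * real N" using N(3) \<open>e > 0\<close> by (simp add: field_simps)
      also have "\<dots> \<le> e * (real N * real N)" using N \<open>e > 0\<close> by simp
      finally show ?thesis using N by (simp add: h_def power2_eq_square field_simps)
    qed
    \<comment> \<open>There are \<open>N\<^sup>2\<close> cells, and the sum of their contributions is divided by \<open>h\<^sup>2\<close>.\<close>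
    define \<eta> where "\<eta> = e / 2 * h\<^sup>2 / (real N * real N)"
    have \<eta>: "\<eta> > 0" using \<open>e > 0\<close> h N by (simp add: \<eta>_def)
    have ev: "\<forall>\<^sub>F n in sequentially. \<forall>m\<ge>n. \<forall>l\<ge>n. \<bar>avg (r m) p - avg (r l) p\<bar> < sqrt \<eta>" for p
    proof -
      have "Cauchy (\<lambda>n. avg (r n) p)" using conv[of p] LIMSEQ_imp_Cauchy by blast
      then obtain M where "\<forall>m\<ge>M. \<forall>l\<ge>M. dist (avg (r m) p) (avg (r l) p) < sqrt \<eta>"
        unfolding Cauchy_def using \<eta> by (meson real_sqrt_gt_zero)
      then show ?thesis by (intro eventually_sequentiallyI[of M]) (auto simp: dist_real_def)
    qed
    have "finite ({N} \<times> {..<N} \<times> {..<N} \<times> (UNIV :: 'i set))" by simp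
    then have "\<forall>\<^sub>F n in sequentially. \<forall>p\<in>{N} \<times> {..<N} \<times> {..<N} \<times> UNIV. \<forall>m\<ge>n. \<forall>l\<ge>n. \<bar>avg (r m) p - avg (r l) p\<bar> < sqrt \<eta>"
      by (rule eventually_ball_finite) (use ev in blast)
    then obtain M where "\<forall>n\<ge>M. \<forall>p\<in>{N} \<times> {..<N} \<times> {..<N} \<times> UNIV. \<forall>m\<ge>n. \<forall>l\<ge>n. \<bar>avg (r m) p - avg (r l) p\<bar> < sqrt \<eta>"
      unfolding eventually_sequentially by (rule exE)
    then have M: "\<bar>avg (r m) p - avg (r l) p\<bar> < sqrt \<eta>"
      if "p \<in> {N} \<times> {..<N} \<times> {..<N} \<times> UNIV" "m \<ge> M" "l \<ge> M" for p m l
      using that order_refl[of M] by blast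
    have "integral Q (\<lambda>z. (w (r m) k z - w (r n) k z)\<^sup>2) < e" if "m \<ge> M" "n \<ge> M" for m n k
    proof -
      let ?d = "\<lambda>z. w (r m) k z - w (r n) k z"
      let ?dx = "\<lambda>z. wx (r m) k z - wx (r n) k z" and ?dy = "\<lambda>z. wy (r m) k z - wy (r n) k z"
      have d: "C1_plane ?d ?dx ?dy" using C1 by (rule C1_plane_diff) (rule C1)
      have cell: "(integral (cell N i j) ?d)\<^sup>2 \<le> \<eta>" if "i < N" "j < N" for i j
      proof -
        have "integral (cell N i j) ?d = avg (r m) (N, i, j, k) - avg (r n) (N, i, j, k)"
        proof -
          have "w n' k integrable_on cell N i j" for n'
            unfolding cell_def by (intro integrable_continuous c)
          then show ?thesis using that by (simp add: avg_def integral_diff)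
        qed
        then have "\<bar>integral (cell N i j) ?d\<bar> \<le> sqrt \<eta>"
          using M[of "(N, i, j, k)" m n] that \<open>m \<ge> M\<close> \<open>n \<ge> M\<close> by simp
        then have "\<bar>integral (cell N i j) ?d\<bar>\<^sup>2 \<le> (sqrt \<eta>)\<^sup>2" by (intro power_mono) auto
        then show ?thesis using \<eta> by simp
      qed
      have "(\<Sum>i<N. \<Sum>j<N. (integral (cell N i j) ?d)\<^sup>2) \<le> (\<Sum>i<N. \<Sum>j<N. \<eta>)"
        by (intro sum_mono cell) auto
      also have "\<dots> = e / 2 * h\<^sup>2" using N by (simp add: \<eta>_def)
      finally have 1: "(\<Sum>i<N. \<Sum>j<N. (integral (cell N i j) ?d)\<^sup>2) / h\<^sup>2 \<le> e / 2"
        using h by (simp add: pos_divide_le_eq)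
      have iQ: "g integrable_on Q" if "continuous_on UNIV g" for g :: "real \<times> real \<Rightarrow> real"
        unfolding Q_def using that by (auto intro: integrable_continuous continuous_on_subset)
      have "integral Q (\<lambda>z. (?dx z)\<^sup>2 + (?dy z)\<^sup>2)
        \<le> integral Q (\<lambda>z. 2 * ((wx (r m) k z)\<^sup>2 + (wy (r m) k z)\<^sup>2) + 2 * ((wx (r n) k z)\<^sup>2 + (wy (r n) k z)\<^sup>2))"
      proof (rule integral_le)
        show "(?dx z)\<^sup>2 + (?dy z)\<^sup>2 \<le> 2 * ((wx (r m) k z)\<^sup>2 + (wy (r m) k z)\<^sup>2) + 2 * ((wx (r n) k z)\<^sup>2 + (wy (r n) k z)\<^sup>2)" for z
          using square_diff_le[of "wx (r m) k z" "wx (r n) k z"] square_diff_le[of "wy (r m) k z" "wy (r n) k z"] by simp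
      qed (intro iQ continuous_intros c)+
      also have "\<dots> = 2 * integral Q (\<lambda>z. (wx (r m) k z)\<^sup>2 + (wy (r m) k z)\<^sup>2) + 2 * integral Q (\<lambda>z. (wx (r n) k z)\<^sup>2 + (wy (r n) k z)\<^sup>2)"
        by (subst integral_add, (intro iQ continuous_intros c)+) (simp only: integral_mult_right)
      also have "\<dots> \<le> 4 * K" using grad[of "r m" k] grad[of "r n" k] by simp
      finally have 2: "h\<^sup>2 * integral Q (\<lambda>z. (?dx z)\<^sup>2 + (?dy z)\<^sup>2) < e / 2"
        using small h by (smt (verit) mult_left_mono zero_le_power2)
      have "integral Q (\<lambda>z. (?d z)\<^sup>2) \<le> (\<Sum>i<N. \<Sum>j<N. (integral (cell N i j) ?d)\<^sup>2) / h\<^sup>2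
          + h\<^sup>2 * integral Q (\<lambda>z. (?dx z)\<^sup>2 + (?dy z)\<^sup>2)"
        unfolding Q_def cell_def h_def using d unfolding C1_plane_def by (intro Poincare_grid[OF N(1)]) auto
      with 1 2 show ?thesis by linarith
    qed
    then show ?thesis by blast
  qed
  with r show thesis using that by blast
qed

section \<open>Minimizing sequences of quartic energies\<close>

definition bounded_measurable :: "'a measure \<Rightarrow> ('a \<Rightarrow> 'b::euclidean_space) \<Rightarrow> bool"
  where "bounded_measurable M f \<longleftrightarrow> f \<in> borel_measurable M \<and> (\<exists>B. \<forall>z. norm (f z) \<le> B)"

lemma bounded_measurable_add:
  assumes "bounded_measurable M f" "bounded_measurable M g"
  shows "bounded_measurable M (\<lambda>z. f z + g z)"
proof -
  obtain B B' where "\<And>z. norm (f z) \<le> B" "\<And>z. norm (g z) \<le> B'"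
    using assms by (auto simp: bounded_measurable_def)
  then have "norm (f z + g z) \<le> B + B'" for z by (intro norm_triangle_le add_mono)
  then show ?thesis using assms by (auto simp: bounded_measurable_def)
qed

lemma bounded_measurable_scaleR:
  assumes "bounded_measurable M f" shows "bounded_measurable M (\<lambda>z. t *\<^sub>R f z)"
proof -
  obtain B where "\<And>z. norm (f z) \<le> B" using assms by (auto simp: bounded_measurable_def)
  then have "norm (t *\<^sub>R f z) \<le> \<bar>t\<bar> * B" for z by (simp add: mult_left_mono)
  then show ?thesis using assms by (auto simp: bounded_measurable_def)
qed

lemma bounded_measurable_Pair:
  assumes "bounded_measurable M f" "bounded_measurable M g"
  shows "bounded_measurable M (\<lambda>z. (f z, g z))"
proof -
  obtain B B' where "\<And>z. norm (f z) \<le> B" "\<And>z. norm (g z) \<le> B'"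
    using assms by (auto simp: bounded_measurable_def)
  then have "norm (f z, g z) \<le> B + B'" for z by (intro order_trans[OF norm_Pair_le] add_mono)
  then show ?thesis using assms by (auto simp: bounded_measurable_def)
qed

lemma bounded_measurable_integrable:
  assumes M: "finite_measure M" and f: "bounded_measurable M f"
    and H: "continuous_on UNIV (H :: 'b::euclidean_space \<Rightarrow> real)"
  shows "integrable M (\<lambda>z. H (f z))"
proof -
  interpret finite_measure M by fact
  obtain B where B: "\<And>z. norm (f z) \<le> B" and fm: "f \<in> borel_measurable M"
    using f by (auto simp: bounded_measurable_def)
  have "compact (H ` cball 0 B)"
    using H by (meson compact_cball compact_continuous_image continuous_on_subset subset_UNIV)
  then obtain B' where "\<And>y. y \<in> H ` cball 0 B \<Longrightarrow> norm y \<le> B'"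
    by (meson bounded_iff compact_imp_bounded)
  then have "norm (H (f z)) \<le> B'" for z using B[of z] by auto
  moreover have "(\<lambda>z. H (f z)) \<in> borel_measurable M"
    using measurable_compose[OF fm borel_measurable_continuous_onI[OF H]] .
  ultimately show ?thesis by (intro integrable_const_bound[where B = B']) auto
qed

text \<open>The properties of an energy density \<open>F\<close>, a function of the value \<open>fst w\<close> and the gradient \<open>snd w\<close> of a field, from
  which minimizers and their Euler-Lagrange equations are derived; \<open>dF w\<close> is the derivative of \<open>F\<close> at \<open>w\<close>.
  The assumption \<open>midpoint\<close> is uniform convexity in the gradient, up to an error that only involves the values;
  \<open>taylor\<close> and \<open>lipschitz\<close> restrict the growth in the value to that of a quartic polynomial and the growth in the
  gradient to that of a quadratic one.\<close>

locale quartic_energy =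
  fixes F :: "'p::euclidean_space \<times> 'g::euclidean_space \<Rightarrow> real"
    and dF :: "'p \<times> 'g \<Rightarrow> 'p \<times> 'g \<Rightarrow> real" and c K :: real
  assumes c: "c > 0" and K: "K \<ge> 0"
    and continuous: "continuous_on UNIV F"
    and continuous_deriv: "continuous_on UNIV (\<lambda>(w, k). dF w k)"
    and deriv_zero: "dF 0 k = 0"
    and coercive: "c * ((norm (snd w))\<^sup>2 + (norm (fst w)) ^ 4) - K \<le> F w"
    and midpoint: "c * (norm (snd w - snd w'))\<^sup>2 - K * (norm (fst w - fst w'))\<^sup>2
      \<le> F w + F w' - 2 * F ((1 / 2) *\<^sub>R (w + w'))"
    and taylor: "\<bar>t\<bar> \<le> 1 \<Longrightarrow>
      F (w + t *\<^sub>R k) \<le> F w + t * dF w k + t\<^sup>2 * (K * ((1 + (norm k)\<^sup>2)\<^sup>2 * (1 + (norm (fst w))\<^sup>2)))"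
    and lipschitz: "\<bar>dF w k - dF w' k\<bar>
      \<le> K * norm k * ((2 + (norm (fst w))\<^sup>2 + (norm (fst w'))\<^sup>2) * norm (w - w'))"
begin

lemma deriv_bound: "\<bar>dF w k\<bar> \<le> K * norm k * ((2 + (norm (fst w))\<^sup>2) * norm w)"
  using lipschitz[of w k 0] by (simp add: deriv_zero)

lemma weight_bound: "(2 + a\<^sup>2 + b\<^sup>2)\<^sup>2 \<le> 12 + 3 * a ^ 4 + 3 * (b :: real) ^ 4"
proof -
  have "0 \<le> (2 - a\<^sup>2)\<^sup>2 + (2 - b\<^sup>2)\<^sup>2 + (a\<^sup>2 - b\<^sup>2)\<^sup>2" by simp
  then show ?thesis by (simp add: power2_eq_square algebra_simps power4_eq_xxxx)
qed

text \<open>The first component of the jets in \<open>V\<close> is compact in \<open>L\<^sup>2\<close> by \<open>V_compact\<close>, and \<open>midpoint\<close> transfers the convergence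
  of the values to the gradients. The last conclusion does not mention \<open>V\<close>: it allows the first variation at the
  limit to be computed in directions that are not in \<open>V\<close>, provided that it is known along the sequence.\<close>

lemma direct_method:
  fixes M :: "'a measure"
  assumes M: "finite_measure M"
    and j0: "bounded_measurable M j0"
    and V_bounded: "\<And>k. k \<in> V \<Longrightarrow> bounded_measurable M k"
    and V_zero: "(\<lambda>_. 0) \<in> V"
    and V_add: "\<And>k k'. k \<in> V \<Longrightarrow> k' \<in> V \<Longrightarrow> (\<lambda>z. k z + k' z) \<in> V"
    and V_scale: "\<And>k t. k \<in> V \<Longrightarrow> (\<lambda>z. t *\<^sub>R k z) \<in> V"
    and V_compact: "\<And>(ks :: nat \<Rightarrow> 'a \<Rightarrow> 'p \<times> 'g) K. (\<And>n. ks n \<in> V) \<Longrightarrow> (\<And>n. (LINT z|M. (norm (ks n z))\<^sup>2) \<le> K) \<Longrightarrow>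
      \<exists>r :: nat \<Rightarrow> nat. strict_mono r \<and> (\<forall>e>0. \<exists>N. \<forall>m\<ge>N. \<forall>n\<ge>N. (LINT z|M. (norm (fst (ks (r m) z) - fst (ks (r n) z)))\<^sup>2) < e)"
  obtains ks j where "\<And>n. ks n \<in> V" "square_integrable M j"
    "(\<lambda>n. LINT z|M. (norm (j0 z + ks n z - j z))\<^sup>2) \<longlonglongrightarrow> 0"
    "\<And>k. k \<in> V \<Longrightarrow> (\<lambda>n. LINT z|M. dF (j0 z + ks n z) (k z)) \<longlonglongrightarrow> 0"
    "\<And>k. bounded_measurable M k \<Longrightarrow> integrable M (\<lambda>z. dF (j z) (k z)) \<and>
      (\<lambda>n. LINT z|M. dF (j0 z + ks n z) (k z)) \<longlonglongrightarrow> (LINT z|M. dF (j z) (k z))"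
proof -
  interpret finite_measure M by fact
  define \<mu> where "\<mu> = measure M (space M)"
  define E where "E k = (LINT z|M. F (j0 z + k z))" for k
  have bj: "bounded_measurable M (\<lambda>z. j0 z + k z)" if "k \<in> V" for k
    using bounded_measurable_add[OF j0 V_bounded[OF that]] .
  note int = bounded_measurable_integrable[OF M]
  have Fi: "integrable M (\<lambda>z. F (j0 z + k z))" if "k \<in> V" for k
    using int[OF bj[OF that] continuous] .
  have cont4: "continuous_on UNIV (\<lambda>w :: 'p \<times> 'g. (norm (fst w)) ^ 4)"
    "continuous_on UNIV (\<lambda>w :: 'p \<times> 'g. (norm (fst w))\<^sup>2)"
    "continuous_on UNIV (\<lambda>w :: 'p \<times> 'g. (norm (snd w))\<^sup>2)"
    "continuous_on UNIV (\<lambda>w :: 'p \<times> 'g. (norm w)\<^sup>2)"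
    by (intro continuous_intros)+
  note i4 = int[OF _ cont4(1)] int[OF _ cont4(2)] int[OF _ cont4(3)] int[OF _ cont4(4)]
  have E_lower: "c * (LINT z|M. (norm (snd (j0 z + k z)))\<^sup>2 + (norm (fst (j0 z + k z))) ^ 4) \<le> E k + K * \<mu>"
    if "k \<in> V" for k
  proof -
    have "(LINT z|M. c * ((norm (snd (j0 z + k z)))\<^sup>2 + (norm (fst (j0 z + k z))) ^ 4)) \<le> (LINT z|M. F (j0 z + k z) + K)"
    proof (rule integral_mono)
      show "c * ((norm (snd (j0 z + k z)))\<^sup>2 + (norm (fst (j0 z + k z))) ^ 4) \<le> F (j0 z + k z) + K" for z
        using coercive[of "j0 z + k z"] by simp
    qed (use i4[OF bj[OF that]] Fi[OF that] in auto)
    also have "\<dots> = E k + K * \<mu>" using Fi[OF that] by (simp add: E_def \<mu>_def)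
    finally show ?thesis by simp
  qed
  \<comment> \<open>The infimum is approached with errors \<open>\<delta> n = 1 / (n + 1)\<close>, whose square roots serve as step sizes below.\<close>
  define m where "m = Inf (E ` V)"
  have bdd: "bdd_below (E ` V)"
  proof (rule bdd_belowI2)
    fix k assume "k \<in> V"
    have "0 \<le> c * (LINT z|M. (norm (snd (j0 z + k z)))\<^sup>2 + (norm (fst (j0 z + k z))) ^ 4)"
      using c by (intro mult_nonneg_nonneg integral_nonneg_AE) auto
    then show "- (K * \<mu>) \<le> E k" using E_lower[OF \<open>k \<in> V\<close>] by simp
  qed
  have m_le: "m \<le> E k" if "k \<in> V" for k
    unfolding m_def using that bdd by (rule cINF_lower[rotated])
  define \<delta> where "\<delta> n = 1 / real (Suc n)" for n
  have \<delta>: "\<delta> n > 0" "\<delta> n \<le> 1" for n by (simp_all add: \<delta>_def)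
  have "\<exists>k\<in>V. E k < m + \<delta> n" for n
  proof -
    have "Inf (E ` V) < m + \<delta> n" using \<delta>(1)[of n] by (simp add: m_def)
    then show ?thesis using cInf_lessD[of "E ` V"] V_zero by blast
  qed
  then obtain ks0 where ks0: "\<And>n. ks0 n \<in> V" "\<And>n. E (ks0 n) < m + \<delta> n" by metis
  define K1 where "K1 = (m + 1 + K * \<mu>) / c"
  have grad_bound: "(LINT z|M. (norm (snd (j0 z + ks0 n z)))\<^sup>2) \<le> K1"
    and quart_bound: "(LINT z|M. (norm (fst (j0 z + ks0 n z))) ^ 4) \<le> K1" for n
  proof -
    have "(LINT z|M. (norm (snd (j0 z + ks0 n z)))\<^sup>2 + (norm (fst (j0 z + ks0 n z))) ^ 4) \<le> K1"
      using E_lower[OF ks0(1)[of n]] ks0(2)[of n] \<delta>(2)[of n] c by (simp add: K1_def field_simps)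
    then have "(LINT z|M. (norm (snd (j0 z + ks0 n z)))\<^sup>2) + (LINT z|M. (norm (fst (j0 z + ks0 n z))) ^ 4) \<le> K1"
      using i4[OF bj[OF ks0(1)]] by simp
    moreover have "0 \<le> (LINT z|M. (norm (snd (j0 z + ks0 n z)))\<^sup>2)" "0 \<le> (LINT z|M. (norm (fst (j0 z + ks0 n z))) ^ 4)"
      by (intro integral_nonneg_AE; simp)+
    ultimately show "(LINT z|M. (norm (snd (j0 z + ks0 n z)))\<^sup>2) \<le> K1"
      "(LINT z|M. (norm (fst (j0 z + ks0 n z))) ^ 4) \<le> K1" by linarith+
  qed
  have sq_bound: "(LINT z|M. (norm (fst (j0 z + ks0 n z)))\<^sup>2) \<le> \<mu> + K1" for n
  proof -
    have "t\<^sup>2 \<le> 1 + t ^ 4" for t :: real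
    proof -
      have "2 * t\<^sup>2 \<le> t ^ 4 + 1" using sum_squares_bound[of "t\<^sup>2" 1] by simp
      with zero_le_power2[of t] show ?thesis by linarith
    qed
    then have "(LINT z|M. (norm (fst (j0 z + ks0 n z)))\<^sup>2) \<le> (LINT z|M. 1 + (norm (fst (j0 z + ks0 n z))) ^ 4)"
      using i4[OF bj[OF ks0(1)]] by (intro integral_mono) auto
    then show ?thesis using quart_bound[of n] i4[OF bj[OF ks0(1)]] by (simp add: \<mu>_def)
  qed
  have norm2: "(norm w)\<^sup>2 = (norm (fst w))\<^sup>2 + (norm (snd w))\<^sup>2" for w :: "'p \<times> 'g"
    by (cases w) (simp add: norm_Pair)
  have "(LINT z|M. (norm (ks0 n z))\<^sup>2) \<le> 2 * (\<mu> + 2 * K1) + 2 * (LINT z|M. (norm (j0 z))\<^sup>2)" for n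
  proof -
    have "(LINT z|M. (norm (ks0 n z))\<^sup>2) \<le> (LINT z|M. 2 * (norm (j0 z + ks0 n z))\<^sup>2 + 2 * (norm (j0 z))\<^sup>2)"
    proof (rule integral_mono)
      show "(norm (ks0 n z))\<^sup>2 \<le> 2 * (norm (j0 z + ks0 n z))\<^sup>2 + 2 * (norm (j0 z))\<^sup>2" for z
        using norm_add_power2_le[of "j0 z + ks0 n z" "- j0 z"] by simp
    qed (use i4(4)[OF bj[OF ks0(1)]] i4(4)[OF j0] i4(4)[OF V_bounded[OF ks0(1)]] in auto)
    also have "\<dots> = 2 * (LINT z|M. (norm (j0 z + ks0 n z))\<^sup>2) + 2 * (LINT z|M. (norm (j0 z))\<^sup>2)"
      using i4(4)[OF bj[OF ks0(1)]] i4(4)[OF j0] by simp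
    also have "(LINT z|M. (norm (j0 z + ks0 n z))\<^sup>2)
      = (LINT z|M. (norm (fst (j0 z + ks0 n z)))\<^sup>2) + (LINT z|M. (norm (snd (j0 z + ks0 n z)))\<^sup>2)"
      unfolding norm2[of "j0 _ + ks0 n _"] using i4(2,3)[OF bj[OF ks0(1)]] by (rule Bochner_Integration.integral_add)
    finally show ?thesis using sq_bound[of n] grad_bound[of n] by simp
  qed
  from V_compact[of ks0, OF ks0(1) this] obtain r :: "nat \<Rightarrow> nat" where r: "strict_mono r"
    and rc: "\<forall>e>0. \<exists>N. \<forall>m\<ge>N. \<forall>n\<ge>N. (LINT z|M. (norm (fst (ks0 (r m) z) - fst (ks0 (r n) z)))\<^sup>2) < e"
    by blast
  define ks where "ks n = ks0 (r n)" for n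
  define js where "js n z = j0 z + ks n z" for n z
  have ksV: "ks n \<in> V" for n by (simp add: ks_def ks0)
  have jsb: "bounded_measurable M (js n)" for n using bj[OF ksV[of n]] by (simp add: js_def[abs_def])
  have ksE: "E (ks n) < m + \<delta> n" for n
  proof -
    have "\<delta> (r n) \<le> \<delta> n" using seq_suble[OF r, of n] by (simp add: \<delta>_def frac_le)
    then show ?thesis using ks0(2)[of "r n"] by (simp add: ks_def)
  qed
  have \<delta>0: "\<delta> \<longlonglongrightarrow> 0" unfolding \<delta>_def using LIMSEQ_inverse_real_of_nat by (simp add: inverse_eq_divide)
  have diff: "js a z - js b z = ks a z - ks b z" for a b z by (simp add: js_def)
  have jsq: "square_integrable M (js n)" for n
    using jsb[of n] i4(4)[OF jsb[of n]] by (auto simp: square_integrable_def bounded_measurable_def)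
  have diffi: "integrable M (\<lambda>z. (norm (fst (js a z) - fst (js b z)))\<^sup>2)" "integrable M (\<lambda>z. (norm (snd (js a z) - snd (js b z)))\<^sup>2)" for a b
    using i4(2,3)[OF bounded_measurable_add[OF jsb[of a] bounded_measurable_scaleR[OF jsb[of b], of "-1"]]] by simp_all
  \<comment> \<open>The energy at the midpoint is at least \<open>m\<close>, and the two energies exceed \<open>m\<close> by at most \<open>\<delta> a\<close> and \<open>\<delta> b\<close>.\<close>
  have grad_Cauchy: "c * (LINT z|M. (norm (snd (js a z) - snd (js b z)))\<^sup>2)
    \<le> \<delta> a + \<delta> b + K * (LINT z|M. (norm (fst (js a z) - fst (js b z)))\<^sup>2)" for a b
  proof -
    define k where "k z = (1 / 2) *\<^sub>R (ks a z + ks b z)" for z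
    have kV: "k \<in> V" unfolding k_def[abs_def] by (intro V_scale V_add ksV)
    have mid: "(1 / 2) *\<^sub>R (js a z + js b z) = j0 z + k z" for z
    proof -
      have "js a z + js b z = 2 *\<^sub>R j0 z + (ks a z + ks b z)" by (simp add: js_def scaleR_2)
      then show ?thesis by (simp add: k_def scaleR_add_right)
    qed
    have Fj: "integrable M (\<lambda>z. F (js n z))" for n using int[OF jsb continuous] .
    have "(LINT z|M. c * (norm (snd (js a z) - snd (js b z)))\<^sup>2 - K * (norm (fst (js a z) - fst (js b z)))\<^sup>2)
      \<le> (LINT z|M. F (js a z) + F (js b z) - 2 * F (j0 z + k z))"
    proof (rule integral_mono)
      show "c * (norm (snd (js a z) - snd (js b z)))\<^sup>2 - K * (norm (fst (js a z) - fst (js b z)))\<^sup>2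
        \<le> F (js a z) + F (js b z) - 2 * F (j0 z + k z)" for z
        using midpoint[of "js a z" "js b z"] unfolding mid .
    qed (use diffi Fj Fi[OF kV] in auto)
    then have "c * (LINT z|M. (norm (snd (js a z) - snd (js b z)))\<^sup>2) - K * (LINT z|M. (norm (fst (js a z) - fst (js b z)))\<^sup>2)
      \<le> E (ks a) + E (ks b) - 2 * E k"
      using diffi Fj Fi[OF kV] by (simp add: E_def js_def)
    then show ?thesis using ksE[of a] ksE[of b] m_le[OF kV] by simp
  qed
  have Cauchy: "\<exists>N. \<forall>a\<ge>N. \<forall>b\<ge>N. (LINT z|M. (norm (js a z - js b z))\<^sup>2) < e" if "e > 0" for e
  proof -
    define D where "D = 1 + K + c"
    define e' where "e' = e * c / (2 * D)"
    have den: "D > 0" using c K by (simp add: D_def)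
    have e': "e' > 0" using that c den by (simp add: e'_def)
    from rc[rule_format, OF e'] obtain N1 where
      "\<forall>a\<ge>N1. \<forall>b\<ge>N1. (LINT z|M. (norm (fst (ks0 (r a) z) - fst (ks0 (r b) z)))\<^sup>2) < e'" ..
    then have N1: "(LINT z|M. (norm (fst (js a z) - fst (js b z)))\<^sup>2) < e'" if "a \<ge> N1" "b \<ge> N1" for a b
      using that by (simp add: js_def ks_def)
    have "\<forall>\<^sub>F n in sequentially. \<delta> n < e' / 2" using \<delta>0 e' by (intro order_tendstoD) auto
    then obtain N2 where N2: "\<And>n. n \<ge> N2 \<Longrightarrow> \<delta> n < e' / 2" by (auto simp: eventually_sequentially)
    have "(LINT z|M. (norm (js a z - js b z))\<^sup>2) < e" if ab: "a \<ge> max N1 N2" "b \<ge> max N1 N2" for a b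
    proof -
      let ?f = "LINT z|M. (norm (fst (js a z) - fst (js b z)))\<^sup>2" and ?s = "LINT z|M. (norm (snd (js a z) - snd (js b z)))\<^sup>2"
      have f: "?f < e'" using N1 ab by simp
      have "c * ?s \<le> \<delta> a + \<delta> b + K * ?f" by (rule grad_Cauchy)
      also have "\<dots> \<le> e' + K * e'" using N2[of a] N2[of b] ab f K by (intro add_mono mult_left_mono) auto
      finally have "c * ?s \<le> e' + K * e'" .
      moreover have "c * ?f < c * e'" using f c by (intro mult_strict_left_mono) auto
      ultimately have "c * (?f + ?s) < D * e'" by (simp add: D_def algebra_simps)
      also have "\<dots> = c * (e / 2)" using den by (simp add: e'_def)
      finally have "?f + ?s < e / 2" using c by simp
      moreover have "(LINT z|M. (norm (js a z - js b z))\<^sup>2) = ?f + ?s"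
        unfolding norm2[of "js a _ - js b _"] fst_diff snd_diff using diffi by (rule Bochner_Integration.integral_add)
      ultimately show ?thesis using \<open>e > 0\<close> by simp
    qed
    then show ?thesis by blast
  qed
  obtain j r' where j: "square_integrable M j" and lim: "(\<lambda>n. LINT z|M. (norm (js n z - j z))\<^sup>2) \<longlonglongrightarrow> 0"
    and r': "strict_mono r'" and ae: "AE z in M. (\<lambda>n. js (r' n) z) \<longlonglongrightarrow> j z"
    using L2_Cauchy_limit[OF M jsq Cauchy] by blast
  have jm: "j \<in> borel_measurable M" using j by (simp add: square_integrable_def)
  have j4: "integrable M (\<lambda>z. (norm (fst (j z))) ^ 4)"
  proof (rule LINT_Fatou(1)[where h = "\<lambda>n z. (norm (fst (js (r' n) z))) ^ 4" and e = K1])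
    show "AE z in M. (\<lambda>n. (norm (fst (js (r' n) z))) ^ 4) \<longlonglongrightarrow> (norm (fst (j z))) ^ 4"
      using ae by eventually_elim (intro tendsto_intros)
    show "(\<lambda>z. (norm (fst (j z))) ^ 4) \<in> borel_measurable M"
      using measurable_compose[OF jm borel_measurable_continuous_onI[OF cont4(1)]] .
    show "\<forall>\<^sub>F n in sequentially. (LINT z|M. (norm (fst (js (r' n) z))) ^ 4) \<le> K1"
      using quart_bound by (simp add: js_def ks_def)
  qed (use i4(1)[OF jsb] in auto)
  have stationary: "(\<lambda>n. LINT z|M. dF (js n z) (k z)) \<longlonglongrightarrow> 0" if k: "k \<in> V" for k
  proof -
    obtain B where B: "\<And>z. norm (k z) \<le> B" using V_bounded[OF k] by (auto simp: bounded_measurable_def)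
    define R where "R = K * ((1 + B\<^sup>2)\<^sup>2 * (2 * \<mu> + K1))"
    have dFi: "integrable M (\<lambda>z. dF (js n z) (k z))" for n
      using int[OF bounded_measurable_Pair[OF jsb[of n] V_bounded[OF k]] continuous_deriv] by simp
    have step: "- (t * (LINT z|M. dF (js n z) (k z))) \<le> \<delta> n + t\<^sup>2 * R" if t: "\<bar>t\<bar> \<le> 1" for t n
    proof -
      have kV: "(\<lambda>z. ks n z + t *\<^sub>R k z) \<in> V" by (intro V_add V_scale ksV k)
      have "F (j0 z + (ks n z + t *\<^sub>R k z)) \<le> F (js n z) + t * dF (js n z) (k z)
        + t\<^sup>2 * (K * ((1 + B\<^sup>2)\<^sup>2 * (1 + (norm (fst (js n z)))\<^sup>2)))" for z
      proof -
        have "(norm (k z))\<^sup>2 \<le> B\<^sup>2" using B[of z] by (intro power_mono) auto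
        then have "(1 + (norm (k z))\<^sup>2)\<^sup>2 \<le> (1 + B\<^sup>2)\<^sup>2" by (intro power_mono) auto
        then have "t\<^sup>2 * (K * ((1 + (norm (k z))\<^sup>2)\<^sup>2 * (1 + (norm (fst (js n z)))\<^sup>2)))
          \<le> t\<^sup>2 * (K * ((1 + B\<^sup>2)\<^sup>2 * (1 + (norm (fst (js n z)))\<^sup>2)))"
          using K by (intro mult_left_mono mult_right_mono) auto
        moreover have eq: "j0 z + (ks n z + t *\<^sub>R k z) = js n z + t *\<^sub>R k z" by (simp add: js_def add.assoc)
        ultimately show ?thesis using taylor[OF t, of "js n z" "k z"] unfolding eq by linarith
      qed
      then have "E (\<lambda>z. ks n z + t *\<^sub>R k z) \<le> (LINT z|M. F (js n z) + t * dF (js n z) (k z)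
        + t\<^sup>2 * (K * ((1 + B\<^sup>2)\<^sup>2 * (1 + (norm (fst (js n z)))\<^sup>2))))"
        unfolding E_def using Fi[OF kV] dFi[of n] int[OF jsb[of n] continuous] i4(2)[OF jsb[of n]]
        by (intro integral_mono) auto
      also have "\<dots> = E (ks n) + t * (LINT z|M. dF (js n z) (k z))
        + t\<^sup>2 * (K * ((1 + B\<^sup>2)\<^sup>2 * (\<mu> + (LINT z|M. (norm (fst (js n z)))\<^sup>2))))"
        using dFi[of n] int[OF jsb[of n] continuous] i4(2)[OF jsb[of n]]
        by (simp add: E_def js_def \<mu>_def)
      also have "t\<^sup>2 * (K * ((1 + B\<^sup>2)\<^sup>2 * (\<mu> + (LINT z|M. (norm (fst (js n z)))\<^sup>2)))) \<le> t\<^sup>2 * R"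
        unfolding R_def using sq_bound[of "r n"] K by (intro mult_left_mono) (auto simp: js_def ks_def)
      finally show ?thesis using m_le[OF kV] ksE[of n] by simp
    qed
    have bound: "\<bar>LINT z|M. dF (js n z) (k z)\<bar> \<le> (1 + R) * sqrt (\<delta> n)" for n
    proof -
      \<comment> \<open>The steps \<open>\<plusminus> sqrt (\<delta> n)\<close> balance the error \<open>\<delta> n\<close> against the quadratic remainder.\<close>
      define s where "s = sqrt (\<delta> n)"
      have s: "0 < s" "s \<le> 1" "s\<^sup>2 = \<delta> n" using \<delta>[of n] by (simp_all add: s_def)
      have "s * (LINT z|M. dF (js n z) (k z)) \<le> s * ((1 + R) * s)" "s * - (LINT z|M. dF (js n z) (k z)) \<le> s * ((1 + R) * s)"
        using step[of "- s" n] step[of s n] s by (simp_all add: algebra_simps power2_eq_square)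
      then have "(LINT z|M. dF (js n z) (k z)) \<le> (1 + R) * s" "- (LINT z|M. dF (js n z) (k z)) \<le> (1 + R) * s"
        using s(1) by (simp_all only: mult_le_cancel_left_pos)
      then show ?thesis by (simp add: s_def[symmetric] abs_le_iff)
    qed
    have "(\<lambda>n. (1 + R) * sqrt (\<delta> n)) \<longlonglongrightarrow> (1 + R) * sqrt 0"
      by (intro tendsto_intros \<delta>0)
    then have z: "(\<lambda>n. (1 + R) * sqrt (\<delta> n)) \<longlonglongrightarrow> 0" by simp
    show ?thesis by (rule tendsto_rabs_zero_cancel, rule tendsto_sandwich[OF _ _ tendsto_const z]) (use bound in auto)
  qed
  have limit: "integrable M (\<lambda>z. dF (j z) (k z)) \<and> (\<lambda>n. LINT z|M. dF (js n z) (k z)) \<longlonglongrightarrow> (LINT z|M. dF (j z) (k z))"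
    if k: "bounded_measurable M k" for k
  proof -
    obtain B where B: "\<And>z. norm (k z) \<le> B" using k by (auto simp: bounded_measurable_def)
    have km: "k \<in> borel_measurable M" using k by (simp add: bounded_measurable_def)
    have B0: "0 \<le> B" using B order_trans[OF norm_ge_zero] by blast
    \<comment> \<open>The weight in \<open>lipschitz\<close> is bounded in \<open>L\<^sup>2\<close> because the values are bounded in \<open>L\<^sup>4\<close>.\<close>
    define W where "W n z = 2 + (norm (fst (js n z)))\<^sup>2 + (norm (fst (j z)))\<^sup>2" for n z
    have jsm: "js n \<in> borel_measurable M" for n using jsb[of n] by (simp add: bounded_measurable_def)
    have fstm: "(\<lambda>z. (norm (fst (f z)))\<^sup>2) \<in> borel_measurable M" if "f \<in> borel_measurable M" for f :: "'a \<Rightarrow> 'p \<times> 'g"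
      using measurable_compose[OF that borel_measurable_continuous_onI[OF cont4(2)]] .
    have W: "square_integrable M (W n)" "(LINT z|M. (W n z)\<^sup>2) \<le> 12 * \<mu> + 3 * K1 + 3 * (LINT z|M. (norm (fst (j z))) ^ 4)" for n
    proof -
      have Wm: "W n \<in> borel_measurable M" unfolding W_def[abs_def] by (intro borel_measurable_add borel_measurable_const fstm jsm jm)
      have bi: "integrable M (\<lambda>z. 12 + 3 * (norm (fst (js n z))) ^ 4 + 3 * (norm (fst (j z))) ^ 4)"
        using i4(1)[OF jsb[of n]] j4 by simp
      have Wi: "integrable M (\<lambda>z. (W n z)\<^sup>2)"
      proof (rule Bochner_Integration.integrable_bound[OF bi])
        show "(\<lambda>z. (W n z)\<^sup>2) \<in> borel_measurable M" using Wm by measurable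
        show "AE z in M. norm ((W n z)\<^sup>2) \<le> norm (12 + 3 * (norm (fst (js n z))) ^ 4 + 3 * (norm (fst (j z))) ^ 4)"
          using weight_bound by (intro AE_I2) (simp add: W_def)
      qed
      show "square_integrable M (W n)" using Wm Wi by (simp add: square_integrable_def)
      have "(LINT z|M. (W n z)\<^sup>2) \<le> (LINT z|M. 12 + 3 * (norm (fst (js n z))) ^ 4 + 3 * (norm (fst (j z))) ^ 4)"
        using Wi bi weight_bound by (intro integral_mono) (auto simp: W_def)
      also have "\<dots> = 12 * \<mu> + 3 * (LINT z|M. (norm (fst (js n z))) ^ 4) + 3 * (LINT z|M. (norm (fst (j z))) ^ 4)"
        using i4(1)[OF jsb[of n]] j4 by (simp add: \<mu>_def)
      also have "\<dots> \<le> 12 * \<mu> + 3 * K1 + 3 * (LINT z|M. (norm (fst (j z))) ^ 4)"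
        using quart_bound[of "r n"] by (simp add: js_def ks_def)
      finally show "(LINT z|M. (W n z)\<^sup>2) \<le> 12 * \<mu> + 3 * K1 + 3 * (LINT z|M. (norm (fst (j z))) ^ 4)" .
    qed
    have norm_sq: "square_integrable M (\<lambda>z. norm (f z))" if "square_integrable M f" for f :: "'a \<Rightarrow> 'p \<times> 'g"
      using that by (auto simp: square_integrable_def)
    have dFm: "(\<lambda>z. dF (f z) (k z)) \<in> borel_measurable M" if "f \<in> borel_measurable M" for f
      using measurable_compose[OF borel_measurable_Pair[OF that km] borel_measurable_continuous_onI[OF continuous_deriv]]
      by simp
    have ji: "integrable M (\<lambda>z. dF (j z) (k z))"
    proof (rule Bochner_Integration.integrable_bound)
      show "integrable M (\<lambda>z. K * B * (W 0 z * norm (j z)))"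
        using LINT_Cauchy_Schwarz(1)[OF W(1) norm_sq[OF j]] by simp
      show "AE z in M. norm (dF (j z) (k z)) \<le> norm (K * B * (W 0 z * norm (j z)))"
      proof (intro AE_I2)
        fix z
        have "\<bar>dF (j z) (k z)\<bar> \<le> K * norm (k z) * ((2 + (norm (fst (j z)))\<^sup>2) * norm (j z))" by (rule deriv_bound)
        also have "\<dots> \<le> K * B * (W 0 z * norm (j z))"
          using K B B0 by (intro mult_mono) (auto simp: W_def)
        finally show "norm (dF (j z) (k z)) \<le> norm (K * B * (W 0 z * norm (j z)))" by simp
      qed
    qed (rule dFm[OF jm])
    define S where "S = 12 * \<mu> + 3 * K1 + 3 * (LINT z|M. (norm (fst (j z))) ^ 4)"
    have est: "\<bar>(LINT z|M. dF (js n z) (k z)) - (LINT z|M. dF (j z) (k z))\<bar>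
      \<le> K * B * (sqrt S * sqrt (LINT z|M. (norm (js n z - j z))\<^sup>2))" for n
    proof -
      have jni: "integrable M (\<lambda>z. dF (js n z) (k z))"
        using int[OF bounded_measurable_Pair[OF jsb[of n] k] continuous_deriv] by simp
      have dq: "square_integrable M (\<lambda>z. norm (js n z - j z))" by (rule norm_sq[OF square_integrable_diff[OF jsq j]])
      note CS = LINT_Cauchy_Schwarz[OF W(1)[of n] dq]
      have "\<bar>(LINT z|M. dF (js n z) (k z)) - (LINT z|M. dF (j z) (k z))\<bar> = \<bar>LINT z|M. dF (js n z) (k z) - dF (j z) (k z)\<bar>"
        using jni ji by simp
      also have "\<dots> \<le> (LINT z|M. \<bar>dF (js n z) (k z) - dF (j z) (k z)\<bar>)"
        by (rule integral_abs_bound)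
      also have "\<dots> \<le> (LINT z|M. K * B * \<bar>W n z * norm (js n z - j z)\<bar>)"
      proof (rule integral_mono)
        fix z
        have "\<bar>dF (js n z) (k z) - dF (j z) (k z)\<bar> \<le> K * norm (k z) * (W n z * norm (js n z - j z))"
          unfolding W_def by (rule lipschitz)
        also have "\<dots> \<le> K * B * (W n z * norm (js n z - j z))"
          using K B B0 by (intro mult_mono) (auto simp: W_def)
        finally show "\<bar>dF (js n z) (k z) - dF (j z) (k z)\<bar> \<le> K * B * \<bar>W n z * norm (js n z - j z)\<bar>"
          by (simp add: abs_mult W_def)
      qed (use jni ji CS(1) in auto)
      also have "\<dots> \<le> K * B * (sqrt (LINT z|M. (W n z)\<^sup>2) * sqrt (LINT z|M. (norm (js n z - j z))\<^sup>2))"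
        using CS(2) K B0 by (simp add: mult_left_mono)
      also have "\<dots> \<le> K * B * (sqrt S * sqrt (LINT z|M. (norm (js n z - j z))\<^sup>2))"
        using W(2)[of n] K B0 by (intro mult_left_mono mult_right_mono) (auto simp: S_def)
      finally show ?thesis .
    qed
    have "(\<lambda>n. K * B * (sqrt S * sqrt (LINT z|M. (norm (js n z - j z))\<^sup>2))) \<longlonglongrightarrow> K * B * (sqrt S * sqrt 0)"
      by (intro tendsto_intros lim)
    then have z: "(\<lambda>n. K * B * (sqrt S * sqrt (LINT z|M. (norm (js n z - j z))\<^sup>2))) \<longlonglongrightarrow> 0" by simp
    have "(\<lambda>n. (LINT z|M. dF (js n z) (k z)) - (LINT z|M. dF (j z) (k z))) \<longlonglongrightarrow> 0"
      by (rule tendsto_rabs_zero_cancel, rule tendsto_sandwich[OF _ _ tendsto_const z]) (use est in auto)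
    then show ?thesis using ji by (simp add: LIM_zero_iff)
  qed
  show thesis
    using that[of ks j] ksV j lim stationary limit by (simp add: js_def)
qed

end

section \<open>The elastic and bulk energy densities\<close>

type_synonym jet = "(real ^ 3) \<times> (real ^ 3) \<times> (real ^ 3)"

text \<open>The symmetric bilinear form with \<open>f_el_bilin a a = 2 f_el a\<close>, that is, the derivative of \<open>f_el\<close> at \<open>a\<close> in direction \<open>b\<close>.\<close>

definition f_el_bilin :: "real \<Rightarrow> (real ^ 3) \<times> (real ^ 3) \<Rightarrow> (real ^ 3) \<times> (real ^ 3) \<Rightarrow> real"
  where "f_el_bilin L2 = (\<lambda>(ax, ay) (bx, by).
      2 * (1 + L2 / 2) * (ax $ 1 * bx $ 1 + ay $ 1 * by $ 1 + ax $ 2 * bx $ 2 + ay $ 2 * by $ 2)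
    + 2 * (3 + L2 / 2) * (ax $ 3 * bx $ 3 + ay $ 3 * by $ 3)
    + L2 * (ay $ 1 * by $ 3 + by $ 1 * ay $ 3 - ax $ 1 * bx $ 3 - bx $ 1 * ax $ 3
      - ay $ 2 * bx $ 3 - by $ 2 * ax $ 3 - ax $ 2 * by $ 3 - bx $ 2 * ay $ 3)
    + \<bar>L2\<bar> * (ay $ 2 * bx $ 1 + by $ 2 * ax $ 1 - ay $ 1 * bx $ 2 - by $ 1 * ax $ 2))"

definition f_b_deriv :: "real \<Rightarrow> real \<Rightarrow> real \<Rightarrow> real ^ 3 \<Rightarrow> real ^ 3 \<Rightarrow> real"
  where "f_b_deriv A B C q p =
      2 * A * (q $ 1 * p $ 1 + q $ 2 * p $ 2 + 3 * q $ 3 * p $ 3)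
    + 4 * C * ((q $ 1)\<^sup>2 + (q $ 2)\<^sup>2 + 3 * (q $ 3)\<^sup>2) * (q $ 1 * p $ 1 + q $ 2 * p $ 2 + 3 * q $ 3 * p $ 3)
    + 2 * B * (p $ 3 * ((q $ 1)\<^sup>2 + (q $ 2)\<^sup>2 - 3 * (q $ 3)\<^sup>2) + 2 * q $ 3 * (q $ 1 * p $ 1 + q $ 2 * p $ 2))"

definition energy_deriv :: "real \<Rightarrow> real \<Rightarrow> real \<Rightarrow> real \<Rightarrow> real \<Rightarrow> real \<Rightarrow> jet \<Rightarrow> jet \<Rightarrow> real"
  where "energy_deriv A B C L L2 lam w k =
    f_el_bilin L2 (snd w) (snd k) + lam\<^sup>2 / L * f_b_deriv A B C (fst w) (fst k)"

lemma has_derivative_vec_nth [derivative_intros]: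
  "(f has_derivative f') F \<Longrightarrow> ((\<lambda>x. f x $ i) has_derivative (\<lambda>x. f' x $ i)) F"
  by (rule bounded_linear.has_derivative[OF bounded_linear_vec_nth])

lemma energy_density_eq:
  "energy_density A B C L L2 lam w =
    f_el L2 (fst (snd w)) (snd (snd w)) + lam\<^sup>2 / L * f_b A B C (fst w)"
  by (cases w) (simp add: energy_density_def)

lemma energy_density_has_derivative:
  "(energy_density A B C L L2 lam has_derivative energy_deriv A B C L L2 lam w) (at w)"
proof -
  have "((\<lambda>w. f_el L2 (fst (snd w)) (snd (snd w)) + lam\<^sup>2 / L * f_b A B C (fst w))
    has_derivative energy_deriv A B C L L2 lam w) (at w)"
    unfolding f_el_def f_b_def
    by (rule derivative_eq_intros refl | simp)+
      (simp add: fun_eq_iff energy_deriv_def f_el_bilin_def f_b_deriv_def case_prod_beta;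
        simp add: algebra_simps power2_eq_square)
  then show ?thesis unfolding energy_density_eq[abs_def] .
qed

lemma norm_power2_vec3: "(norm (x :: real ^ 3))\<^sup>2 = (x $ 1)\<^sup>2 + (x $ 2)\<^sup>2 + (x $ 3)\<^sup>2"
  by (simp add: power2_norm_eq_inner inner_vec_def sum_3) (simp add: power2_eq_square)

lemma norm_power2_Pair: "(norm (a, b))\<^sup>2 = (norm a)\<^sup>2 + (norm b)\<^sup>2"
  by (simp add: norm_Pair)

text \<open>For \<open>L2 \<ge> 0\<close> the terms with the factor \<open>L2\<close> are half the squared divergence of the matrix with the entries
  \<open>q\<^sub>1 - q\<^sub>3\<close>, \<open>q\<^sub>2\<close>, \<open>q\<^sub>2\<close>, \<open>- q\<^sub>1 - q\<^sub>3\<close>. The factor of the Jacobian term is \<open>|L2|\<close>, which for \<open>L2 < 0\<close> makes the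
  remaining terms a sum of squares again, now with \<open>q\<^sub>3\<close> entering with the opposite sign, at the cost of a part
  of the Dirichlet integral.\<close>

lemma f_el_ge_gradient:
  assumes "L2 > -1"
  shows "f_el L2 ax ay \<ge> min 1 (1 + L2) * (norm (ax, ay))\<^sup>2"
proof (cases "L2 \<ge> 0")
  case True
  have "f_el L2 ax ay - 1 * (norm (ax, ay))\<^sup>2
    = 2 * ((ax $ 3)\<^sup>2 + (ay $ 3)\<^sup>2) + L2 / 2 * ((ax $ 1 - ax $ 3 + ay $ 2)\<^sup>2 + (ax $ 2 - ay $ 1 - ay $ 3)\<^sup>2)"
    using True unfolding f_el_def norm_power2_Pair norm_power2_vec3
    by (simp add: field_simps power2_eq_square)
  also have "\<dots> \<ge> 0" using True by simp
  finally show ?thesis using True by (simp add: min_def)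
next
  case False
  \<comment> \<open>The identity below needs the absolute value resolved.\<close>
  define l where "l = - L2"
  have l: "L2 = - l" "0 < l" "l < 1" "\<bar>L2\<bar> = l" using False assms by (auto simp: l_def)
  have "f_el L2 ax ay - (1 - l) * (norm (ax, ay))\<^sup>2
    = 2 * ((ax $ 3)\<^sup>2 + (ay $ 3)\<^sup>2)
      + l / 2 * ((ax $ 3 + ax $ 1 + ay $ 2)\<^sup>2 + (ay $ 3 + ax $ 2 - ay $ 1)\<^sup>2)"
    unfolding f_el_def norm_power2_Pair norm_power2_vec3 l(4) unfolding l(1)
    by (simp add: field_simps power2_eq_square)
  also have "\<dots> \<ge> 0" using l by simp
  finally show ?thesis using l by (simp add: min_def)
qed

lemma f_el_midpoint:
  "f_el L2 ax ay + f_el L2 bx by - 2 * f_el L2 ((1/2) *\<^sub>R (ax + bx)) ((1/2) *\<^sub>R (ay + by))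
    = f_el L2 (ax - bx) (ay - by) / 2"
  unfolding f_el_def by (simp add: field_simps power2_eq_square)

text \<open>The second difference of the quartic term contains \<open>4 C |m|\<^sup>2 |d|\<^sup>2\<close>, and that of the cubic term is at most a multiple
  of \<open>|m| |d|\<^sup>2\<close>. By the inequality of arithmetic and geometric means, the former absorbs the latter up to a
  multiple of \<open>|d|\<^sup>2\<close>.\<close>

lemma f_b_midpoint:
  assumes "B > 0" "C > 0"
  shows "f_b A B C (m + d) + f_b A B C (m - d) - 2 * f_b A B C m
    \<ge> - (6 * \<bar>A\<bar> + 18 * B\<^sup>2 / C) * (norm d)\<^sup>2"
proof -
  define b where "b = B / C"
  have B: "B = C * b" and b: "b > 0" using assms by (simp_all add: b_def)
  define M D where "M = (m $ 1)\<^sup>2 + (m $ 2)\<^sup>2 + 3 * (m $ 3)\<^sup>2" and "D = (d $ 1)\<^sup>2 + (d $ 2)\<^sup>2 + 3 * (d $ 3)\<^sup>2"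
  define \<beta> where "\<beta> = m $ 1 * d $ 1 + m $ 2 * d $ 2 + 3 * m $ 3 * d $ 3"
  define X where "X = (d $ 1)\<^sup>2 + (d $ 2)\<^sup>2 - 3 * (d $ 3)\<^sup>2"
  have D: "0 \<le> D" "D \<le> 3 * (norm d)\<^sup>2" by (simp_all add: D_def norm_power2_vec3)
  have expand: "f_b A B C (m + d) + f_b A B C (m - d) - 2 * f_b A B C m
    = 2 * A * D + C * (4 * M * D + 2 * D\<^sup>2 + 8 * \<beta>\<^sup>2
      + 4 * b * (m $ 3) * X + 8 * b * d $ 3 * (m $ 1 * d $ 1 + m $ 2 * d $ 2))"
    unfolding f_b_def M_def D_def \<beta>_def X_def B by (simp add: algebra_simps power2_eq_square)
  have "\<bar>4 * b * (m $ 3)\<bar> \<le> 2 * (m $ 3)\<^sup>2 + 2 * b\<^sup>2"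
    using sum_squares_bound[of b "\<bar>m $ 3\<bar>"] b by (simp add: abs_mult)
  moreover have "\<bar>X\<bar> \<le> D" unfolding X_def D_def by (simp add: abs_le_iff)
  ultimately have "\<bar>4 * b * (m $ 3)\<bar> * \<bar>X\<bar> \<le> (2 * (m $ 3)\<^sup>2 + 2 * b\<^sup>2) * D"
    by (intro mult_mono) auto
  then have 1: "4 * b * (m $ 3) * X \<ge> - ((2 * (m $ 3)\<^sup>2 + 2 * b\<^sup>2) * D)"
    by (simp add: abs_mult[symmetric] abs_le_iff)
  have 2: "8 * b * d $ 3 * (m $ 1 * d $ 1 + m $ 2 * d $ 2)
    \<ge> - 4 * ((m $ 1)\<^sup>2 + (m $ 2)\<^sup>2) * (d $ 3)\<^sup>2 - 4 * b\<^sup>2 * ((d $ 1)\<^sup>2 + (d $ 2)\<^sup>2)"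
  proof -
    have "0 \<le> 4 * (m $ 1 * d $ 3 + b * d $ 1)\<^sup>2 + 4 * (m $ 2 * d $ 3 + b * d $ 2)\<^sup>2" by simp
    then show ?thesis by (simp add: algebra_simps power2_eq_square)
  qed
  have 3: "4 * M * D - 2 * (m $ 3)\<^sup>2 * D - 4 * ((m $ 1)\<^sup>2 + (m $ 2)\<^sup>2) * (d $ 3)\<^sup>2 \<ge> 0"
  proof -
    have "4 * M * D - 2 * (m $ 3)\<^sup>2 * D - 4 * ((m $ 1)\<^sup>2 + (m $ 2)\<^sup>2) * (d $ 3)\<^sup>2
      = 10 * ((m $ 3)\<^sup>2 * D) + 4 * ((m $ 1)\<^sup>2 + (m $ 2)\<^sup>2) * ((d $ 1)\<^sup>2 + (d $ 2)\<^sup>2 + 2 * (d $ 3)\<^sup>2)"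
      unfolding M_def D_def by (simp add: algebra_simps)
    also have "\<dots> \<ge> 0" using D by simp
    finally show ?thesis .
  qed
  have 4: "4 * b\<^sup>2 * ((d $ 1)\<^sup>2 + (d $ 2)\<^sup>2) \<le> 4 * b\<^sup>2 * D"
    by (intro mult_left_mono) (simp_all add: D_def)
  have "- 6 * b\<^sup>2 * D \<le> 4 * M * D + 2 * D\<^sup>2 + 8 * \<beta>\<^sup>2
      + 4 * b * (m $ 3) * X + 8 * b * d $ 3 * (m $ 1 * d $ 1 + m $ 2 * d $ 2)"
    using 1 2 3 4 zero_le_power2[of D] zero_le_power2[of \<beta>] by (simp only: algebra_simps)
  then have "C * (- 6 * b\<^sup>2 * D) \<le> C * (4 * M * D + 2 * D\<^sup>2 + 8 * \<beta>\<^sup>2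
      + 4 * b * (m $ 3) * X + 8 * b * d $ 3 * (m $ 1 * d $ 1 + m $ 2 * d $ 2))"
    using assms by (intro mult_left_mono) auto
  moreover have "- (2 * \<bar>A\<bar> * D) \<le> 2 * A * D"
    using mult_right_mono[OF abs_ge_minus_self[of A] D(1)] by (simp add: algebra_simps)
  ultimately have "- (2 * \<bar>A\<bar> + 6 * C * b\<^sup>2) * D \<le> f_b A B C (m + d) + f_b A B C (m - d) - 2 * f_b A B C m"
    unfolding expand by (simp add: algebra_simps)
  moreover have "(2 * \<bar>A\<bar> + 6 * C * b\<^sup>2) * D \<le> (2 * \<bar>A\<bar> + 6 * C * b\<^sup>2) * (3 * (norm d)\<^sup>2)"
    using assms D by (intro mult_left_mono) auto
  moreover have e: "18 * B\<^sup>2 / C = 18 * C * b\<^sup>2" using assms by (simp add: b_def power2_eq_square)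
  ultimately show ?thesis unfolding e by (simp add: algebra_simps)
qed

text \<open>The same absorption: the quartic term dominates the cubic and the quadratic one up to a constant.\<close>

lemma f_b_coercive:
  assumes "B > 0" "C > 0"
  shows "\<exists>K. \<forall>q. f_b A B C q \<ge> C / 4 * (norm q) ^ 4 - K"
proof (intro exI allI)
  fix q :: "real ^ 3"
  define b a where "b = B / C" and "a = \<bar>A\<bar> / C"
  have B: "B = C * b" and b: "b > 0" and A: "\<bar>A\<bar> = C * a" using assms by (simp_all add: b_def a_def)
  define N where "N = (q $ 1)\<^sup>2 + (q $ 2)\<^sup>2 + 3 * (q $ 3)\<^sup>2"
  define X where "X = (q $ 1)\<^sup>2 + (q $ 2)\<^sup>2 - (q $ 3)\<^sup>2"
  define k where "k = a + 4 * b\<^sup>2"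
  have N: "0 \<le> N" "(norm q)\<^sup>2 \<le> N" "(q $ 3)\<^sup>2 \<le> N" by (simp_all add: N_def norm_power2_vec3)
  have "\<bar>2 * b * q $ 3\<bar> \<le> 1 / 4 * N + 4 * b\<^sup>2"
  proof -
    have "0 \<le> (\<bar>q $ 3\<bar> / 2 - 2 * b)\<^sup>2" by simp
    then have "\<bar>2 * b * q $ 3\<bar> \<le> 1 / 4 * (q $ 3)\<^sup>2 + 4 * b\<^sup>2"
      using b by (simp add: abs_mult power2_diff power_divide mult.commute)
    then show ?thesis using N(3) by simp
  qed
  moreover have "\<bar>X\<bar> \<le> N" unfolding X_def N_def by (simp add: abs_le_iff)
  ultimately have "\<bar>2 * b * q $ 3\<bar> * \<bar>X\<bar> \<le> (1 / 4 * N + 4 * b\<^sup>2) * N"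
    by (intro mult_mono) (auto simp: N)
  then have "2 * b * q $ 3 * X \<ge> - ((1 / 4 * N + 4 * b\<^sup>2) * N)"
    by (simp add: abs_mult[symmetric] abs_le_iff)
  moreover have "k * N \<le> 1 / 2 * N\<^sup>2 + k\<^sup>2 / 2"
    using sum_squares_bound[of k N] by simp
  ultimately have "1 / 4 * N\<^sup>2 - k\<^sup>2 / 2 \<le> N\<^sup>2 - a * N + 2 * b * q $ 3 * X"
    by (simp add: k_def algebra_simps power2_eq_square[of N])
  then have "C * (1 / 4 * N\<^sup>2 - k\<^sup>2 / 2) \<le> C * (N\<^sup>2 - a * N + 2 * b * q $ 3 * X)"
    using assms by (intro mult_left_mono) auto
  moreover have "C * (N\<^sup>2 - a * N + 2 * b * q $ 3 * X) \<le> f_b A B C q"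
    using mult_right_mono[OF abs_ge_minus_self[of A] N(1)]
    unfolding f_b_def N_def[symmetric] X_def[symmetric] A B by (simp add: algebra_simps)
  moreover have "(norm q) ^ 4 \<le> N\<^sup>2"
    using power_mono[OF N(2), of 2] by simp
  then have "C * (1 / 4 * (norm q) ^ 4) \<le> C * (1 / 4 * N\<^sup>2)" using assms by (intro mult_left_mono) auto
  ultimately show "C / 4 * (norm q) ^ 4 - C * ((\<bar>A\<bar> / C + 4 * (B / C)\<^sup>2)\<^sup>2 / 2) \<le> f_b A B C q"
    by (simp add: k_def a_def b_def algebra_simps)
qed

lemma abs_le_one_plus_square: "\<bar>x\<bar> \<le> (1 + x\<^sup>2) / 2" for x :: real
  using sum_squares_bound[of 1 "\<bar>x\<bar>"] by simp

lemma f_b_taylor: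
  assumes "A < 0" "B > 0" "C > 0" and t: "\<bar>t\<bar> \<le> 1"
  shows "f_b A B C (q + t *\<^sub>R p) \<le> f_b A B C q + t * f_b_deriv A B C q p
      + t\<^sup>2 * ((81 * C + 8 * B) * ((1 + (norm p)\<^sup>2)\<^sup>2 * (1 + (norm q)\<^sup>2)))"
proof -
  define P Q where "P = (norm p)\<^sup>2" and "Q = (norm q)\<^sup>2"
  define Np Nq where "Np = (p $ 1)\<^sup>2 + (p $ 2)\<^sup>2 + 3 * (p $ 3)\<^sup>2" and "Nq = (q $ 1)\<^sup>2 + (q $ 2)\<^sup>2 + 3 * (q $ 3)\<^sup>2"
  define \<beta> where "\<beta> = q $ 1 * p $ 1 + q $ 2 * p $ 2 + 3 * q $ 3 * p $ 3"
  define X where "X = q $ 3 * ((p $ 1)\<^sup>2 + (p $ 2)\<^sup>2 - 3 * (p $ 3)\<^sup>2) + 2 * p $ 3 * (q $ 1 * p $ 1 + q $ 2 * p $ 2)"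
  define Y where "Y = p $ 3 * ((p $ 1)\<^sup>2 + (p $ 2)\<^sup>2 - (p $ 3)\<^sup>2)"
  define W where "W = (1 + P)\<^sup>2 * (1 + Q)"
  have PQ: "0 \<le> P" "0 \<le> Q" by (simp_all add: P_def Q_def)
  have P3: "P = (p $ 1)\<^sup>2 + (p $ 2)\<^sup>2 + (p $ 3)\<^sup>2" and Q3: "Q = (q $ 1)\<^sup>2 + (q $ 2)\<^sup>2 + (q $ 3)\<^sup>2"
    by (simp_all add: P_def Q_def norm_power2_vec3)
  have N: "0 \<le> Np" "Np \<le> 3 * P" "0 \<le> Nq" "Nq \<le> 3 * Q" by (simp_all add: Np_def Nq_def P3 Q3)
  have expand: "f_b A B C (q + t *\<^sub>R p) = f_b A B C q + t * f_b_deriv A B C q p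
      + t\<^sup>2 * (A * Np + C * (4 * \<beta>\<^sup>2 + 2 * Nq * Np + 4 * t * \<beta> * Np + t\<^sup>2 * Np\<^sup>2) + 2 * B * (X + t * Y))"
    unfolding f_b_def f_b_deriv_def Np_def Nq_def \<beta>_def X_def Y_def
    by (simp add: algebra_simps power2_eq_square)
  have W: "W = 1 + 2 * P + P * P + Q + 2 * (P * Q) + P * P * Q"
    unfolding W_def by (simp add: algebra_simps power2_eq_square)
  have nn: "0 \<le> P * Q" "0 \<le> P * P" "0 \<le> P * P * Q" using PQ by auto
  have \<beta>2: "\<beta>\<^sup>2 \<le> Nq * Np"
  proof -
    have "Nq * Np - \<beta>\<^sup>2 = (q $ 1 * p $ 2 - q $ 2 * p $ 1)\<^sup>2 + 3 * (q $ 1 * p $ 3 - q $ 3 * p $ 1)\<^sup>2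
      + 3 * (q $ 2 * p $ 3 - q $ 3 * p $ 2)\<^sup>2"
      unfolding \<beta>_def Np_def Nq_def by (simp add: algebra_simps power2_eq_square)
    then show ?thesis by (smt (verit) zero_le_power2)
  qed
  have NN: "Nq * Np \<le> 9 * (P * Q)" using mult_mono[OF N(4,2)] N PQ by (simp add: ac_simps)
  have \<beta>1: "\<bar>\<beta>\<bar> \<le> 3 * (P + Q) / 2"
  proof -
    have "\<bar>\<beta>\<bar>\<^sup>2 \<le> ((Nq + Np) / 2)\<^sup>2"
      using \<beta>2 zero_le_power2[of "Nq - Np"] by (simp add: power2_eq_square field_simps)
    then have "\<bar>\<beta>\<bar> \<le> (Nq + Np) / 2" by (rule power2_le_imp_le) (use N in simp)
    then show ?thesis using N by simp
  qed
  have T1: "4 * t * \<beta> * Np \<le> 18 * ((P + Q) * P)"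
  proof -
    have "t * \<beta> \<le> \<bar>t\<bar> * \<bar>\<beta>\<bar>" by (simp add: abs_mult[symmetric])
    also have "\<dots> \<le> 1 * (3 * (P + Q) / 2)" using t \<beta>1 by (intro mult_mono) auto
    finally have "(t * \<beta>) * Np \<le> (3 * (P + Q) / 2) * (3 * P)" using N PQ by (intro mult_mono) auto
    then show ?thesis by (simp add: algebra_simps)
  qed
  have T2: "t\<^sup>2 * Np\<^sup>2 \<le> 9 * (P * P)"
  proof -
    have "t\<^sup>2 \<le> 1" using t by (simp add: abs_square_le_1)
    moreover have "Np\<^sup>2 \<le> (3 * P)\<^sup>2" using N by (intro power_mono) auto
    ultimately have "t\<^sup>2 * Np\<^sup>2 \<le> 1 * (3 * P)\<^sup>2" by (intro mult_mono) auto
    then show ?thesis by (simp add: power2_eq_square)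
  qed
  have Z: "x * y \<le> (1 + Q) / 2 * z" if "x\<^sup>2 \<le> Q" "\<bar>y\<bar> \<le> z" for x y z
  proof -
    have "x * y \<le> \<bar>x\<bar> * \<bar>y\<bar>" by (simp add: abs_mult[symmetric])
    also have "\<dots> \<le> (1 + Q) / 2 * z"
      using abs_le_one_plus_square[of x] that by (intro mult_mono) auto
    finally show ?thesis .
  qed
  have XX: "X \<le> 5 / 2 * ((1 + Q) * P)"
  proof -
    have "X = q $ 3 * ((p $ 1)\<^sup>2 + (p $ 2)\<^sup>2 - 3 * (p $ 3)\<^sup>2) + q $ 1 * (2 * p $ 3 * p $ 1) + q $ 2 * (2 * p $ 3 * p $ 2)"
      by (simp add: X_def algebra_simps)
    also have "\<dots> \<le> (1 + Q) / 2 * (3 * P) + (1 + Q) / 2 * P + (1 + Q) / 2 * P"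
    proof (intro add_mono Z)
      show "\<bar>(p $ 1)\<^sup>2 + (p $ 2)\<^sup>2 - 3 * (p $ 3)\<^sup>2\<bar> \<le> 3 * P"
        unfolding P3 by (simp add: abs_le_iff)
      have "\<bar>2 * x * y\<bar> \<le> x\<^sup>2 + y\<^sup>2" for x y :: real
        using sum_squares_bound[of "\<bar>x\<bar>" "\<bar>y\<bar>"] by (simp add: abs_mult)
      from this[of "p $ 3" "p $ 1"] this[of "p $ 3" "p $ 2"]
      show "\<bar>2 * p $ 3 * p $ 1\<bar> \<le> P" "\<bar>2 * p $ 3 * p $ 2\<bar> \<le> P"
        unfolding P3 by (smt (verit) zero_le_power2)+
    qed (simp_all add: Q3)
    finally show ?thesis by (simp add: field_simps)
  qed
  have YY: "t * Y \<le> 1 / 2 * ((1 + P) * P)"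
  proof -
    have "t * Y \<le> \<bar>t\<bar> * \<bar>Y\<bar>" by (simp add: abs_mult[symmetric])
    also have "\<dots> \<le> 1 * \<bar>Y\<bar>" using t by (intro mult_right_mono) auto
    also have "\<dots> = \<bar>p $ 3\<bar> * \<bar>(p $ 1)\<^sup>2 + (p $ 2)\<^sup>2 - (p $ 3)\<^sup>2\<bar>" by (simp add: Y_def abs_mult)
    also have "\<dots> \<le> (1 + P) / 2 * P"
    proof (rule mult_mono)
      show "\<bar>p $ 3\<bar> \<le> (1 + P) / 2" using abs_le_one_plus_square[of "p $ 3"] by (simp add: P3 add_increasing2 field_simps) (smt (verit) zero_le_power2)
      show "\<bar>(p $ 1)\<^sup>2 + (p $ 2)\<^sup>2 - (p $ 3)\<^sup>2\<bar> \<le> P" unfolding P3 by (simp add: abs_le_iff)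
    qed (use PQ in auto)
    finally show ?thesis by simp
  qed
  have "4 * \<beta>\<^sup>2 + 2 * Nq * Np + 4 * t * \<beta> * Np + t\<^sup>2 * Np\<^sup>2 \<le> 81 * W"
    using \<beta>2 NN T1 T2 nn PQ unfolding W by (simp only: algebra_simps)
  then have 1: "C * (4 * \<beta>\<^sup>2 + 2 * Nq * Np + 4 * t * \<beta> * Np + t\<^sup>2 * Np\<^sup>2) \<le> C * (81 * W)"
    using assms by (intro mult_left_mono) auto
  have "X + t * Y \<le> 4 * W"
    using XX YY nn PQ unfolding W by (simp only: algebra_simps)
  then have 2: "2 * B * (X + t * Y) \<le> 2 * B * (4 * W)"
    using assms by (intro mult_left_mono) auto
  have 3: "A * Np \<le> 0" using assms(1) N by (simp add: mult_nonpos_nonneg)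
  have "A * Np + C * (4 * \<beta>\<^sup>2 + 2 * Nq * Np + 4 * t * \<beta> * Np + t\<^sup>2 * Np\<^sup>2) + 2 * B * (X + t * Y)
    \<le> (81 * C + 8 * B) * W"
    using 1 2 3 by (simp add: algebra_simps)
  then show ?thesis unfolding expand W_def P_def Q_def
    by (intro add_left_mono mult_left_mono) auto
qed

lemma f_b_deriv_lipschitz:
  assumes "A < 0" "B > 0" "C > 0"
  shows "\<bar>f_b_deriv A B C q p - f_b_deriv A B C q' p\<bar>
    \<le> (10 * \<bar>A\<bar> + 150 * C + 18 * B) * norm p * ((1 + (norm q)\<^sup>2 + (norm q')\<^sup>2) * norm (q - q'))"
proof -
  define d where "d = q - q'"
  have q: "q $ i = q' $ i + d $ i" for i by (simp add: d_def)
  define a b \<delta> \<pi> where "a = norm q" and "b = norm q'" and "\<delta> = norm d" and "\<pi> = norm p"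
  have nn: "0 \<le> a" "0 \<le> b" "0 \<le> \<delta>" "0 \<le> \<pi>" by (simp_all add: a_def b_def \<delta>_def \<pi>_def)
  have c: "\<bar>q $ i\<bar> \<le> a" "\<bar>q' $ i\<bar> \<le> b" "\<bar>d $ i\<bar> \<le> \<delta>" "\<bar>p $ i\<bar> \<le> \<pi>" for i
    by (simp_all add: a_def b_def \<delta>_def \<pi>_def component_le_norm_cart)
  have c2: "\<bar>x * y\<bar> \<le> x' * y'" if "\<bar>x\<bar> \<le> x'" "\<bar>y\<bar> \<le> y'" for x y x' y' :: real
    unfolding abs_mult using that by (intro mult_mono) auto
  define bq where "bq x y = x $ 1 * y $ 1 + x $ 2 * y $ 2 + 3 * x $ 3 * y $ 3" for x y :: "real ^ 3"
  have bq: "\<bar>bq x y\<bar> \<le> 5 * (r * s)" if "\<And>i. \<bar>x $ i\<bar> \<le> r" "\<And>i. \<bar>y $ i\<bar> \<le> s" for x y r s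
    using c2[OF that(1)[of 1] that(2)[of 1]] c2[OF that(1)[of 2] that(2)[of 2]] c2[OF that(1)[of 3] that(2)[of 3]]
    unfolding bq_def by (simp add: abs_le_iff)
  define U W where "U = \<delta> * \<pi>" and "W = 1 + a\<^sup>2 + b\<^sup>2"
  have U: "0 \<le> U" using nn by (simp add: U_def)
  define T where "T = p $ 3 * (d $ 1 * (q $ 1 + q' $ 1) + d $ 2 * (q $ 2 + q' $ 2) - 3 * (d $ 3 * (q $ 3 + q' $ 3)))
    + 2 * (d $ 3 * (q $ 1 * p $ 1 + q $ 2 * p $ 2) + q' $ 3 * (d $ 1 * p $ 1 + d $ 2 * p $ 2))"
  have eq: "f_b_deriv A B C q p - f_b_deriv A B C q' p
    = 2 * A * bq d p + 4 * C * (bq q q * bq d p + bq d (q + q') * bq q' p) + 2 * B * T"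
    unfolding f_b_deriv_def bq_def T_def vector_add_component q by (simp add: algebra_simps power2_eq_square)
  have s: "\<bar>(q + q') $ i\<bar> \<le> a + b" "\<bar>q $ i + q' $ i\<bar> \<le> a + b" for i
    using c(1,2)[of i] by (auto intro: order_trans[OF abs_triangle_ineq] add_mono)
  have W: "a + b \<le> W" "a\<^sup>2 + (a + b) * b \<le> 3 / 2 * W" "1 \<le> W"
    using sum_squares_bound[of a 1] sum_squares_bound[of b 1] sum_squares_bound[of a b]
      zero_le_power2[of a] zero_le_power2[of b]
    unfolding W_def by (simp_all only: algebra_simps power2_eq_square)
  have dp: "\<bar>bq d p\<bar> \<le> 5 * U" unfolding U_def by (rule bq) (rule c)+
  have "\<bar>2 * A * bq d p\<bar> \<le> 10 * \<bar>A\<bar> * U"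
    using mult_left_mono[OF dp, of "2 * \<bar>A\<bar>"] by (simp add: abs_mult)
  also have "\<dots> \<le> 10 * \<bar>A\<bar> * (U * W)"
    using mult_left_mono[OF W(3) U] by (intro mult_left_mono) auto
  finally have 1: "\<bar>2 * A * bq d p\<bar> \<le> 10 * \<bar>A\<bar> * (U * W)" .
  have "\<bar>bq q q * bq d p\<bar> \<le> (5 * (a * a)) * (5 * U)"
    by (rule c2[OF bq dp]) (rule c)+
  moreover have "\<bar>bq d (q + q') * bq q' p\<bar> \<le> (5 * (\<delta> * (a + b))) * (5 * (b * \<pi>))"
    by (rule c2[OF bq bq]) (rule c s)+
  ultimately have "\<bar>bq q q * bq d p + bq d (q + q') * bq q' p\<bar> \<le> 25 * (U * (a\<^sup>2 + (a + b) * b))"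
    unfolding U_def by (simp add: algebra_simps power2_eq_square)
  also have "\<dots> \<le> 25 * (U * (3 / 2 * W))"
    using U W(2) by (intro mult_left_mono) auto
  finally have "4 * C * \<bar>bq q q * bq d p + bq d (q + q') * bq q' p\<bar> \<le> 4 * C * (25 * (U * (3 / 2 * W)))"
    using assms by (intro mult_left_mono) auto
  then have 2: "\<bar>4 * C * (bq q q * bq d p + bq d (q + q') * bq q' p)\<bar> \<le> 150 * C * (U * W)"
    using assms by (simp add: abs_mult)
  have "\<bar>d $ 1 * (q $ 1 + q' $ 1) + d $ 2 * (q $ 2 + q' $ 2) - 3 * (d $ 3 * (q $ 3 + q' $ 3))\<bar> \<le> 5 * (\<delta> * (a + b))"
    using c2[OF c(3) s(2), of 1 1] c2[OF c(3) s(2), of 2 2] c2[OF c(3) s(2), of 3 3]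
    by (simp add: abs_le_iff)
  note t1 = c2[OF c(4)[of 3] this]
  have "\<bar>q $ 1 * p $ 1 + q $ 2 * p $ 2\<bar> \<le> 2 * (a * \<pi>)" "\<bar>d $ 1 * p $ 1 + d $ 2 * p $ 2\<bar> \<le> 2 * (\<delta> * \<pi>)"
    using c2[OF c(1,4)[of 1]] c2[OF c(1,4)[of 2]] c2[OF c(3,4)[of 1]] c2[OF c(3,4)[of 2]]
    by (simp_all add: abs_le_iff)
  note t2 = c2[OF c(3)[of 3] this(1)] and t3 = c2[OF c(2)[of 3] this(2)]
  have "\<bar>T\<bar> \<le> 9 * (U * (a + b))"
    using t1 t2 t3 unfolding T_def U_def abs_le_iff by (simp add: algebra_simps)
  also have "\<dots> \<le> 9 * (U * W)" using U W(1) by (intro mult_left_mono) auto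
  finally have 3: "\<bar>2 * B * T\<bar> \<le> 18 * B * (U * W)" using assms by (simp add: abs_mult)
  have "\<bar>f_b_deriv A B C q p - f_b_deriv A B C q' p\<bar> \<le> (10 * \<bar>A\<bar> + 150 * C + 18 * B) * (U * W)"
    using 1 2 3 unfolding eq by (simp add: algebra_simps)
  then show ?thesis
    by (simp add: U_def W_def a_def b_def d_def \<delta>_def \<pi>_def algebra_simps)
qed

lemma f_el_bilin_bound: "\<bar>f_el_bilin L2 a b\<bar> \<le> (20 + 20 * \<bar>L2\<bar>) * (norm a * norm b)"
proof -
  obtain ax ay bx by' where ab: "a = (ax, ay)" "b = (bx, by')" by (cases a; cases b) auto
  define M where "M = norm a * norm b"
  have n: "\<bar>ax $ i\<bar> \<le> norm a" "\<bar>ay $ i\<bar> \<le> norm a" "\<bar>bx $ i\<bar> \<le> norm b" "\<bar>by' $ i\<bar> \<le> norm b" for i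
    using component_le_norm_cart norm_fst_le[of ax ay] norm_snd_le[of ay ax] norm_fst_le[of bx by'] norm_snd_le[of by' bx]
    unfolding ab by (meson order_trans)+
  have p: "\<bar>x * y\<bar> \<le> M" if "\<bar>x\<bar> \<le> norm a" "\<bar>y\<bar> \<le> norm b" for x y
    unfolding abs_mult M_def using that by (intro mult_mono) auto
  have c: "\<bar>c * x\<bar> \<le> \<bar>c\<bar> * y" if "\<bar>x\<bar> \<le> y" for c x y :: real
    unfolding abs_mult using that by (intro mult_left_mono) auto
  define S1 where "S1 = ax $ 1 * bx $ 1 + ay $ 1 * by' $ 1 + ax $ 2 * bx $ 2 + ay $ 2 * by' $ 2"
  define S2 where "S2 = ax $ 3 * bx $ 3 + ay $ 3 * by' $ 3"
  define S3 where "S3 = ay $ 1 * by' $ 3 + by' $ 1 * ay $ 3 - ax $ 1 * bx $ 3 - bx $ 1 * ax $ 3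
      - ay $ 2 * bx $ 3 - by' $ 2 * ax $ 3 - ax $ 2 * by' $ 3 - bx $ 2 * ay $ 3"
  define S4 where "S4 = ay $ 2 * bx $ 1 + by' $ 2 * ax $ 1 - ay $ 1 * bx $ 2 - by' $ 1 * ax $ 2"
  have S: "\<bar>S1\<bar> \<le> 4 * M" "\<bar>S2\<bar> \<le> 2 * M" "\<bar>S4\<bar> \<le> 4 * M"
    using p[OF n(1,3)[of 1]] p[OF n(2,4)[of 1]] p[OF n(1,3)[of 2]] p[OF n(2,4)[of 2]] p[OF n(1,3)[of 3]] p[OF n(2,4)[of 3]]
      p[OF n(2)[of 2] n(3)[of 1]] p[OF n(1)[of 1] n(4)[of 2]] p[OF n(2)[of 1] n(3)[of 2]] p[OF n(1)[of 2] n(4)[of 1]]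
    unfolding S1_def S2_def S4_def abs_le_iff by (simp_all add: mult.commute)
  have S3: "\<bar>S3\<bar> \<le> 8 * M"
    using p[OF n(2)[of 1] n(4)[of 3]] p[OF n(2)[of 3] n(4)[of 1]] p[OF n(1)[of 1] n(3)[of 3]] p[OF n(1)[of 3] n(3)[of 1]]
      p[OF n(2)[of 2] n(3)[of 3]] p[OF n(1)[of 3] n(4)[of 2]] p[OF n(1)[of 2] n(4)[of 3]] p[OF n(2)[of 3] n(3)[of 2]]
    unfolding S3_def abs_le_iff by (simp add: mult.commute)
  have eq: "f_el_bilin L2 a b = 2 * S1 + L2 * S1 + 6 * S2 + L2 * S2 + L2 * S3 + \<bar>L2\<bar> * S4"
    unfolding ab f_el_bilin_def S1_def S2_def S3_def S4_def by (simp add: algebra_simps)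
  show ?thesis
    using S S3 c[OF S(1), of L2] c[OF S(2), of L2] c[OF S3, of L2] c[OF S(3), of "\<bar>L2\<bar>"]
    unfolding eq M_def[symmetric] abs_le_iff by (simp only: algebra_simps) linarith
qed

lemma f_el_taylor:
  "f_el L2 (ax + t *\<^sub>R bx) (ay + t *\<^sub>R by)
    = f_el L2 ax ay + t * f_el_bilin L2 (ax, ay) (bx, by) + t\<^sup>2 * f_el L2 bx by"
  unfolding f_el_def f_el_bilin_def by (simp add: algebra_simps power2_eq_square)

text \<open>The lower constant has to serve both densities, hence the minimum; the upper one is the sum of all constants that
  occur.\<close>

lemma quartic_energy_energy_density:
  assumes "A < 0" "B > 0" "C > 0" "L > 0" "L2 > -1" "lam > 0"
  obtains c K where "quartic_energy (energy_density A B C L L2 lam) (energy_deriv A B C L L2 lam) c K"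
proof -
  define \<mu> where "\<mu> = lam\<^sup>2 / L"
  define c0 where "c0 = min 1 (1 + L2)"
  obtain K1 where K1: "\<And>q. f_b A B C q \<ge> C / 4 * (norm q) ^ 4 - K1"
    using f_b_coercive[OF assms(2,3)] by blast
  define K2 K3 K4 K5 where "K2 = 6 * \<bar>A\<bar> + 18 * B\<^sup>2 / C" and "K3 = 81 * C + 8 * B"
    and "K4 = 10 * \<bar>A\<bar> + 150 * C + 18 * B" and "K5 = 20 + 20 * \<bar>L2\<bar>"
  define c where "c = min (c0 / 2) (\<mu> * C / 4)"
  define K where "K = \<mu> * \<bar>K1\<bar> + \<mu> * K2 + \<mu> * K3 + \<mu> * K4 + K5"
  have pos: "\<mu> > 0" "c0 > 0" "0 \<le> K2" "0 \<le> K3" "0 \<le> K4" "0 \<le> K5"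
  proof -
    show "0 \<le> K2" unfolding K2_def using assms by (intro add_nonneg_nonneg) simp_all
  qed (use assms in \<open>simp_all add: \<mu>_def c0_def K3_def K4_def K5_def\<close>)
  have c: "c > 0" "c \<le> c0 / 2" "c \<le> c0" "c \<le> \<mu> * C / 4"
  proof -
    show "c \<le> c0 / 2" "c \<le> \<mu> * C / 4" by (simp_all add: c_def)
    then show "c \<le> c0" using pos by simp
    show "c > 0" using pos assms(3) by (simp add: c_def)
  qed
  have \<mu>K: "0 \<le> \<mu> * \<bar>K1\<bar>" "0 \<le> \<mu> * K2" "0 \<le> \<mu> * K3" "0 \<le> \<mu> * K4" using pos by auto
  have K: "0 \<le> K" "\<mu> * K1 \<le> K" "\<mu> * K2 \<le> K" "\<mu> * K3 + K5 \<le> K" "\<mu> * K4 + K5 \<le> K"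
  proof -
    have "\<mu> * K1 \<le> \<mu> * \<bar>K1\<bar>" using pos by (intro mult_left_mono) auto
    then show "0 \<le> K" "\<mu> * K1 \<le> K" "\<mu> * K2 \<le> K" "\<mu> * K3 + K5 \<le> K" "\<mu> * K4 + K5 \<le> K"
      using \<mu>K pos unfolding K_def by linarith+
  qed
  let ?F = "energy_density A B C L L2 lam" and ?dF = "energy_deriv A B C L L2 lam"
  have F: "?F w = f_el L2 (fst (snd w)) (snd (snd w)) + \<mu> * f_b A B C (fst w)" for w
    by (simp add: energy_density_eq \<mu>_def)
  have dF: "?dF w k = f_el_bilin L2 (snd w) (snd k) + \<mu> * f_b_deriv A B C (fst w) (fst k)" for w k
    by (simp add: energy_deriv_def \<mu>_def)
  have fst_le: "norm (fst w) \<le> norm w" and snd_le: "norm (snd w) \<le> norm w" for w :: jet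
    by (metis norm_fst_le prod.collapse) (metis norm_snd_le prod.collapse)
  have fel: "f_el L2 (fst G) (snd G) \<ge> c0 * (norm G)\<^sup>2" for G
    using f_el_ge_gradient[OF assms(5), of "fst G" "snd G"] by (simp add: c0_def)
  have "quartic_energy ?F ?dF c K"
  proof
    show "c > 0" by (fact c(1))
    show "K \<ge> 0" by (fact K(1))
    show "continuous_on UNIV ?F"
      unfolding energy_density_eq[abs_def] f_el_def f_b_def by (intro continuous_intros)
    show "continuous_on UNIV (\<lambda>(w, k). ?dF w k)"
      unfolding energy_deriv_def f_el_bilin_def f_b_deriv_def case_prod_beta by (intro continuous_intros)
    show "?dF 0 k = 0" for k
      by (simp add: energy_deriv_def f_el_bilin_def f_b_deriv_def case_prod_beta)
    show "c * ((norm (snd w))\<^sup>2 + norm (fst w) ^ 4) - K \<le> ?F w" for w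
    proof -
      have "c * (norm (snd w))\<^sup>2 \<le> c0 * (norm (snd w))\<^sup>2" using c by (intro mult_right_mono) auto
      moreover have "c * norm (fst w) ^ 4 \<le> \<mu> * C / 4 * norm (fst w) ^ 4" using c by (intro mult_right_mono) auto
      moreover have "\<mu> * (C / 4 * (norm (fst w)) ^ 4 - K1) \<le> \<mu> * f_b A B C (fst w)"
        using K1 pos by (intro mult_left_mono) auto
      ultimately show ?thesis using fel[of "snd w"] K(2) unfolding F by (simp add: algebra_simps)
    qed
    show "c * (norm (snd w - snd w'))\<^sup>2 - K * (norm (fst w - fst w'))\<^sup>2
      \<le> ?F w + ?F w' - 2 * ?F ((1 / 2) *\<^sub>R (w + w'))" for w w'
    proof -
      define m d where "m = (1 / 2) *\<^sub>R (fst w + fst w')" and "d = (1 / 2) *\<^sub>R (fst w - fst w')"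
      have md: "m + d = fst w" "m - d = fst w'"
        by (simp_all add: m_def d_def vec_eq_iff algebra_simps)
      have "\<mu> * (- K2 * (norm d)\<^sup>2) \<le> \<mu> * (f_b A B C (fst w) + f_b A B C (fst w') - 2 * f_b A B C m)"
        using f_b_midpoint[OF assms(2,3), where A = A and m = m and d = d] pos unfolding md K2_def by (intro mult_left_mono) auto
      moreover have "(norm d)\<^sup>2 = (norm (fst w - fst w'))\<^sup>2 / 4"
        unfolding d_def by (simp add: power2_eq_square)
      moreover have "\<mu> * K2 * (norm (fst w - fst w'))\<^sup>2 \<le> K * (norm (fst w - fst w'))\<^sup>2"
        using K by (intro mult_right_mono) auto
      moreover have "0 \<le> \<mu> * K2 * (norm (fst w - fst w'))\<^sup>2" using \<mu>K by simp
      moreover have "c * (norm (snd w - snd w'))\<^sup>2 \<le> c0 / 2 * (norm (snd w - snd w'))\<^sup>2"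
        using c by (intro mult_right_mono) auto
      moreover have "f_el L2 (fst (snd w)) (snd (snd w)) + f_el L2 (fst (snd w')) (snd (snd w'))
          - 2 * f_el L2 ((1 / 2) *\<^sub>R (fst (snd w) + fst (snd w'))) ((1 / 2) *\<^sub>R (snd (snd w) + snd (snd w')))
        \<ge> c0 / 2 * (norm (snd w - snd w'))\<^sup>2"
        unfolding f_el_midpoint using fel[of "snd w - snd w'"] by simp
      ultimately show ?thesis
        unfolding F by (simp add: m_def[symmetric]) (simp add: m_def algebra_simps)
    qed
    show "?F (w + t *\<^sub>R k) \<le> ?F w + t * ?dF w k
        + t\<^sup>2 * (K * ((1 + (norm k)\<^sup>2)\<^sup>2 * (1 + (norm (fst w))\<^sup>2)))" if t: "\<bar>t\<bar> \<le> 1" for t w k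
    proof -
      let ?W = "(1 + (norm k)\<^sup>2)\<^sup>2 * (1 + (norm (fst w))\<^sup>2)"
      have 1: "1 \<le> 1 + (norm (fst w))\<^sup>2" by simp
      have nk: "(norm k)\<^sup>2 \<le> (1 + (norm k)\<^sup>2)\<^sup>2"
      proof -
        have "(1 + (norm k)\<^sup>2) * 1 \<le> (1 + (norm k)\<^sup>2) * (1 + (norm k)\<^sup>2)" by (intro mult_left_mono) auto
        then show ?thesis by (simp add: power2_eq_square[of "1 + (norm k)\<^sup>2"])
      qed
      have "f_el L2 (fst (snd k)) (snd (snd k)) = f_el_bilin L2 (snd k) (snd k) / 2"
        by (simp add: f_el_def f_el_bilin_def case_prod_beta field_simps power2_eq_square)
      also have "\<dots> \<le> K5 * (norm (snd k) * norm (snd k)) / 2"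
        using f_el_bilin_bound[of L2 "snd k" "snd k"] by (simp add: K5_def)
      also have "\<dots> \<le> K5 * ((norm k)\<^sup>2 * 1)"
      proof -
        have "norm (snd k) * norm (snd k) \<le> norm k * norm k" by (intro mult_mono snd_le) auto
        then have "K5 * (norm (snd k) * norm (snd k)) \<le> K5 * (norm k * norm k)" using pos by (intro mult_left_mono) auto
        moreover have "0 \<le> K5 * (norm (snd k) * norm (snd k))" using pos by simp
        ultimately show ?thesis by (simp add: power2_eq_square)
      qed
      also have "\<dots> \<le> K5 * ?W" using pos nk 1 by (intro mult_left_mono mult_mono) auto
      finally have el: "f_el L2 (fst (snd k)) (snd (snd k)) \<le> K5 * ?W" .
      have "(norm (fst k))\<^sup>2 \<le> (norm k)\<^sup>2" using fst_le by (intro power_mono) auto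
      then have "(1 + (norm (fst k))\<^sup>2)\<^sup>2 * (1 + (norm (fst w))\<^sup>2) \<le> ?W"
        by (intro mult_right_mono power_mono) auto
      then have "\<mu> * K3 * ((1 + (norm (fst k))\<^sup>2)\<^sup>2 * (1 + (norm (fst w))\<^sup>2)) \<le> \<mu> * K3 * ?W"
        using pos by (intro mult_left_mono) auto
      with el have "f_el L2 (fst (snd k)) (snd (snd k)) + \<mu> * K3 * ((1 + (norm (fst k))\<^sup>2)\<^sup>2 * (1 + (norm (fst w))\<^sup>2))
        \<le> (\<mu> * K3 + K5) * ?W" by (simp add: algebra_simps)
      also have "\<dots> \<le> K * ?W" using K by (intro mult_right_mono) auto
      finally have quad: "t\<^sup>2 * (f_el L2 (fst (snd k)) (snd (snd k)) + \<mu> * K3 * ((1 + (norm (fst k))\<^sup>2)\<^sup>2 * (1 + (norm (fst w))\<^sup>2)))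
        \<le> t\<^sup>2 * (K * ?W)" by (intro mult_left_mono) auto
      have "\<mu> * f_b A B C (fst w + t *\<^sub>R fst k) \<le> \<mu> * (f_b A B C (fst w) + t * f_b_deriv A B C (fst w) (fst k)
        + t\<^sup>2 * (K3 * ((1 + (norm (fst k))\<^sup>2)\<^sup>2 * (1 + (norm (fst w))\<^sup>2))))"
        using f_b_taylor[OF assms(1-3) t] pos unfolding K3_def by (intro mult_left_mono) auto
      moreover have "f_el L2 (fst (snd w) + t *\<^sub>R fst (snd k)) (snd (snd w) + t *\<^sub>R snd (snd k))
        = f_el L2 (fst (snd w)) (snd (snd w)) + t * f_el_bilin L2 (snd w) (snd k) + t\<^sup>2 * f_el L2 (fst (snd k)) (snd (snd k))"
        using f_el_taylor[of L2 "fst (snd w)" t "fst (snd k)" "snd (snd w)" "snd (snd k)"] by simp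
      ultimately show ?thesis using quad unfolding F dF by (simp add: distrib_left mult.assoc mult.left_commute[of \<mu>])
    qed
    show "\<bar>?dF w k - ?dF w' k\<bar>
      \<le> K * norm k * ((2 + (norm (fst w))\<^sup>2 + (norm (fst w'))\<^sup>2) * norm (w - w'))" for w w' k
    proof -
      let ?W = "norm k * ((2 + (norm (fst w))\<^sup>2 + (norm (fst w'))\<^sup>2) * norm (w - w'))"
      have "f_el_bilin L2 (snd w) (snd k) - f_el_bilin L2 (snd w') (snd k) = f_el_bilin L2 (snd (w - w')) (snd k)"
        by (simp add: f_el_bilin_def case_prod_beta algebra_simps)
      then have "\<bar>f_el_bilin L2 (snd w) (snd k) - f_el_bilin L2 (snd w') (snd k)\<bar> \<le> K5 * (norm (snd (w - w')) * norm (snd k))"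
        using f_el_bilin_bound[of L2 "snd (w - w')" "snd k"] by (simp add: K5_def)
      also have "\<dots> \<le> K5 * ?W"
      proof -
        have "norm (snd (w - w')) * norm (snd k) \<le> (1 * norm (w - w')) * norm k"
          using snd_le[of "w - w'"] snd_le[of k] by (intro mult_mono) auto
        also have "\<dots> \<le> ((2 + (norm (fst w))\<^sup>2 + (norm (fst w'))\<^sup>2) * norm (w - w')) * norm k"
          by (intro mult_right_mono) (auto intro: add_nonneg_nonneg add_increasing2)
        finally show ?thesis using pos by (intro mult_left_mono) (simp_all add: mult.commute)
      qed
      finally have 1: "\<bar>f_el_bilin L2 (snd w) (snd k) - f_el_bilin L2 (snd w') (snd k)\<bar> \<le> K5 * ?W" .
      have "\<bar>f_b_deriv A B C (fst w) (fst k) - f_b_deriv A B C (fst w') (fst k)\<bar>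
        \<le> K4 * norm (fst k) * ((1 + (norm (fst w))\<^sup>2 + (norm (fst w'))\<^sup>2) * norm (fst (w - w')))"
        using f_b_deriv_lipschitz[OF assms(1-3)] by (simp add: K4_def)
      also have "\<dots> \<le> K4 * norm k * ((2 + (norm (fst w))\<^sup>2 + (norm (fst w'))\<^sup>2) * norm (w - w'))"
        using pos fst_le[of k] fst_le[of "w - w'"] by (intro mult_mono mult_nonneg_nonneg) auto
      finally have "\<mu> * \<bar>f_b_deriv A B C (fst w) (fst k) - f_b_deriv A B C (fst w') (fst k)\<bar> \<le> \<mu> * (K4 * ?W)"
        using pos by (intro mult_left_mono) (auto simp: mult.assoc)
      then have 2: "\<bar>\<mu> * f_b_deriv A B C (fst w) (fst k) - \<mu> * f_b_deriv A B C (fst w') (fst k)\<bar> \<le> \<mu> * (K4 * ?W)"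
        using pos by (simp add: abs_mult right_diff_distrib[symmetric])
      have "\<bar>?dF w k - ?dF w' k\<bar> \<le> (\<mu> * K4 + K5) * ?W"
        using 1 2 unfolding dF by (simp add: algebra_simps)
      also have "\<dots> \<le> K * ?W" using K by (intro mult_right_mono mult_nonneg_nonneg) auto
      finally show ?thesis by (simp add: mult.assoc)
    qed
  qed
  with that show thesis .
qed

section \<open>A piecewise linear extension of the boundary data\<close>

definition ramp :: "real \<Rightarrow> real \<Rightarrow> real"
  where "ramp \<epsilon> r = max (- 1) (min 1 (r / \<epsilon>))"

lemma ramp_has_derivative:
  assumes "\<epsilon> > 0" "\<bar>r\<bar> \<noteq> \<epsilon>"
  shows "(ramp \<epsilon> has_real_derivative (if \<bar>r\<bar> < \<epsilon> then 1 / \<epsilon> else 0)) (at r)"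
proof -
  consider "\<bar>r\<bar> < \<epsilon>" | "r > \<epsilon>" | "r < - \<epsilon>" using assms by linarith
  then show ?thesis
  proof cases
    case 1
    have "((\<lambda>r. r / \<epsilon>) has_real_derivative 1 / \<epsilon>) (at r)"
      using assms by (auto intro!: derivative_eq_intros)
    then have "(ramp \<epsilon> has_real_derivative 1 / \<epsilon>) (at r)"
    proof (rule has_field_derivative_transform_within_open[where S = "{-\<epsilon><..<\<epsilon>}"])
      fix x assume "x \<in> {-\<epsilon><..<\<epsilon>}"
      then have "- 1 \<le> x / \<epsilon>" "x / \<epsilon> \<le> 1" using assms(1) by (auto simp: field_simps)
      then show "x / \<epsilon> = ramp \<epsilon> x" by (simp add: ramp_def)
    qed (use 1 in auto)
    then show ?thesis using 1 by simp
  next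
    case 2
    have "((\<lambda>_. 1) has_real_derivative 0) (at r)" by simp
    then have "(ramp \<epsilon> has_real_derivative 0) (at r)"
    proof (rule has_field_derivative_transform_within_open[where S = "{\<epsilon><..}"])
      fix x assume "x \<in> {\<epsilon><..}"
      then have "1 \<le> x / \<epsilon>" using assms(1) by (auto simp: field_simps)
      then show "1 = ramp \<epsilon> x" by (simp add: ramp_def)
    qed (use 2 in auto)
    then show ?thesis using 2 assms by simp
  next
    case 3
    have "((\<lambda>_. - 1) has_real_derivative 0) (at r)" by simp
    then have "(ramp \<epsilon> has_real_derivative 0) (at r)"
    proof (rule has_field_derivative_transform_within_open[where S = "{..<-\<epsilon>}"])
      fix x assume "x \<in> {..<-\<epsilon>}"
      then have "x / \<epsilon> \<le> - 1" using assms(1) by (auto simp: field_simps)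
      then show "- 1 = ramp \<epsilon> x" by (simp add: ramp_def)
    qed (use 3 in auto)
    then show ?thesis using 3 assms by simp
  qed
qed

lemma abs_has_real_derivative_sgn:
  assumes "x \<noteq> (0 :: real)" shows "(abs has_real_derivative sgn x) (at x)"
proof (cases "x > 0")
  case True
  have "((\<lambda>x. x) has_real_derivative 1) (at x)" by simp
  then have "(abs has_real_derivative 1) (at x)"
    by (rule has_field_derivative_transform_within_open[where S = "{0<..}"]) (use True in auto)
  then show ?thesis using True by simp
next
  case False
  have "((\<lambda>x. - x) has_real_derivative - 1) (at x)" by (auto intro!: derivative_eq_intros)
  then have "(abs has_real_derivative - 1) (at x)"
    by (rule has_field_derivative_transform_within_open[where S = "{..<0}"]) (use False assms in auto)
  then show ?thesis using False assms by simp
qed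

text \<open>On a short edge, \<open>|y| - |x|\<close> is the argument at which the boundary function \<open>g\<close> is evaluated, and on the long
  edges it is at least \<open>\<epsilon>\<close> in absolute value. Truncating it at \<open>\<plusminus>\<epsilon>\<close> therefore reproduces the boundary data; the
  result is Lipschitz, has the symmetries of the square, and vanishes on the diagonals.\<close>

definition boundary_lift :: "real \<Rightarrow> real \<Rightarrow> real \<times> real \<Rightarrow> real ^ 3"
  where "boundary_lift s \<epsilon> = (\<lambda>(x, y). (s / 2 * ramp \<epsilon> (\<bar>y\<bar> - \<bar>x\<bar>)) *\<^sub>R axis 1 1 + (- s / 6) *\<^sub>R axis 3 1)"

definition boundary_lift_slope :: "real \<Rightarrow> real \<Rightarrow> real \<times> real \<Rightarrow> real"
  where "boundary_lift_slope s \<epsilon> = (\<lambda>(x, y). if \<bar>\<bar>y\<bar> - \<bar>x\<bar>\<bar> < \<epsilon> then s / (2 * \<epsilon>) else 0)"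

definition boundary_lift_x :: "real \<Rightarrow> real \<Rightarrow> real \<times> real \<Rightarrow> real ^ 3"
  where "boundary_lift_x s \<epsilon> z = (- sgn (fst z) * boundary_lift_slope s \<epsilon> z) *\<^sub>R axis 1 1"

definition boundary_lift_y :: "real \<Rightarrow> real \<Rightarrow> real \<times> real \<Rightarrow> real ^ 3"
  where "boundary_lift_y s \<epsilon> z = (sgn (snd z) * boundary_lift_slope s \<epsilon> z) *\<^sub>R axis 1 1"

lemma boundary_lift_continuous: assumes "\<epsilon> > 0" shows "continuous_on S (boundary_lift s \<epsilon>)"
  unfolding boundary_lift_def ramp_def case_prod_beta using assms by (intro continuous_intros) auto

lemma boundary_lift_slope_measurable: "boundary_lift_slope s \<epsilon> \<in> borel_measurable borel"
proof -
  have "continuous_on UNIV (\<lambda>z :: real \<times> real. \<bar>\<bar>snd z\<bar> - \<bar>fst z\<bar>\<bar>)" by (intro continuous_intros)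
  then have "(\<lambda>z :: real \<times> real. \<bar>\<bar>snd z\<bar> - \<bar>fst z\<bar>\<bar>) \<in> borel_measurable borel" by (rule borel_measurable_continuous_onI)
  then have "{z \<in> space borel. \<bar>\<bar>snd z\<bar> - \<bar>fst z\<bar>\<bar> < \<epsilon>} \<in> sets (borel :: (real \<times> real) measure)"
    by (rule borel_measurable_less[OF _ borel_measurable_const])
  then show ?thesis unfolding boundary_lift_slope_def case_prod_beta by (intro measurable_If) auto
qed

lemma sgn_coordinate_measurable:
  "(\<lambda>z :: real \<times> real. sgn (fst z)) \<in> borel_measurable borel"
  "(\<lambda>z :: real \<times> real. sgn (snd z)) \<in> borel_measurable borel"
  by (intro borel_measurable_sgn[THEN measurable_compose[rotated]] borel_measurable_continuous_onI continuous_intros)+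

lemma boundary_lift_xy_measurable:
  "boundary_lift_x s \<epsilon> \<in> borel_measurable borel" "boundary_lift_y s \<epsilon> \<in> borel_measurable borel"
  unfolding boundary_lift_x_def[abs_def] boundary_lift_y_def[abs_def]
  by (intro borel_measurable_scaleR borel_measurable_times borel_measurable_uminus
      boundary_lift_slope_measurable sgn_coordinate_measurable borel_measurable_const)+

lemma boundary_lift_xy_bounded: "norm (boundary_lift_x s \<epsilon> z) \<le> \<bar>s / (2 * \<epsilon>)\<bar>" "norm (boundary_lift_y s \<epsilon> z) \<le> \<bar>s / (2 * \<epsilon>)\<bar>"
proof -
  have s: "\<bar>sgn t\<bar> \<le> 1" for t :: real by (simp add: sgn_if)
  have l: "\<bar>boundary_lift_slope s \<epsilon> z\<bar> \<le> \<bar>s / (2 * \<epsilon>)\<bar>" by (simp add: boundary_lift_slope_def case_prod_beta)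
  show "norm (boundary_lift_x s \<epsilon> z) \<le> \<bar>s / (2 * \<epsilon>)\<bar>" "norm (boundary_lift_y s \<epsilon> z) \<le> \<bar>s / (2 * \<epsilon>)\<bar>"
    using mult_mono[OF s l, of "fst z"] mult_mono[OF s l, of "snd z"]
    by (simp_all add: boundary_lift_x_def boundary_lift_y_def norm_axis_1 abs_mult)
qed

lemma boundary_lift_lines:
  assumes "\<epsilon> > 0"
  shows "\<exists>E. finite E \<and> (\<forall>t. t \<notin> E \<longrightarrow>
      ((\<lambda>t. boundary_lift s \<epsilon> (z + t *\<^sub>R (1, 0))) has_vector_derivative boundary_lift_x s \<epsilon> (z + t *\<^sub>R (1, 0))) (at t))"
    and "\<exists>E. finite E \<and> (\<forall>t. t \<notin> E \<longrightarrow>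
      ((\<lambda>t. boundary_lift s \<epsilon> (z + t *\<^sub>R (0, 1))) has_vector_derivative boundary_lift_y s \<epsilon> (z + t *\<^sub>R (0, 1))) (at t))"
proof -
  obtain a b where z: "z = (a, b)" by (cases z)
  have deriv: "((\<lambda>t. (s / 2 * ramp \<epsilon> (r t)) *\<^sub>R axis 1 1 + c) has_vector_derivative
      (D * (if \<bar>r t\<bar> < \<epsilon> then s / (2 * \<epsilon>) else 0)) *\<^sub>R axis 1 1) (at t)"
    if r: "(r has_real_derivative D) (at t)" and "\<bar>r t\<bar> \<noteq> \<epsilon>" for r D t and c :: "real ^ 3"
  proof -
    have "((\<lambda>t. s / 2 * ramp \<epsilon> (r t)) has_real_derivative
        s / 2 * ((if \<bar>r t\<bar> < \<epsilon> then 1 / \<epsilon> else 0) * D)) (at t)"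
      by (intro DERIV_cmult DERIV_chain2[OF ramp_has_derivative[OF assms that(2)] r])
    from has_vector_derivative_add[OF has_vector_derivative_scaleR[OF this
          has_vector_derivative_const[of "axis 1 1 :: real ^ 3"]] has_vector_derivative_const[of c]]
    have "((\<lambda>t. (s / 2 * ramp \<epsilon> (r t)) *\<^sub>R axis 1 1 + c) has_vector_derivative
      (s / 2 * ((if \<bar>r t\<bar> < \<epsilon> then 1 / \<epsilon> else 0) * D)) *\<^sub>R axis 1 1) (at t)"
      by (simp only: scaleR_zero_right add_0_left add_0_right)
    moreover have "s / 2 * ((if \<bar>r t\<bar> < \<epsilon> then 1 / \<epsilon> else 0) * D) = D * (if \<bar>r t\<bar> < \<epsilon> then s / (2 * \<epsilon>) else 0)" by simp
    ultimately show ?thesis by (simp only:)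
  qed
  show "\<exists>E. finite E \<and> (\<forall>t. t \<notin> E \<longrightarrow>
      ((\<lambda>t. boundary_lift s \<epsilon> (z + t *\<^sub>R (1, 0))) has_vector_derivative boundary_lift_x s \<epsilon> (z + t *\<^sub>R (1, 0))) (at t))"
  proof (intro exI conjI allI impI)
    \<comment> \<open>The kink of \<open>|a + t|\<close> and the points where the truncation sets in.\<close>
    show "finite {- a, \<bar>b\<bar> - \<epsilon> - a, - \<bar>b\<bar> + \<epsilon> - a, \<bar>b\<bar> + \<epsilon> - a, - \<bar>b\<bar> - \<epsilon> - a}" by simp
    fix t assume t: "t \<notin> {- a, \<bar>b\<bar> - \<epsilon> - a, - \<bar>b\<bar> + \<epsilon> - a, \<bar>b\<bar> + \<epsilon> - a, - \<bar>b\<bar> - \<epsilon> - a}"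
    have nz: "a + t \<noteq> 0" using t by auto
    have ne: "\<bar>\<bar>b\<bar> - \<bar>a + t\<bar>\<bar> \<noteq> \<epsilon>"
    proof
      assume "\<bar>\<bar>b\<bar> - \<bar>a + t\<bar>\<bar> = \<epsilon>"
      then have "\<bar>a + t\<bar> = \<bar>b\<bar> - \<epsilon> \<or> \<bar>a + t\<bar> = \<bar>b\<bar> + \<epsilon>" by linarith
      then have "t = \<bar>b\<bar> - \<epsilon> - a \<or> t = - \<bar>b\<bar> + \<epsilon> - a \<or> t = \<bar>b\<bar> + \<epsilon> - a \<or> t = - \<bar>b\<bar> - \<epsilon> - a"
        by linarith
      with t show False by simp
    qed
    have "((\<lambda>t. a + t) has_real_derivative 1) (at t)" by (auto intro!: derivative_eq_intros)
    then have abs_deriv: "((\<lambda>t. \<bar>a + t\<bar>) has_real_derivative sgn (a + t) * 1) (at t)"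
      by (rule DERIV_chain2[where g = "\<lambda>t. a + t", OF abs_has_real_derivative_sgn[OF nz]])
    have "((\<lambda>t. \<bar>b\<bar> - \<bar>a + t\<bar>) has_real_derivative - sgn (a + t)) (at t)"
      using DERIV_diff[OF DERIV_const[of "\<bar>b\<bar>"] abs_deriv] by simp
    from deriv[OF this ne, of "(- s / 6) *\<^sub>R axis 3 1"] show "((\<lambda>t. boundary_lift s \<epsilon> (z + t *\<^sub>R (1, 0))) has_vector_derivative boundary_lift_x s \<epsilon> (z + t *\<^sub>R (1, 0))) (at t)"
      by (simp add: z boundary_lift_def boundary_lift_x_def boundary_lift_slope_def split del: if_split)
  qed
  show "\<exists>E. finite E \<and> (\<forall>t. t \<notin> E \<longrightarrow>
      ((\<lambda>t. boundary_lift s \<epsilon> (z + t *\<^sub>R (0, 1))) has_vector_derivative boundary_lift_y s \<epsilon> (z + t *\<^sub>R (0, 1))) (at t))"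
  proof (intro exI conjI allI impI)
    \<comment> \<open>The kink of \<open>|b + t|\<close> and the points where the truncation sets in.\<close>
    show "finite {- b, \<bar>a\<bar> - \<epsilon> - b, - \<bar>a\<bar> + \<epsilon> - b, \<bar>a\<bar> + \<epsilon> - b, - \<bar>a\<bar> - \<epsilon> - b}" by simp
    fix t assume t: "t \<notin> {- b, \<bar>a\<bar> - \<epsilon> - b, - \<bar>a\<bar> + \<epsilon> - b, \<bar>a\<bar> + \<epsilon> - b, - \<bar>a\<bar> - \<epsilon> - b}"
    have nz: "b + t \<noteq> 0" using t by auto
    have ne: "\<bar>\<bar>b + t\<bar> - \<bar>a\<bar>\<bar> \<noteq> \<epsilon>"
    proof
      assume "\<bar>\<bar>b + t\<bar> - \<bar>a\<bar>\<bar> = \<epsilon>"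
      then have "\<bar>b + t\<bar> = \<bar>a\<bar> - \<epsilon> \<or> \<bar>b + t\<bar> = \<bar>a\<bar> + \<epsilon>" by linarith
      then have "t = \<bar>a\<bar> - \<epsilon> - b \<or> t = - \<bar>a\<bar> + \<epsilon> - b \<or> t = \<bar>a\<bar> + \<epsilon> - b \<or> t = - \<bar>a\<bar> - \<epsilon> - b"
        by linarith
      with t show False by simp
    qed
    have "((\<lambda>t. b + t) has_real_derivative 1) (at t)" by (auto intro!: derivative_eq_intros)
    then have abs_deriv: "((\<lambda>t. \<bar>b + t\<bar>) has_real_derivative sgn (b + t) * 1) (at t)"
      by (rule DERIV_chain2[where g = "\<lambda>t. b + t", OF abs_has_real_derivative_sgn[OF nz]])
    have "((\<lambda>t. \<bar>b + t\<bar> - \<bar>a\<bar>) has_real_derivative sgn (b + t)) (at t)"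
      using DERIV_diff[OF abs_deriv DERIV_const[of "\<bar>a\<bar>"]] by simp
    from deriv[OF this ne, of "(- s / 6) *\<^sub>R axis 3 1"] show "((\<lambda>t. boundary_lift s \<epsilon> (z + t *\<^sub>R (0, 1))) has_vector_derivative boundary_lift_y s \<epsilon> (z + t *\<^sub>R (0, 1))) (at t)"
      by (simp add: z boundary_lift_def boundary_lift_y_def boundary_lift_slope_def split del: if_split)
  qed
qed

lemma boundary_lift_has_weak_deriv:
  assumes "\<epsilon> > 0" "S \<in> sets lebesgue"
  shows "has_weak_deriv S (1, 0) (boundary_lift s \<epsilon>) (boundary_lift_x s \<epsilon>)" "has_weak_deriv S (0, 1) (boundary_lift s \<epsilon>) (boundary_lift_y s \<epsilon>)"
  by (rule has_weak_deriv_piecewise[OF assms(2) _ boundary_lift_continuous[OF assms(1)] boundary_lift_xy_measurable(1) boundary_lift_xy_bounded(1) boundary_lift_lines(1)[OF assms(1)]],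
      simp add: Basis_real_prod,
      rule has_weak_deriv_piecewise[OF assms(2) _ boundary_lift_continuous[OF assms(1)] boundary_lift_xy_measurable(2) boundary_lift_xy_bounded(2) boundary_lift_lines(2)[OF assms(1)]],
      simp add: Basis_real_prod)

lemma long_edge_points:
  assumes "0 < \<epsilon>" "\<epsilon> < 1"
  shows "(x, y) \<in> points_of (C1 \<epsilon>) \<Longrightarrow> y = 1 \<and> \<bar>x\<bar> \<le> 1 - \<epsilon>"
    "(x, y) \<in> points_of (C2 \<epsilon>) \<Longrightarrow> x = 1 \<and> \<bar>y\<bar> \<le> 1 - \<epsilon>"
    "(x, y) \<in> points_of (C3 \<epsilon>) \<Longrightarrow> y = -1 \<and> \<bar>x\<bar> \<le> 1 - \<epsilon>"
    "(x, y) \<in> points_of (C4 \<epsilon>) \<Longrightarrow> x = -1 \<and> \<bar>y\<bar> \<le> 1 - \<epsilon>"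
proof -
  have b: "\<bar>(1 - u) * r + u * (- r)\<bar> \<le> \<bar>r\<bar>" if "0 \<le> u" "u \<le> 1" for u r :: real
  proof -
    have "(1 - u) * r + u * (- r) = (1 - 2 * u) * r" by (simp add: algebra_simps)
    then show ?thesis using mult_right_mono[of "\<bar>1 - 2 * u\<bar>" 1 "\<bar>r\<bar>"] that by (simp add: abs_mult)
  qed
  show "(x, y) \<in> points_of (C1 \<epsilon>) \<Longrightarrow> y = 1 \<and> \<bar>x\<bar> \<le> 1 - \<epsilon>"
    "(x, y) \<in> points_of (C2 \<epsilon>) \<Longrightarrow> x = 1 \<and> \<bar>y\<bar> \<le> 1 - \<epsilon>"
    "(x, y) \<in> points_of (C3 \<epsilon>) \<Longrightarrow> y = -1 \<and> \<bar>x\<bar> \<le> 1 - \<epsilon>"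
    "(x, y) \<in> points_of (C4 \<epsilon>) \<Longrightarrow> x = -1 \<and> \<bar>y\<bar> \<le> 1 - \<epsilon>"
    using b[of _ "-1 + \<epsilon>"] b[of _ "1 - \<epsilon>"] assms
    by (auto simp: points_of_def C1_def C2_def C3_def C4_def in_segment)
qed

lemma short_edge_points:
  assumes "0 < \<epsilon>" "\<epsilon> < 1"
  shows "(x, y) \<in> points_of (S1 \<epsilon>) \<Longrightarrow> y - x = 2 - \<epsilon> \<and> -1 \<le> x \<and> x \<le> -1 + \<epsilon>"
    "(x, y) \<in> points_of (S2 \<epsilon>) \<Longrightarrow> x + y = 2 - \<epsilon> \<and> 1 - \<epsilon> \<le> x \<and> x \<le> 1"
    "(x, y) \<in> points_of (S3 \<epsilon>) \<Longrightarrow> x - y = 2 - \<epsilon> \<and> 1 - \<epsilon> \<le> x \<and> x \<le> 1"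
    "(x, y) \<in> points_of (S4 \<epsilon>) \<Longrightarrow> x + y = - (2 - \<epsilon>) \<and> -1 \<le> x \<and> x \<le> -1 + \<epsilon>"
proof -
  have seg: "\<exists>w. 0 \<le> w \<and> w \<le> \<epsilon> \<and> x = a + d * w \<and> y = b + d' * w"
    if mem: "(x, y) \<in> closed_segment (a, b) (a + d * \<epsilon>, b + d' * \<epsilon>)" for a b d d'
  proof -
    obtain u where u: "0 \<le> u" "u \<le> 1" "x = (1 - u) * a + u * (a + d * \<epsilon>)" "y = (1 - u) * b + u * (b + d' * \<epsilon>)"
      using mem by (auto simp: in_segment)
    have "0 \<le> u * \<epsilon>" "u * \<epsilon> \<le> \<epsilon>" using u(1,2) assms(1) by (simp_all add: mult_left_le_one_le)
    with u(3,4) show ?thesis by (intro exI[of _ "u * \<epsilon>"]) (auto simp: algebra_simps)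
  qed
  show "(x, y) \<in> points_of (S1 \<epsilon>) \<Longrightarrow> y - x = 2 - \<epsilon> \<and> -1 \<le> x \<and> x \<le> -1 + \<epsilon>"
    using seg[of "-1" "1 - \<epsilon>" 1 1] by (auto simp: points_of_def S1_def)
  show "(x, y) \<in> points_of (S2 \<epsilon>) \<Longrightarrow> x + y = 2 - \<epsilon> \<and> 1 - \<epsilon> \<le> x \<and> x \<le> 1"
    using seg[of "1 - \<epsilon>" 1 1 "-1"] by (auto simp: points_of_def S2_def)
  show "(x, y) \<in> points_of (S3 \<epsilon>) \<Longrightarrow> x - y = 2 - \<epsilon> \<and> 1 - \<epsilon> \<le> x \<and> x \<le> 1"
    using seg[of 1 "-1 + \<epsilon>" "-1" "-1"] by (auto simp: points_of_def S3_def)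
  show "(x, y) \<in> points_of (S4 \<epsilon>) \<Longrightarrow> x + y = - (2 - \<epsilon>) \<and> -1 \<le> x \<and> x \<le> -1 + \<epsilon>"
    using seg[of "-1 + \<epsilon>" "-1" "-1" 1] by (auto simp: points_of_def S4_def)
qed

lemma ramp_cases:
  assumes "\<epsilon> > 0"
  shows "r \<ge> \<epsilon> \<Longrightarrow> ramp \<epsilon> r = 1" "r \<le> - \<epsilon> \<Longrightarrow> ramp \<epsilon> r = -1" "\<bar>r\<bar> \<le> \<epsilon> \<Longrightarrow> ramp \<epsilon> r = r / \<epsilon>"
  using assms by (auto simp: ramp_def field_simps abs_le_iff min_def max_def)

lemma ramp_eq_q_b:
  assumes \<epsilon>: "0 < \<epsilon>" "\<epsilon> < 1" and e: "e \<in> boundary_edges \<epsilon>" and z: "z \<in> points_of e"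
  shows "s / 2 * ramp \<epsilon> (\<bar>snd z\<bar> - \<bar>fst z\<bar>) = q_b s \<epsilon> z"
proof -
  obtain x y where xy: "z = (x, y)" by (cases z)
  let ?r = "s / 2 * ramp \<epsilon> (\<bar>y\<bar> - \<bar>x\<bar>)"
  note pts = long_edge_points[OF \<epsilon>, of x y] short_edge_points[OF \<epsilon>, of x y]
  note rc = ramp_cases[OF \<epsilon>(1), of "\<bar>y\<bar> - \<bar>x\<bar>"]
  have 1: "?r = s / 2" if "z \<in> points_of (C1 \<epsilon>) \<union> points_of (C3 \<epsilon>)"
    using that pts(1,3) rc(1) \<epsilon> by (auto simp: xy)
  have 2: "?r = - s / 2" if "z \<in> points_of (C2 \<epsilon>) \<union> points_of (C4 \<epsilon>)"
    using that pts(2,4) rc(2) \<epsilon> by (auto simp: xy)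
  have 3: "?r = g_short s \<epsilon> (x + y)" if "z \<in> points_of (S1 \<epsilon>)"
  proof -
    have "\<bar>y\<bar> = y" "\<bar>x\<bar> = - x" "\<bar>x + y\<bar> \<le> \<epsilon>" using that pts(5) \<epsilon> by (auto simp: xy)
    then show ?thesis using rc(3) by (simp add: g_short_def algebra_simps)
  qed
  have 4: "?r = g_short s \<epsilon> (y - x)" if "z \<in> points_of (S2 \<epsilon>)"
  proof -
    have "\<bar>y\<bar> = y" "\<bar>x\<bar> = x" "\<bar>y - x\<bar> \<le> \<epsilon>" using that pts(6) \<epsilon> by (auto simp: xy)
    then show ?thesis using rc(3) by (simp add: g_short_def)
  qed
  have 5: "?r = g_short s \<epsilon> (- x - y)" if "z \<in> points_of (S3 \<epsilon>)"
  proof -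
    have "\<bar>y\<bar> = - y" "\<bar>x\<bar> = x" "\<bar>- x - y\<bar> \<le> \<epsilon>" using that pts(7) \<epsilon> by (auto simp: xy)
    then show ?thesis using rc(3) by (simp add: g_short_def algebra_simps)
  qed
  have 6: "?r = g_short s \<epsilon> (x - y)" if "z \<in> points_of (S4 \<epsilon>)"
  proof -
    have "\<bar>y\<bar> = - y" "\<bar>x\<bar> = - x" "\<bar>x - y\<bar> \<le> \<epsilon>" using that pts(8) \<epsilon> by (auto simp: xy)
    then show ?thesis using rc(3) by (simp add: g_short_def algebra_simps)
  qed
  have "z \<in> points_of (C1 \<epsilon>) \<union> points_of (C3 \<epsilon>) \<or> z \<in> points_of (C2 \<epsilon>) \<union> points_of (C4 \<epsilon>) \<or>
    z \<in> points_of (S1 \<epsilon>) \<or> z \<in> points_of (S2 \<epsilon>) \<or> z \<in> points_of (S3 \<epsilon>) \<or> z \<in> points_of (S4 \<epsilon>)"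
    using e z by (auto simp: boundary_edges_def)
  then show ?thesis using 1 2 3 4 5 6 unfolding q_b_def xy fst_conv snd_conv prod.case by (simp split: if_split) auto
qed

lemma boundary_edges_outside:
  assumes "0 < \<epsilon>" "\<epsilon> < 1" "e \<in> boundary_edges \<epsilon>" "z \<in> points_of e"
  shows "z \<notin> Omega \<epsilon>"
proof -
  obtain x y where xy: "z = (x, y)" by (cases z)
  show ?thesis
    using assms(3,4) long_edge_points[OF assms(1,2), of x y] short_edge_points[OF assms(1,2), of x y]
    by (auto simp: xy boundary_edges_def Omega_def)
qed

lemma linepath_in_points_of: "t \<in> {0..1} \<Longrightarrow> linepath a b t \<in> points_of (a, b)"
  by (auto simp: points_of_def linepath_in_path)

lemma boundary_lift_eq:
  "boundary_lift s \<epsilon> z = vector [s / 2 * ramp \<epsilon> (\<bar>snd z\<bar> - \<bar>fst z\<bar>), 0, - s / 6]"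
  by (simp add: boundary_lift_def case_prod_beta vec_eq_iff forall_3 axis_def)

lemma linepath_diagonals:
  assumes "(a, b) \<in> diagonals \<epsilon>" obtains "snd (linepath a b t) = fst (linepath a b t)" | "snd (linepath a b t) = - fst (linepath a b t)"
  using assms by (auto simp: diagonals_def linepath_def algebra_simps)

lemma linepath_axes:
  assumes "(a, b) \<in> axes" obtains "fst (linepath a b t) = 0" | "snd (linepath a b t) = 0"
  using assms by (auto simp: axes_def linepath_def)

section \<open>Reflections of the square\<close>

text \<open>The value and the partial derivatives of a field at a point, the arguments of the energy density.\<close>

definition jet :: "(real \<times> real \<Rightarrow> real ^ 3) \<Rightarrow> real \<times> real \<Rightarrow> jet"
  where "jet \<phi> z = (\<phi> z, dir_deriv (1, 0) \<phi> z, dir_deriv (0, 1) \<phi> z)"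

lemma jet_add: "smooth \<phi> \<Longrightarrow> smooth \<psi> \<Longrightarrow> jet (\<lambda>z. \<phi> z + \<psi> z) z = jet \<phi> z + jet \<psi> z"
  by (simp add: jet_def dir_deriv_add)

lemma jet_scaleR: "smooth \<phi> \<Longrightarrow> jet (\<lambda>z. t *\<^sub>R \<phi> z) z = t *\<^sub>R jet \<phi> z"
  by (simp add: jet_def dir_deriv_bounded_linear[OF bounded_linear_scaleR_right])

lemma jet_continuous: "smooth \<phi> \<Longrightarrow> continuous_on S (jet \<phi>)"
  unfolding jet_def[abs_def] by (intro continuous_intros smooth_continuous smooth_dir_deriv)

definition refl_x :: "real \<times> real \<Rightarrow> real \<times> real" where "refl_x z = (- fst z, snd z)"
definition refl_y :: "real \<times> real \<Rightarrow> real \<times> real" where "refl_y z = (fst z, - snd z)"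
definition refl_d :: "real \<times> real \<Rightarrow> real \<times> real" where "refl_d z = (snd z, fst z)"

text \<open>Changing the sign of the component \<open>i\<close> is how a reflection of the square acts on the values: \<open>i = 2\<close> for the
  reflections in the axes and \<open>i = 1\<close> for the one in the diagonal.\<close>

definition flip :: "3 \<Rightarrow> real ^ 3 \<Rightarrow> real ^ 3"
  where "flip i v = (\<chi> j. if j = i then - v $ j else v $ j)"

lemma bounded_linear_flip: "bounded_linear (flip i)"
  by (intro linear_conv_bounded_linear[THEN iffD1] linearI) (auto simp: flip_def vec_eq_iff)

lemma flip_simps:
  "flip i (flip i v) = v" "flip i (flip j v) = flip j (flip i v)" "flip i (u + v) = flip i u + flip i v"
  "flip i (- v) = - flip i v" "flip i (u - v) = flip i u - flip i v"
  by (auto simp: flip_def vec_eq_iff)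

lemma flip_nth: "flip i v $ j = (if j = i then - v $ j else v $ j)"
  by (simp add: flip_def)

lemma bounded_linear_reflections: "bounded_linear refl_x" "bounded_linear refl_y" "bounded_linear refl_d"
  unfolding refl_x_def[abs_def] refl_y_def[abs_def] refl_d_def[abs_def]
  by (intro bounded_linear_Pair bounded_linear_fst bounded_linear_snd bounded_linear_minus)+

lemma refl_involution: "refl_x (refl_x z) = z" "refl_y (refl_y z) = z" "refl_d (refl_d z) = z"
  by (simp_all add: refl_x_def refl_y_def refl_d_def)

lemma refl_Omega:
  "refl_x z \<in> Omega \<epsilon> \<longleftrightarrow> z \<in> Omega \<epsilon>" "refl_y z \<in> Omega \<epsilon> \<longleftrightarrow> z \<in> Omega \<epsilon>" "refl_d z \<in> Omega \<epsilon> \<longleftrightarrow> z \<in> Omega \<epsilon>"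
  by (auto simp: refl_x_def refl_y_def refl_d_def Omega_def case_prod_beta add.commute abs_minus_commute)

lemma distr_reflections:
  "distr lborel borel refl_x = lborel" "distr lborel borel refl_y = lborel" "distr lborel borel refl_d = lborel"
proof -
  have flipped: "lborel = distr lborel borel T"
    if T: "T = (\<lambda>x. 0 + (\<Sum>j\<in>Basis. (c j * (x \<bullet> j)) *\<^sub>R j))" and c: "\<And>j. j \<in> Basis \<Longrightarrow> \<bar>c j\<bar> = 1" for T and c :: "real \<times> real \<Rightarrow> real"
  proof -
    have "lborel = density (distr lborel borel T) (\<lambda>_. (\<Prod>j\<in>Basis. \<bar>c j\<bar>))"
      unfolding T by (rule lborel_affine_euclidean) (use c in fastforce)
    also have "(\<Prod>j\<in>Basis. \<bar>c j\<bar>) = 1" using c by simp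
    finally show ?thesis by (simp add: density_1)
  qed
  have "refl_x = (\<lambda>x. 0 + (\<Sum>j\<in>Basis. ((if j = (1, 0) then - 1 else 1) * (x \<bullet> j)) *\<^sub>R j))"
    by (auto simp: fun_eq_iff Basis_real_prod refl_x_def)
  from flipped[OF this] show "distr lborel borel refl_x = lborel" by simp
  have "refl_y = (\<lambda>x. 0 + (\<Sum>j\<in>Basis. ((if j = (0, 1) then - 1 else 1) * (x \<bullet> j)) *\<^sub>R j))"
    by (auto simp: fun_eq_iff Basis_real_prod refl_y_def)
  from flipped[OF this] show "distr lborel borel refl_y = lborel" by simp
  have "lborel \<Otimes>\<^sub>M lborel = distr (lborel \<Otimes>\<^sub>M lborel) (lborel \<Otimes>\<^sub>M lborel) (\<lambda>(x, y). (y, x :: real))"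
    using lborel_pair.distr_pair_swap by blast
  then have swap: "lborel = distr lborel lborel (\<lambda>(x, y). (y, x :: real))" by (simp add: lborel_prod)
  have "distr lborel lborel (\<lambda>(x, y). (y, x :: real)) = distr lborel borel refl_d"
    by (rule distr_cong) (auto simp: refl_d_def)
  then show "distr lborel borel refl_d = lborel" using swap by (rule trans[OF sym sym])
qed

lemma LINT_change_of_variables:
  fixes f :: "'a::euclidean_space \<Rightarrow> real"
  assumes S: "S \<in> sets borel" and f: "f \<in> borel_measurable borel"
    and T: "T \<in> borel_measurable borel" "distr lborel borel T = lborel" "\<And>z. T z \<in> S \<longleftrightarrow> z \<in> S"
  shows "(LINT z|lebesgue_on S. f (T z)) = (LINT z|lebesgue_on S. f z)"
proof -
  let ?g = "\<lambda>z. indicator S z * f z"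
  have g: "?g \<in> borel_measurable borel" using S f by simp
  have to_lborel: "(LINT z|lebesgue_on S. h z) = (LINT z|lborel. indicator S z * h z)"
    if h: "h \<in> borel_measurable borel" for h :: "'a \<Rightarrow> real"
  proof -
    have "(LINT z|lebesgue_on S. h z) = (LINT z|lebesgue_on S. indicator S z * h z)"
      by (rule Bochner_Integration.integral_cong) auto
    also have "\<dots> = (LINT z|lborel. indicator S z * h z)"
      by (rule LINT_lebesgue_on_eq_lborel) (use S h in auto)
    finally show ?thesis .
  qed
  have "(LINT z|lborel. ?g z) = (LINT z|distr lborel borel T. ?g z)" by (simp only: T(2))
  also have "\<dots> = (LINT z|lborel. ?g (T z))" by (rule integral_distr) (use T(1) g in auto)
  also have "\<dots> = (LINT z|lborel. indicator S z * f (T z))" using T(3) by (simp add: indicator_def)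
  finally show ?thesis using to_lborel[OF f] to_lborel[OF measurable_compose[OF T(1) f]] by simp
qed

text \<open>The actions on jets that correspond to the three reflections: the components are flipped and the partial
  derivatives transformed by the chain rule.\<close>

definition jet_x :: "jet \<Rightarrow> jet" where "jet_x = (\<lambda>(q, qx, qy). (flip 2 q, - flip 2 qx, flip 2 qy))"
definition jet_y :: "jet \<Rightarrow> jet" where "jet_y = (\<lambda>(q, qx, qy). (flip 2 q, flip 2 qx, - flip 2 qy))"
definition jet_d :: "jet \<Rightarrow> jet" where "jet_d = (\<lambda>(q, qx, qy). (flip 1 q, flip 1 qy, flip 1 qx))"

lemma jet_act:
  assumes "smooth \<phi>"
  shows "jet (\<lambda>z. flip 2 (\<phi> (refl_x z))) z = jet_x (jet \<phi> (refl_x z))"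
    "jet (\<lambda>z. flip 2 (\<phi> (refl_y z))) z = jet_y (jet \<phi> (refl_y z))"
    "jet (\<lambda>z. flip 1 (\<phi> (refl_d z))) z = jet_d (jet \<phi> (refl_d z))"
proof -
  have e: "refl_x (1, 0) = - (1, 0)" "refl_x (0, 1) = (0, 1)" "refl_y (1, 0) = (1, 0)" "refl_y (0, 1) = - (0, 1)"
    "refl_d (1, 0) = (0, 1)" "refl_d (0, 1) = (1, 0)"
    by (simp_all add: refl_x_def refl_y_def refl_d_def)
  show "jet (\<lambda>z. flip 2 (\<phi> (refl_x z))) z = jet_x (jet \<phi> (refl_x z))"
    "jet (\<lambda>z. flip 2 (\<phi> (refl_y z))) z = jet_y (jet \<phi> (refl_y z))"
    "jet (\<lambda>z. flip 1 (\<phi> (refl_d z))) z = jet_d (jet \<phi> (refl_d z))"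
    unfolding jet_def jet_x_def jet_y_def jet_d_def
      dir_deriv_act[OF bounded_linear_reflections(1) bounded_linear_flip assms]
      dir_deriv_act[OF bounded_linear_reflections(2) bounded_linear_flip assms]
      dir_deriv_act[OF bounded_linear_reflections(3) bounded_linear_flip assms] e
      dir_deriv_minus[OF assms] by (simp_all add: flip_simps)
qed

text \<open>Invariance of the energy density under the group, in the form in which it enters the first variation.\<close>

lemma energy_deriv_jet_symmetry:
  "energy_deriv A B C L L2 lam (jet_x w) (jet_x k) = energy_deriv A B C L L2 lam w k"
  "energy_deriv A B C L L2 lam (jet_y w) (jet_y k) = energy_deriv A B C L L2 lam w k"
  "energy_deriv A B C L L2 lam (jet_d w) (jet_d k) = energy_deriv A B C L L2 lam w k"
  by (simp_all add: energy_deriv_def f_el_bilin_def f_b_deriv_def jet_x_def jet_y_def jet_d_def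
      case_prod_beta flip_nth) (simp_all add: algebra_simps)

definition base_jet :: "real \<Rightarrow> real \<Rightarrow> real \<times> real \<Rightarrow> jet"
  where "base_jet s \<epsilon> z = (boundary_lift s \<epsilon> z, boundary_lift_x s \<epsilon> z, boundary_lift_y s \<epsilon> z)"

lemma ramp_minus: "ramp \<epsilon> (- r) = - ramp \<epsilon> r"
  by (simp add: ramp_def min_def max_def)

lemma flip_axis: "flip i (c *\<^sub>R axis j 1) = (if i = j then - c else c) *\<^sub>R axis j 1"
  by (auto simp: flip_def vec_eq_iff axis_def)

text \<open>The value \<open>sgn 0 = 0\<close> makes these hold everywhere, also on the axes, where the lift is not differentiable.\<close>

lemma base_jet_symmetry:
  "base_jet s \<epsilon> z = jet_x (base_jet s \<epsilon> (refl_x z))"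
  "base_jet s \<epsilon> z = jet_y (base_jet s \<epsilon> (refl_y z))"
  "base_jet s \<epsilon> z = jet_d (base_jet s \<epsilon> (refl_d z))"
proof -
  obtain x y where z: "z = (x, y)" by (cases z)
  have r: "ramp \<epsilon> (\<bar>x\<bar> - \<bar>y\<bar>) = - ramp \<epsilon> (\<bar>y\<bar> - \<bar>x\<bar>)" using ramp_minus[of \<epsilon> "\<bar>y\<bar> - \<bar>x\<bar>"] by simp
  have c: "\<bar>\<bar>x\<bar> - \<bar>y\<bar>\<bar> = \<bar>\<bar>y\<bar> - \<bar>x\<bar>\<bar>" by simp
  show "base_jet s \<epsilon> z = jet_x (base_jet s \<epsilon> (refl_x z))"
    "base_jet s \<epsilon> z = jet_y (base_jet s \<epsilon> (refl_y z))"
    "base_jet s \<epsilon> z = jet_d (base_jet s \<epsilon> (refl_d z))"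
    by (simp_all add: z base_jet_def jet_x_def jet_y_def jet_d_def refl_x_def refl_y_def refl_d_def
        boundary_lift_def boundary_lift_x_def boundary_lift_y_def boundary_lift_slope_def
        flip_simps flip_axis flip_axis[of _ "- _", simplified] r c)
qed

definition symmetric_field :: "(real \<times> real \<Rightarrow> real ^ 3) \<Rightarrow> bool"
  where "symmetric_field \<phi> \<longleftrightarrow>
    (\<forall>z. \<phi> (refl_x z) = flip 2 (\<phi> z)) \<and> (\<forall>z. \<phi> (refl_y z) = flip 2 (\<phi> z)) \<and> (\<forall>z. \<phi> (refl_d z) = flip 1 (\<phi> z))"

text \<open>The reflection in the second diagonal is the one in the first diagonal composed with both reflections in the axes;
  the latter cancel on the values.\<close>

lemma symmetric_field_diagonal:
  assumes "symmetric_field \<phi>" "snd z = fst z \<or> snd z = - fst z"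
  shows "\<phi> z $ 1 = 0"
  using assms(2)
proof
  assume "snd z = fst z"
  then have "refl_d z = z" by (simp add: refl_d_def prod_eq_iff)
  then have "\<phi> z = flip 1 (\<phi> z)" using assms(1) unfolding symmetric_field_def by metis
  then have "\<phi> z $ 1 = flip 1 (\<phi> z) $ 1" by simp
  then show ?thesis by (simp add: flip_nth)
next
  assume "snd z = - fst z"
  then have "refl_d z = refl_x (refl_y z)" by (simp add: refl_d_def refl_x_def refl_y_def prod_eq_iff)
  then have "flip 1 (\<phi> z) = flip 2 (flip 2 (\<phi> z))" using assms(1) unfolding symmetric_field_def by metis
  then have "flip 1 (\<phi> z) $ 1 = \<phi> z $ 1" by (simp add: flip_simps(1))
  then show ?thesis by (simp add: flip_nth)
qed

lemma symmetric_field_axis: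
  assumes "symmetric_field \<phi>" "fst z = 0 \<or> snd z = 0"
  shows "\<phi> z $ 2 = 0"
proof -
  have "refl_x z = z \<or> refl_y z = z" using assms(2) by (auto simp: refl_x_def refl_y_def prod_eq_iff)
  then have "\<phi> z = flip 2 (\<phi> z)" using assms(1) unfolding symmetric_field_def by metis
  then have "\<phi> z $ 2 = flip 2 (\<phi> z) $ 2" by simp
  then show ?thesis by (simp add: flip_nth)
qed

text \<open>The sum over the group generated by one reflection, not divided by its order.\<close>

definition symmetrize :: "(real \<times> real \<Rightarrow> real \<times> real) \<Rightarrow> 3 \<Rightarrow> (real \<times> real \<Rightarrow> real ^ 3) \<Rightarrow> real \<times> real \<Rightarrow> real ^ 3"
  where "symmetrize T i \<phi> = (\<lambda>z. \<phi> z + flip i (\<phi> (T z)))"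

text \<open>The group is generated by the three reflections: the sum over the reflections in the axes is preserved by the
  diagonal reflection, which exchanges them.\<close>

lemma symmetric_field_symmetrize:
  "symmetric_field (symmetrize refl_d 1 (symmetrize refl_y 2 (symmetrize refl_x 2 \<phi>)))"
  unfolding symmetric_field_def
proof (intro conjI allI)
  fix z :: "real \<times> real"
  obtain x y where z: "z = (x, y)" by (cases z)
  show "symmetrize refl_d 1 (symmetrize refl_y 2 (symmetrize refl_x 2 \<phi>)) (refl_x z)
      = flip 2 (symmetrize refl_d 1 (symmetrize refl_y 2 (symmetrize refl_x 2 \<phi>)) z)"
    "symmetrize refl_d 1 (symmetrize refl_y 2 (symmetrize refl_x 2 \<phi>)) (refl_y z)
      = flip 2 (symmetrize refl_d 1 (symmetrize refl_y 2 (symmetrize refl_x 2 \<phi>)) z)"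
    "symmetrize refl_d 1 (symmetrize refl_y 2 (symmetrize refl_x 2 \<phi>)) (refl_d z)
      = flip 1 (symmetrize refl_d 1 (symmetrize refl_y 2 (symmetrize refl_x 2 \<phi>)) z)"
    by (simp_all add: z symmetrize_def refl_x_def refl_y_def refl_d_def flip_simps(1,3)
        flip_simps(2)[of 2 1] ac_simps)
qed

lemma open_Omega: "open (Omega \<epsilon>)"
proof -
  have "Omega \<epsilon> = {z. \<bar>fst z\<bar> < 1} \<inter> {z. \<bar>snd z\<bar> < 1} \<inter> {z. \<bar>fst z + snd z\<bar> < 2 - \<epsilon>} \<inter> {z. \<bar>fst z - snd z\<bar> < 2 - \<epsilon>}"
    by (auto simp: Omega_def)
  then show ?thesis by (auto intro!: open_Int open_Collect_less continuous_intros)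
qed

lemma Omega_sets: "Omega \<epsilon> \<in> sets lebesgue" "Omega \<epsilon> \<in> sets borel"
  using open_Omega by auto

lemma Omega_subset_square: "Omega \<epsilon> \<subseteq> cbox (-1, -1) (1, 1)"
  by (auto simp: Omega_def)

lemma finite_measure_Omega: "finite_measure (lebesgue_on (Omega \<epsilon>))"
proof (rule finite_measure_lebesgue_on)
  show "Omega \<epsilon> \<in> lmeasurable"
    by (rule lmeasurable_open[OF bounded_subset[OF bounded_cbox Omega_subset_square] open_Omega])
qed

lemma borel_measurable_lebesgue_on_if_borel:
  "f \<in> borel_measurable borel \<Longrightarrow> f \<in> borel_measurable (lebesgue_on S)"
  by (intro measurable_restrict_space1 measurable_completion) simp

lemma LINT_Omega_eq_integral_square:
  fixes g :: "real \<times> real \<Rightarrow> real"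
  assumes g: "continuous_on UNIV g" "\<And>z. z \<notin> Omega \<epsilon> \<Longrightarrow> g z = 0"
  shows "(LINT z|lebesgue_on (Omega \<epsilon>). g z) = integral (cbox (-1, -1) (1, 1)) g"
proof -
  have "(LINT z|lebesgue_on (Omega \<epsilon>). g z) = (LINT z|lebesgue_on (cbox (-1, -1) (1, 1)). g z)"
  proof (rule LINT_lebesgue_on_zero_outside)
    fix z assume "z \<notin> Omega \<epsilon> \<inter> cbox (-1, -1) (1, 1)"
    then have "z \<notin> Omega \<epsilon>" using Omega_subset_square by blast
    then show "g z = 0" by (rule g(2))
  qed (simp_all add: Omega_sets)
  also have "\<dots> = integral (cbox (-1, -1) (1, 1)) g"
  proof (rule lebesgue_integral_eq_integral)
    have "g absolutely_integrable_on cbox (-1, -1) (1, 1)"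
      by (intro absolutely_integrable_continuous continuous_on_subset[OF g(1)]) auto
    then show "integrable (lebesgue_on (cbox (-1, -1) (1, 1))) g"
      by (simp add: absolutely_integrable_iff_lebesgue_on)
  qed simp
  finally show ?thesis .
qed

lemma jet_zero_outside:
  assumes "test_function S \<phi>" "z \<notin> S" shows "jet \<phi> z = 0"
proof -
  obtain K where K: "compact K" "K \<subseteq> S" "\<And>z. z \<notin> K \<Longrightarrow> \<phi> z = 0"
    using assms(1) unfolding test_function_def by blast
  have "z \<notin> K" using K assms(2) by blast
  then show ?thesis
    using K(3) dir_deriv_zero_outside[OF K(1) _ \<open>z \<notin> K\<close>, of \<phi>] by (simp add: jet_def zero_prod_def)
qed

lemma bounded_measurable_jet:
  assumes "test_function S \<phi>" shows "bounded_measurable (lebesgue_on S') (jet \<phi>)"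
proof -
  obtain K where K: "smooth \<phi>" "compact K" "\<And>z. z \<notin> K \<Longrightarrow> \<phi> z = 0"
    using assms unfolding test_function_def by blast
  have "jet \<phi> z = 0" if "z \<notin> K" for z
    using K(3) dir_deriv_zero_outside[OF K(2) _ that, of \<phi>] that by (simp add: jet_def zero_prod_def)
  from test_function_bounded[OF jet_continuous[OF K(1)] K(2) this]
  obtain B where "\<And>z. norm (jet \<phi> z) \<le> B" by blast
  moreover have "jet \<phi> \<in> borel_measurable (lebesgue_on S')"
    by (intro borel_measurable_lebesgue_on_if_borel borel_measurable_continuous_onI jet_continuous K)
  ultimately show ?thesis by (auto simp: bounded_measurable_def)
qed

lemma base_jet_measurable: "\<epsilon> > 0 \<Longrightarrow> base_jet s \<epsilon> \<in> borel_measurable borel"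
  unfolding base_jet_def[abs_def]
  by (intro borel_measurable_Pair boundary_lift_xy_measurable borel_measurable_continuous_onI boundary_lift_continuous)

lemma bounded_measurable_base_jet:
  assumes "\<epsilon> > 0" shows "bounded_measurable (lebesgue_on S) (base_jet s \<epsilon>)"
proof -
  have "norm (base_jet s \<epsilon> z) \<le> (\<bar>s / 2\<bar> + \<bar>s / 6\<bar>) + (\<bar>s / (2 * \<epsilon>)\<bar> + \<bar>s / (2 * \<epsilon>)\<bar>)" for z
  proof -
    have ramp: "\<bar>ramp \<epsilon> r\<bar> \<le> 1" for r by (auto simp: ramp_def)
    have "norm (boundary_lift s \<epsilon> z) \<le> \<bar>s / 2\<bar> + \<bar>s / 6\<bar>"
    proof -
      have "\<bar>s / 2 * ramp \<epsilon> (\<bar>snd z\<bar> - \<bar>fst z\<bar>)\<bar> \<le> \<bar>s / 2\<bar>"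
        using mult_left_mono[OF ramp, of "\<bar>s / 2\<bar>"] by (simp only: abs_mult mult_1_right abs_ge_zero)
      then show ?thesis
        unfolding boundary_lift_def case_prod_beta
        by (intro norm_triangle_le add_mono) (simp_all add: norm_axis_1)
    qed
    then show ?thesis
      unfolding base_jet_def using boundary_lift_xy_bounded[of s \<epsilon> z]
      by (intro order_trans[OF norm_Pair_le] add_mono) auto
  qed
  then show ?thesis
    using borel_measurable_lebesgue_on_if_borel[OF base_jet_measurable[OF assms]]
    unfolding bounded_measurable_def by blast
qed

lemma C1_plane_component:
  assumes "smooth \<phi>"
  shows "C1_plane (\<lambda>z. \<phi> z $ k) (\<lambda>z. dir_deriv (1, 0) \<phi> z $ k) (\<lambda>z. dir_deriv (0, 1) \<phi> z $ k)"
proof -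
  have line: "((\<lambda>t. \<phi> (p t) $ k) has_real_derivative dir_deriv e \<phi> (p t) $ k) (at t)"
    if p: "(p has_derivative (\<lambda>h. h *\<^sub>R e)) (at t)" for p e t
  proof -
    have "((\<lambda>t. \<phi> (p t) $ k) has_derivative (\<lambda>h. dir_deriv (h *\<^sub>R e) \<phi> (p t) $ k)) (at t)"
      by (intro has_derivative_vec_nth has_derivative_compose[OF p smooth_has_derivative[OF assms]])
    then show ?thesis
      unfolding has_field_derivative_def
      by (rule has_derivative_eq_rhs)
        (simp add: fun_eq_iff linear_scale[OF has_derivative_linear[OF smooth_has_derivative[OF assms]]])
  qed
  show ?thesis
    unfolding C1_plane_def
  proof (intro conjI allI)
    fix x y :: real
    show "((\<lambda>x. \<phi> (x, y) $ k) has_real_derivative dir_deriv (1, 0) \<phi> (x, y) $ k) (at x)"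
      by (rule line) (auto intro!: derivative_eq_intros)
    show "((\<lambda>y. \<phi> (x, y) $ k) has_real_derivative dir_deriv (0, 1) \<phi> (x, y) $ k) (at y)"
      by (rule line) (auto intro!: derivative_eq_intros)
  qed (intro continuous_intros smooth_continuous smooth_dir_deriv assms)+
qed

lemma norm_jet_power2: "(norm (jet \<phi> z))\<^sup>2 =
    (norm (\<phi> z))\<^sup>2 + (norm (dir_deriv (1, 0) \<phi> z))\<^sup>2 + (norm (dir_deriv (0, 1) \<phi> z))\<^sup>2"
  by (simp add: jet_def norm_power2_Pair)

text \<open>Test functions vanish outside the domain, so that they may be treated as functions on the surrounding square.\<close>

lemma Rellich_test_functions:
  fixes \<phi> :: "nat \<Rightarrow> real \<times> real \<Rightarrow> real ^ 3"
  assumes \<phi>: "\<And>n. test_function (Omega \<epsilon>) (\<phi> n)"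
    and bound: "\<And>n. (LINT z|lebesgue_on (Omega \<epsilon>). (norm (jet (\<phi> n) z))\<^sup>2) \<le> K"
  shows "\<exists>r :: nat \<Rightarrow> nat. strict_mono r \<and> (\<forall>e>0. \<exists>N. \<forall>m\<ge>N. \<forall>n\<ge>N.
    (LINT z|lebesgue_on (Omega \<epsilon>). (norm (\<phi> (r m) z - \<phi> (r n) z))\<^sup>2) < e)"
proof -
  let ?Q = "cbox (-1, -1) (1, 1) :: (real \<times> real) set"
  let ?M = "lebesgue_on (Omega \<epsilon>)"
  have s: "smooth (\<phi> n)" for n using \<phi> test_function_smooth by blast
  have z0: "\<phi> n z = 0" "dir_deriv (1, 0) (\<phi> n) z = 0" "dir_deriv (0, 1) (\<phi> n) z = 0" if "z \<notin> Omega \<epsilon>" for n z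
    using jet_zero_outside[OF \<phi> that] by (simp_all add: jet_def zero_prod_def)
  have c: "continuous_on UNIV (\<phi> n)" "continuous_on UNIV (dir_deriv e (\<phi> n))" for n e
    using s by (auto intro: smooth_continuous smooth_dir_deriv)
  have component: "(x $ k)\<^sup>2 \<le> (norm x)\<^sup>2" for x :: "real ^ 3" and k
    using power_mono[OF component_le_norm_cart[of x k] abs_ge_zero, of 2] by simp
  have ji: "integrable ?M (\<lambda>z. (norm (jet (\<phi> n) z))\<^sup>2)" for n
    by (intro bounded_measurable_integrable[OF finite_measure_Omega bounded_measurable_jet[OF \<phi>]] continuous_intros)
  have b: "integral ?Q g \<le> K"
    if g: "continuous_on UNIV g" "\<And>z. z \<notin> Omega \<epsilon> \<Longrightarrow> g z = 0" "\<And>z. 0 \<le> g z" "\<And>z. g z \<le> (norm (jet (\<phi> n) z))\<^sup>2" for g n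
  proof -
    have "integral ?Q g = (LINT z|?M. g z)" using LINT_Omega_eq_integral_square[OF g(1,2)] by simp
    also have "\<dots> \<le> (LINT z|?M. (norm (jet (\<phi> n) z))\<^sup>2)"
    proof (rule integral_mono)
      show "integrable ?M g"
      proof (rule Bochner_Integration.integrable_bound[OF ji[of n]])
        show "g \<in> borel_measurable ?M"
          by (intro borel_measurable_lebesgue_on_if_borel borel_measurable_continuous_onI g)
        show "AE z in ?M. norm (g z) \<le> norm ((norm (jet (\<phi> n) z))\<^sup>2)"
        proof (intro AE_I2)
          fix z show "norm (g z) \<le> norm ((norm (jet (\<phi> n) z))\<^sup>2)" using g(3,4)[of z] by simp
        qed
      qed
    qed (use ji g(4) in blast)+
    finally show ?thesis using bound[of n] by simp
  qed
  have C1: "C1_plane (\<lambda>z. \<phi> n z $ k) (\<lambda>z. dir_deriv (1, 0) (\<phi> n) z $ k) (\<lambda>z. dir_deriv (0, 1) (\<phi> n) z $ k)" for n k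
      by (rule C1_plane_component[OF s])
  have b0: "integral ?Q (\<lambda>z. (\<phi> n z $ k)\<^sup>2) \<le> K" for n k
    proof (rule b)
      show "(\<phi> n z $ k)\<^sup>2 \<le> (norm (jet (\<phi> n) z))\<^sup>2" for z
        unfolding norm_jet_power2 using component[of "\<phi> n z" k] by (simp add: add_increasing2)
    qed (auto intro!: continuous_intros c simp: z0)
  have b1: "integral ?Q (\<lambda>z. (dir_deriv (1, 0) (\<phi> n) z $ k)\<^sup>2 + (dir_deriv (0, 1) (\<phi> n) z $ k)\<^sup>2) \<le> K" for n k
    proof (rule b)
      show "(dir_deriv (1, 0) (\<phi> n) z $ k)\<^sup>2 + (dir_deriv (0, 1) (\<phi> n) z $ k)\<^sup>2 \<le> (norm (jet (\<phi> n) z))\<^sup>2" for z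
        unfolding norm_jet_power2
        using component[of "dir_deriv (1, 0) (\<phi> n) z" k] component[of "dir_deriv (0, 1) (\<phi> n) z" k] zero_le_power2[of "norm (\<phi> n z)"]
        by linarith
    qed (auto intro!: continuous_intros c simp: z0)
  obtain r :: "nat \<Rightarrow> nat" where r: "strict_mono r"
    and rc: "\<And>e. e > 0 \<Longrightarrow> \<exists>N. \<forall>m\<ge>N. \<forall>n\<ge>N. \<forall>k. integral ?Q (\<lambda>z. (\<phi> (r m) z $ k - \<phi> (r n) z $ k)\<^sup>2) < e"
    by (rule Rellich_square[where w = "\<lambda>n k z. \<phi> n z $ k" and wx = "\<lambda>n k z. dir_deriv (1, 0) (\<phi> n) z $ k"
        and wy = "\<lambda>n k z. dir_deriv (0, 1) (\<phi> n) z $ k" and K = K, OF C1 b0 b1], rule that)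
  have "\<exists>N. \<forall>m\<ge>N. \<forall>n\<ge>N. (LINT z|?M. (norm (\<phi> (r m) z - \<phi> (r n) z))\<^sup>2) < e" if "e > 0" for e
  proof -
    obtain N where N: "\<And>m n k. m \<ge> N \<Longrightarrow> n \<ge> N \<Longrightarrow> integral ?Q (\<lambda>z. (\<phi> (r m) z $ k - \<phi> (r n) z $ k)\<^sup>2) < e / 3"
    proof -
      have "0 < e / 3" using \<open>e > 0\<close> by simp
      from rc[OF this] obtain N where "\<forall>m\<ge>N. \<forall>n\<ge>N. \<forall>k. integral ?Q (\<lambda>z. (\<phi> (r m) z $ k - \<phi> (r n) z $ k)\<^sup>2) < e / 3" ..
      then show ?thesis by (intro that[of N]) simp
    qed
    have "(LINT z|?M. (norm (\<phi> (r m) z - \<phi> (r n) z))\<^sup>2) < e" if "m \<ge> N" "n \<ge> N" for m n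
    proof -
      let ?d = "\<lambda>k z. (\<phi> (r m) z $ k - \<phi> (r n) z $ k)\<^sup>2"
      have cd: "continuous_on UNIV (?d k)" for k by (intro continuous_intros c)
      have id: "?d k integrable_on ?Q" for k by (intro integrable_continuous continuous_on_subset[OF cd]) auto
      have "(LINT z|?M. (norm (\<phi> (r m) z - \<phi> (r n) z))\<^sup>2) = integral ?Q (\<lambda>z. (norm (\<phi> (r m) z - \<phi> (r n) z))\<^sup>2)"
        by (rule LINT_Omega_eq_integral_square) (auto intro!: continuous_intros c simp: z0)
      also have "\<dots> = integral ?Q (\<lambda>z. ?d 1 z + ?d 2 z + ?d 3 z)"
        by (simp add: norm_power2_vec3)
      also have "\<dots> = integral ?Q (?d 1) + integral ?Q (?d 2) + integral ?Q (?d 3)"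
        using id by (simp add: integral_add integrable_add)
      finally show ?thesis using N[OF that, of 1] N[OF that, of 2] N[OF that, of 3] by simp
    qed
    then show ?thesis by blast
  qed
  with r show ?thesis by blast
qed

text \<open>Substitute \<open>T z\<close> for \<open>z\<close>: as the field is invariant, its jet at \<open>z\<close> is the transformed jet at \<open>T z\<close>.\<close>

lemma first_variation_act:
  fixes A B C L L2 lam s \<epsilon> :: real and T :: "real \<times> real \<Rightarrow> real \<times> real"
  defines "dF \<equiv> energy_deriv A B C L L2 lam"
  assumes "\<epsilon> > 0" and dF: "continuous_on UNIV (\<lambda>(w, k). dF w k)"
    and T: "bounded_linear T" "distr lborel borel T = lborel" "\<And>z. T z \<in> Omega \<epsilon> \<longleftrightarrow> z \<in> Omega \<epsilon>"
    and act: "\<And>\<eta> z. smooth \<eta> \<Longrightarrow> jet (\<lambda>z. flip i (\<eta> (T z))) z = \<tau> (jet \<eta> (T z))"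
    and inv: "\<And>w k. dF (\<tau> w) (\<tau> k) = dF w k"
    and add: "\<And>w k. \<tau> (w + k) = \<tau> w + \<tau> k"
    and base: "\<And>z. base_jet s \<epsilon> z = \<tau> (base_jet s \<epsilon> (T z))"
    and \<phi>: "smooth \<phi>" "\<And>z. \<phi> (T z) = flip i (\<phi> z)" and \<psi>: "smooth \<psi>"
  shows "(LINT z|lebesgue_on (Omega \<epsilon>). dF (base_jet s \<epsilon> z + jet \<phi> z) (jet (\<lambda>z. flip i (\<psi> (T z))) z))
    = (LINT z|lebesgue_on (Omega \<epsilon>). dF (base_jet s \<epsilon> z + jet \<phi> z) (jet \<psi> z))"
proof -
  define f where "f z = dF (base_jet s \<epsilon> z + jet \<phi> z) (jet \<psi> z)" for z
  have "(\<lambda>z. flip i (\<phi> (T z))) = \<phi>" using \<phi>(2) by (simp add: flip_simps(1))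
  then have jet\<phi>: "jet \<phi> z = \<tau> (jet \<phi> (T z))" for z using act[OF \<phi>(1), of z] by simp
  have eq: "dF (base_jet s \<epsilon> z + jet \<phi> z) (jet (\<lambda>z. flip i (\<psi> (T z))) z) = f (T z)" for z
    unfolding f_def act[OF \<psi>] by (subst base, subst jet\<phi>) (simp only: add[symmetric] inv)
  have jm: "jet \<eta> \<in> borel_measurable borel" if "smooth \<eta>" for \<eta>
    by (intro borel_measurable_continuous_onI jet_continuous that)
  have fm: "f \<in> borel_measurable borel"
  proof -
    have "(\<lambda>z. (base_jet s \<epsilon> z + jet \<phi> z, jet \<psi> z)) \<in> borel_measurable borel"
      by (intro borel_measurable_Pair borel_measurable_add base_jet_measurable jm assms)
    from measurable_compose[OF this borel_measurable_continuous_onI[OF dF]]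
    show ?thesis by (simp add: f_def[abs_def])
  qed
  have Tm: "T \<in> borel_measurable borel"
    by (intro borel_measurable_continuous_onI linear_continuous_on T(1))
  have "(LINT z|lebesgue_on (Omega \<epsilon>). f (T z)) = (LINT z|lebesgue_on (Omega \<epsilon>). f z)"
    by (rule LINT_change_of_variables[OF Omega_sets(2) fm Tm T(2,3)])
  then show ?thesis unfolding eq f_def .
qed

lemma jet_symmetry_add: "jet_x (w + k) = jet_x w + jet_x k" "jet_y (w + k) = jet_y w + jet_y k" "jet_d (w + k) = jet_d w + jet_d k"
  by (simp_all add: jet_x_def jet_y_def jet_d_def case_prod_beta flip_simps)

lemma test_function_symmetrize:
  assumes "bounded_linear T" "\<And>z. T (T z) = z" "\<And>z. T z \<in> S \<longleftrightarrow> z \<in> S" "test_function S \<psi>"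
  shows "test_function S (symmetrize T i \<psi>)"
  unfolding symmetrize_def
  by (intro test_function_add test_function_act[OF _ _ _ bounded_linear_flip] assms)

text \<open>The first variation is linear in the direction and does not distinguish a direction from its reflection.\<close>

lemma first_variation_symmetrize:
  fixes A B C L L2 lam s \<epsilon> :: real
  defines "dF \<equiv> energy_deriv A B C L L2 lam"
  assumes "\<epsilon> > 0" and dF: "continuous_on UNIV (\<lambda>(w, k). dF w k)"
    and \<phi>: "test_function (Omega \<epsilon>) \<phi>" "symmetric_field \<phi>" and \<psi>: "test_function (Omega \<epsilon>) \<psi>"
    and T: "(T, i) \<in> {(refl_x, 2), (refl_y, 2), (refl_d, 1)}"
  shows "(LINT z|lebesgue_on (Omega \<epsilon>). dF (base_jet s \<epsilon> z + jet \<phi> z) (jet (symmetrize T i \<psi>) z))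
    = 2 * (LINT z|lebesgue_on (Omega \<epsilon>). dF (base_jet s \<epsilon> z + jet \<phi> z) (jet \<psi> z))"
proof -
  let ?M = "lebesgue_on (Omega \<epsilon>)" and ?j = "\<lambda>z. base_jet s \<epsilon> z + jet \<phi> z"
  have s: "smooth \<phi>" "smooth \<psi>" using \<phi>(1) \<psi> test_function_smooth by auto
  have lin: "dF w (k + k') = dF w k + dF w k'" for w k k'
    unfolding dF_def by (rule linear_add[OF has_derivative_linear[OF energy_density_has_derivative]])
  have Tl: "bounded_linear T" "\<And>z. T (T z) = z" "\<And>z. T z \<in> Omega \<epsilon> \<longleftrightarrow> z \<in> Omega \<epsilon>"
    using T bounded_linear_reflections refl_involution refl_Omega by auto
  have act_test: "test_function (Omega \<epsilon>) (\<lambda>z. flip i (\<psi> (T z)))"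
    by (rule test_function_act[OF Tl bounded_linear_flip \<psi>])
  have int: "integrable ?M (\<lambda>z. dF (?j z) (jet \<eta> z))" if "test_function (Omega \<epsilon>) \<eta>" for \<eta>
    using bounded_measurable_integrable[OF finite_measure_Omega bounded_measurable_Pair[OF
        bounded_measurable_add[OF bounded_measurable_base_jet[OF \<open>\<epsilon> > 0\<close>] bounded_measurable_jet[OF \<phi>(1)]]
        bounded_measurable_jet[OF that]] dF] by simp
  have sym: "\<And>z. \<phi> (refl_x z) = flip 2 (\<phi> z)" "\<And>z. \<phi> (refl_y z) = flip 2 (\<phi> z)" "\<And>z. \<phi> (refl_d z) = flip 1 (\<phi> z)"
    using \<phi>(2) by (auto simp: symmetric_field_def)
  have "(LINT z|?M. dF (?j z) (jet (\<lambda>z. flip i (\<psi> (T z))) z)) = (LINT z|?M. dF (?j z) (jet \<psi> z))"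
  proof -
    consider "T = refl_x" "i = 2" | "T = refl_y" "i = 2" | "T = refl_d" "i = 1" using T by auto
    then show ?thesis
    proof cases
      case 1
      show ?thesis unfolding 1 dF_def
        by (rule first_variation_act[OF \<open>\<epsilon> > 0\<close> dF[unfolded dF_def] bounded_linear_reflections(1) distr_reflections(1) refl_Omega(1)
              jet_act(1) energy_deriv_jet_symmetry(1) jet_symmetry_add(1) base_jet_symmetry(1) s(1) sym(1) s(2)])
    next
      case 2
      show ?thesis unfolding 2 dF_def
        by (rule first_variation_act[OF \<open>\<epsilon> > 0\<close> dF[unfolded dF_def] bounded_linear_reflections(2) distr_reflections(2) refl_Omega(2)
              jet_act(2) energy_deriv_jet_symmetry(2) jet_symmetry_add(2) base_jet_symmetry(2) s(1) sym(2) s(2)])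
    next
      case 3
      show ?thesis unfolding 3 dF_def
        by (rule first_variation_act[OF \<open>\<epsilon> > 0\<close> dF[unfolded dF_def] bounded_linear_reflections(3) distr_reflections(3) refl_Omega(3)
              jet_act(3) energy_deriv_jet_symmetry(3) jet_symmetry_add(3) base_jet_symmetry(3) s(1) sym(3) s(2)])
    qed
  qed
  moreover have "jet (symmetrize T i \<psi>) z = jet \<psi> z + jet (\<lambda>z. flip i (\<psi> (T z))) z" for z
    unfolding symmetrize_def by (rule jet_add[OF s(2) test_function_smooth[OF act_test]])
  ultimately show ?thesis
    using int[OF \<psi>] int[OF act_test] by (simp add: lin)
qed

section \<open>Existence of a symmetric critical point\<close>

theorem proposition3p2:
  fixes A B C L L2 \<epsilon> :: real
  assumes "A < 0" "B > 0" "C > 0" "L > 0" "L2 > -1" "0 < \<epsilon>" "\<epsilon> < 1"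
  shows "\<forall>lam>0. \<exists>q :: real \<times> real \<Rightarrow> real ^ 3.
    critical_point_J A B C L L2 lam \<epsilon> q \<and>
    has_trace (Omega \<epsilon>) (diagonals \<epsilon>) (\<lambda>z. q z $ 1) (\<lambda>_. 0) \<and>
    has_trace (Omega \<epsilon>) axes (\<lambda>z. q z $ 2) (\<lambda>_. 0)"
proof (intro allI impI)
  fix lam :: real assume lam: "lam > 0"
  define s where "s = s_plus A B C"
  let ?F = "energy_density A B C L L2 lam" and ?dF = "energy_deriv A B C L L2 lam"
  let ?\<Omega> = "Omega \<epsilon>" and ?M = "lebesgue_on (Omega \<epsilon>)"
  obtain c K where "quartic_energy ?F ?dF c K"
    using quartic_energy_energy_density[OF assms(1-5) lam] .
  then interpret quartic_energy ?F ?dF c K .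
  \<comment> \<open>The symmetric test functions; their jets form the space of variations.\<close>
  define \<V> where "\<V> = {\<phi>. test_function ?\<Omega> \<phi> \<and> symmetric_field \<phi>}"
  have V_smooth: "smooth \<phi>" if "\<phi> \<in> \<V>" for \<phi> using that test_function_smooth by (auto simp: \<V>_def)
  have zero: "(\<lambda>_. 0) \<in> \<V>"
    by (auto simp: \<V>_def symmetric_field_def flip_def vec_eq_iff intro: test_functionI[where K = "{}"] smooth_const)
  have add: "(\<lambda>z. \<phi> z + \<psi> z) \<in> \<V>" if "\<phi> \<in> \<V>" "\<psi> \<in> \<V>" for \<phi> \<psi>
    using that by (auto simp: \<V>_def symmetric_field_def flip_simps(3) intro: test_function_add)
  have scale: "(\<lambda>z. t *\<^sub>R \<phi> z) \<in> \<V>" if "\<phi> \<in> \<V>" for \<phi> t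
  proof -
    have "test_function ?\<Omega> \<phi>" using that by (simp add: \<V>_def)
    then obtain K where K: "compact K" "K \<subseteq> ?\<Omega>" "\<And>z. z \<notin> K \<Longrightarrow> \<phi> z = 0"
      unfolding test_function_def by blast
    have "test_function ?\<Omega> (\<lambda>z. t *\<^sub>R \<phi> z)"
      by (rule test_functionI[OF smooth_scaleR[OF V_smooth[OF that]] K(1,2)]) (simp add: K(3))
    then show ?thesis
      using that by (auto simp: \<V>_def symmetric_field_def linear_scale[OF bounded_linear.linear[OF bounded_linear_flip]])
  qed
  have choose: "\<exists>\<phi>. \<forall>n. \<phi> n \<in> \<V> \<and> ks n = jet (\<phi> n)"
    if "\<And>n. ks n \<in> jet ` \<V>" for ks :: "nat \<Rightarrow> real \<times> real \<Rightarrow> jet"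
    by (rule choice) (use that in blast)
  obtain ks j where ks: "\<And>n. ks n \<in> jet ` \<V>" and j: "square_integrable ?M j"
    and lim: "(\<lambda>n. LINT z|?M. (norm (base_jet s \<epsilon> z + ks n z - j z))\<^sup>2) \<longlonglongrightarrow> 0"
    and stat: "\<And>k. k \<in> jet ` \<V> \<Longrightarrow> (\<lambda>n. LINT z|?M. ?dF (base_jet s \<epsilon> z + ks n z) (k z)) \<longlonglongrightarrow> 0"
    and conv: "\<And>k. bounded_measurable ?M k \<Longrightarrow> integrable ?M (\<lambda>z. ?dF (j z) (k z)) \<and>
      (\<lambda>n. LINT z|?M. ?dF (base_jet s \<epsilon> z + ks n z) (k z)) \<longlonglongrightarrow> (LINT z|?M. ?dF (j z) (k z))"
  proof (rule direct_method[OF finite_measure_Omega bounded_measurable_base_jet[OF assms(6)], of "jet ` \<V>" \<epsilon> s], goal_cases)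
    case (1 k)
    then show ?case by (auto simp: \<V>_def intro: bounded_measurable_jet)
  next
    case 2
    have "jet (\<lambda>_. 0) = (\<lambda>_. 0)"
      using jet_scaleR[OF V_smooth[OF zero], of 0] by (auto simp: fun_eq_iff)
    then show ?case using zero by (metis imageI)
  next
    case (3 k k')
    then obtain \<phi> \<psi> where "k = jet \<phi>" "k' = jet \<psi>" "\<phi> \<in> \<V>" "\<psi> \<in> \<V>" by auto
    then show ?case
      using jet_add[OF V_smooth V_smooth, of \<phi> \<psi>] add by (intro image_eqI[where x = "\<lambda>z. \<phi> z + \<psi> z"]) (auto simp: fun_eq_iff)
  next
    case (4 k t)
    then obtain \<phi> where "k = jet \<phi>" "\<phi> \<in> \<V>" by auto
    then show ?case
      using jet_scaleR[OF V_smooth, of \<phi>] scale by (intro image_eqI[where x = "\<lambda>z. t *\<^sub>R \<phi> z"]) (auto simp: fun_eq_iff)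
  next
    case (5 ks K)
    from choose[OF 5(2)] obtain \<phi> where \<phi>': "\<forall>n. \<phi> n \<in> \<V> \<and> ks n = jet (\<phi> n)" ..
    then have ks: "ks = (\<lambda>n. jet (\<phi> n))" by auto
    have \<phi>: "test_function ?\<Omega> (\<phi> n)" for n using \<phi>' by (simp add: \<V>_def)
    have "fst (jet (\<phi> n) z) = \<phi> n z" for n z by (simp add: jet_def)
    then show ?case
      using Rellich_test_functions[of \<epsilon> \<phi> K, OF \<phi> 5(3)[unfolded ks]] unfolding ks by simp
  next
    case (6 ks j)
    show ?case by (rule 6(1)[OF 6(2-6)])
  qed
  from choose[OF ks] obtain \<phi> where \<phi>': "\<forall>n. \<phi> n \<in> \<V> \<and> ks n = jet (\<phi> n)" ..
  have \<phi>V: "\<phi> n \<in> \<V>" and ks_eq: "ks n = jet (\<phi> n)" for n using \<phi>' by auto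
  have \<phi>: "test_function ?\<Omega> (\<phi> n)" "symmetric_field (\<phi> n)" for n using \<phi>V by (auto simp: \<V>_def)
  have lim: "(\<lambda>n. LINT z|?M. (norm ((base_jet s \<epsilon> z + jet (\<phi> n) z) - j z))\<^sup>2) \<longlonglongrightarrow> 0"
    using lim by (simp add: ks_eq)

  \<comment> \<open>Symmetric criticality: three successive symmetrizations multiply the first variation by \<open>8\<close> and lead to a symmetric direction.\<close>
  have EL: "(LINT z|?M. ?dF (j z) (jet \<psi> z)) = 0" if \<psi>: "test_function ?\<Omega> \<psi>" for \<psi>
  proof -
    define \<psi>1 \<psi>2 \<psi>3 where "\<psi>1 = symmetrize refl_x 2 \<psi>" and "\<psi>2 = symmetrize refl_y 2 \<psi>1" and "\<psi>3 = symmetrize refl_d 1 \<psi>2"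
    have t1: "test_function ?\<Omega> \<psi>1" unfolding \<psi>1_def
      by (rule test_function_symmetrize[OF bounded_linear_reflections(1) refl_involution(1) refl_Omega(1) \<psi>])
    have t2: "test_function ?\<Omega> \<psi>2" unfolding \<psi>2_def
      by (rule test_function_symmetrize[OF bounded_linear_reflections(2) refl_involution(2) refl_Omega(2) t1])
    have t3: "test_function ?\<Omega> \<psi>3" unfolding \<psi>3_def
      by (rule test_function_symmetrize[OF bounded_linear_reflections(3) refl_involution(3) refl_Omega(3) t2])
    have "\<psi>3 \<in> \<V>" using t3 symmetric_field_symmetrize[of \<psi>] by (simp add: \<V>_def \<psi>1_def \<psi>2_def \<psi>3_def)
    then have "(\<lambda>n. LINT z|?M. ?dF (base_jet s \<epsilon> z + jet (\<phi> n) z) (jet \<psi>3 z)) \<longlonglongrightarrow> 0"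
      using stat[of "jet \<psi>3"] by (simp add: ks_eq)
    moreover have "(LINT z|?M. ?dF (base_jet s \<epsilon> z + jet (\<phi> n) z) (jet \<psi>3 z))
      = 8 * (LINT z|?M. ?dF (base_jet s \<epsilon> z + jet (\<phi> n) z) (jet \<psi> z))" for n
      unfolding \<psi>3_def first_variation_symmetrize[OF assms(6) continuous_deriv \<phi> t2, of refl_d 1, simplified]
      unfolding \<psi>2_def first_variation_symmetrize[OF assms(6) continuous_deriv \<phi> t1, of refl_y 2, simplified]
      unfolding \<psi>1_def first_variation_symmetrize[OF assms(6) continuous_deriv \<phi> \<psi>, of refl_x 2, simplified]
      by simp
    ultimately have "(\<lambda>n. 8 * (LINT z|?M. ?dF (base_jet s \<epsilon> z + jet (\<phi> n) z) (jet \<psi> z))) \<longlonglongrightarrow> 0" by simp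
    moreover have "(\<lambda>n. 8 * (LINT z|?M. ?dF (base_jet s \<epsilon> z + jet (\<phi> n) z) (jet \<psi> z))) \<longlonglongrightarrow> 8 * (LINT z|?M. ?dF (j z) (jet \<psi> z))"
      using conv[OF bounded_measurable_jet[OF \<psi>]] by (intro tendsto_mult_left) (simp add: ks_eq)
    ultimately have "8 * (LINT z|?M. ?dF (j z) (jet \<psi> z)) = 0" by (rule LIMSEQ_unique[rotated])
    then show ?thesis by simp
  qed

  \<comment> \<open>The components of the limit jet are a field and its weak derivatives, since the latter are preserved by \<open>L\<^sup>2\<close> limits.\<close>
  define q qx qy where "q z = fst (j z)" and "qx z = fst (snd (j z))" and "qy z = snd (snd (j z))" for z
  define u ux uy where "u n z = boundary_lift s \<epsilon> z + \<phi> n z" and "ux n z = boundary_lift_x s \<epsilon> z + dir_deriv (1, 0) (\<phi> n) z"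
    and "uy n z = boundary_lift_y s \<epsilon> z + dir_deriv (0, 1) (\<phi> n) z" for n z
  have jn: "base_jet s \<epsilon> z + jet (\<phi> n) z = (u n z, ux n z, uy n z)" for n z
    by (simp add: base_jet_def jet_def u_def ux_def uy_def)
  have jn_sq: "square_integrable ?M (\<lambda>z. (u n z, ux n z, uy n z))" for n
  proof -
    have b: "bounded_measurable ?M (\<lambda>z. (u n z, ux n z, uy n z))"
      unfolding jn[symmetric]
      by (rule bounded_measurable_add[OF bounded_measurable_base_jet[OF assms(6)] bounded_measurable_jet[OF \<phi>(1)]])
    have "continuous_on UNIV (\<lambda>x :: jet. (norm x)\<^sup>2)" by (intro continuous_intros)
    from bounded_measurable_integrable[OF finite_measure_Omega b this] b
    show ?thesis by (simp add: square_integrable_def bounded_measurable_def)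
  qed
  note wd_u = has_weak_deriv_add[OF Omega_sets(1) boundary_lift_has_weak_deriv(1)[OF assms(6) Omega_sets(1)]
      test_function_has_weak_deriv[OF Omega_sets(1) _ \<phi>(1)]]
    and wd_v = has_weak_deriv_add[OF Omega_sets(1) boundary_lift_has_weak_deriv(2)[OF assms(6) Omega_sets(1)]
      test_function_has_weak_deriv[OF Omega_sets(1) _ \<phi>(1)]]
  have wdx: "has_weak_deriv ?\<Omega> (1, 0) (u n) (ux n)" and wdy: "has_weak_deriv ?\<Omega> (0, 1) (u n) (uy n)" for n
    using wd_u wd_v by (simp_all add: u_def[abs_def] ux_def[abs_def] uy_def[abs_def] Basis_real_prod)

  have lim_jet: "(\<lambda>n. LINT z|?M. (norm ((u n z, ux n z, uy n z) - j z))\<^sup>2) \<longlonglongrightarrow> 0"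
    using lim by (simp add: jn)
  have L2: "square_integrable ?M (\<lambda>z. P (u n z, ux n z, uy n z))" "square_integrable ?M (\<lambda>z. P (j z))"
    "(\<lambda>n. LINT z|?M. (norm (P (u n z, ux n z, uy n z) - P (j z)))\<^sup>2) \<longlonglongrightarrow> 0"
    if "bounded_linear P" "\<And>x. norm (P x) \<le> norm x" for P :: "jet \<Rightarrow> 'b::euclidean_space" and n
    using L2_limit_contraction[OF that jn_sq j lim_jet] by auto
  have fst_le: "norm (fst w) \<le> norm w" and snd_le: "norm (snd w) \<le> norm w" for w :: "'c::euclidean_space \<times> 'd::euclidean_space"
    by (metis norm_fst_le prod.collapse) (metis norm_snd_le prod.collapse)
  have P: "bounded_linear (\<lambda>w :: jet. fst w)" "\<And>w :: jet. norm (fst w) \<le> norm w"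
    "bounded_linear (\<lambda>w :: jet. fst (snd w))" "\<And>w :: jet. norm (fst (snd w)) \<le> norm w"
    "bounded_linear (\<lambda>w :: jet. snd (snd w))" "\<And>w :: jet. norm (snd (snd w)) \<le> norm w"
    by (rule bounded_linear_fst fst_le bounded_linear_compose[OF bounded_linear_fst bounded_linear_snd]
        bounded_linear_compose[OF bounded_linear_snd bounded_linear_snd]
        order_trans[OF fst_le snd_le] order_trans[OF snd_le snd_le])+
  have sq: "square_integrable ?M (u n)" "square_integrable ?M (ux n)" "square_integrable ?M (uy n)"
    "square_integrable ?M q" "square_integrable ?M qx" "square_integrable ?M qy" for n
    using L2(1)[OF P(1,2), of n] L2(1)[OF P(3,4), of n] L2(1)[OF P(5,6), of n]
      L2(2)[OF P(1,2)] L2(2)[OF P(3,4)] L2(2)[OF P(5,6)]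
    by (simp_all add: q_def[abs_def] qx_def[abs_def] qy_def[abs_def])
  have lims: "(\<lambda>n. LINT z|?M. (norm (u n z - q z))\<^sup>2) \<longlonglongrightarrow> 0"
    "(\<lambda>n. LINT z|?M. (norm (ux n z - qx z))\<^sup>2) \<longlonglongrightarrow> 0" "(\<lambda>n. LINT z|?M. (norm (uy n z - qy z))\<^sup>2) \<longlonglongrightarrow> 0"
    using L2(3)[OF P(1,2)] L2(3)[OF P(3,4)] L2(3)[OF P(5,6)] by (simp_all add: q_def qx_def qy_def)
  have wdq: "has_weak_deriv ?\<Omega> (1, 0) q qx" "has_weak_deriv ?\<Omega> (0, 1) q qy"
    by (rule has_weak_deriv_L2_limit[OF Omega_sets(1) finite_measure_Omega wdx sq(1,4) sq(2,5) lims(1,2)],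
        rule has_weak_deriv_L2_limit[OF Omega_sets(1) finite_measure_Omega wdy sq(1,4) sq(3,6) lims(1,3)])
  have cont: "continuous_on S (u n)" for S n
    unfolding u_def[abs_def]
    by (intro continuous_intros boundary_lift_continuous assms smooth_continuous V_smooth \<phi>V)
  have trace: "has_trace ?\<Omega> \<Gamma> (\<lambda>z. T (q z)) g"
    if T: "bounded_linear T" "\<And>x. norm (T x) \<le> norm x"
      and eq: "\<And>a b n t. (a, b) \<in> \<Gamma> \<Longrightarrow> t \<in> {0..1} \<Longrightarrow> T (u n (linepath a b t)) = g (linepath a b t)"
    for T :: "real ^ 3 \<Rightarrow> 'b::euclidean_space" and \<Gamma> g
    by (rule has_trace_limit[OF open_Omega has_weak_deriv_bounded_linear[OF T(1) Omega_sets(1) wdx]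
          has_weak_deriv_bounded_linear[OF T(1) Omega_sets(1) wdq(1)]
          has_weak_deriv_bounded_linear[OF T(1) Omega_sets(1) wdy]
          has_weak_deriv_bounded_linear[OF T(1) Omega_sets(1) wdq(2)]
          L2_limit_contraction(1)[OF T sq(1,4) lims(1)] L2_limit_contraction(1)[OF T sq(2,5) lims(2)]
          L2_limit_contraction(1)[OF T sq(3,6) lims(3)]
          L2_limit_contraction(2)[OF T sq(1,4) lims(1)] L2_limit_contraction(2)[OF T sq(2,5) lims(2)]
          L2_limit_contraction(2)[OF T sq(3,6) lims(3)]
          L2_limit_contraction(3)[OF T sq(1,4) lims(1)] L2_limit_contraction(3)[OF T sq(2,5) lims(2)]
          L2_limit_contraction(3)[OF T sq(3,6) lims(3)] _ eq])
      (intro continuous_on_compose2[OF linear_continuous_on[OF T(1), of UNIV] cont]; simp)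
  have adm: "q \<in> admissible s \<epsilon>"
  proof -
    have "has_trace ?\<Omega> (boundary_edges \<epsilon>) (\<lambda>z. (\<lambda>x. x) (q z)) (\<lambda>z. vector [q_b s \<epsilon> z, 0, - s / 6])"
    proof (rule trace[OF bounded_linear_ident])
      fix a b n and t :: real assume ab: "(a, b) \<in> boundary_edges \<epsilon>" and t: "t \<in> {0..1}"
      let ?z = "linepath a b t"
      have z: "?z \<in> points_of (a, b)" by (rule linepath_in_points_of[OF t])
      have "jet (\<phi> n) ?z = 0"
        by (rule jet_zero_outside[OF \<phi>(1) boundary_edges_outside[OF assms(6,7) ab z]])
      then have "\<phi> n ?z = 0" by (simp add: jet_def zero_prod_def)
      then show "u n ?z = vector [q_b s \<epsilon> ?z, 0, - s / 6]"
        unfolding u_def boundary_lift_eq ramp_eq_q_b[OF assms(6,7) ab z] by simp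
    qed simp
    then show ?thesis by (simp add: admissible_def has_trace_def)
  qed
  have ramp0: "ramp \<epsilon> 0 = 0" by (simp add: ramp_def)
  have diag: "has_trace ?\<Omega> (diagonals \<epsilon>) (\<lambda>z. q z $ 1) (\<lambda>_. 0)"
  proof (rule trace[OF bounded_linear_vec_nth])
    fix a b n t assume "(a, b) \<in> diagonals \<epsilon>"
    then have "snd (linepath a b t) = fst (linepath a b t) \<or> snd (linepath a b t) = - fst (linepath a b t)"
      by (rule linepath_diagonals[of a b \<epsilon> t]) auto
    then show "u n (linepath a b t) $ 1 = 0"
      using symmetric_field_diagonal[OF \<phi>(2)[of n]] by (auto simp: u_def boundary_lift_eq ramp0)
  qed (simp add: component_le_norm_cart)
  have ax: "has_trace ?\<Omega> axes (\<lambda>z. q z $ 2) (\<lambda>_. 0)"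
  proof (rule trace[OF bounded_linear_vec_nth])
    fix a b n t assume "(a, b) \<in> axes"
    then have "fst (linepath a b t) = 0 \<or> snd (linepath a b t) = 0"
      by (rule linepath_axes[of a b t]) auto
    then show "u n (linepath a b t) $ 2 = 0"
      using symmetric_field_axis[OF \<phi>(2)[of n]] by (simp add: u_def boundary_lift_eq)
  qed (simp add: component_le_norm_cart)
  have "weak_Euler_Lagrange ?\<Omega> ?F q"
    unfolding weak_Euler_Lagrange_def Let_def
  proof (intro allI impI)
    fix \<psi> :: "real \<times> real \<Rightarrow> real ^ 3" assume \<psi>: "test_function ?\<Omega> \<psi>"
    let ?h = "\<lambda>z. frechet_derivative ?F (at (q z, weak_deriv ?\<Omega> (1, 0) q z, weak_deriv ?\<Omega> (0, 1) q z))
      (\<psi> z, dir_deriv (1, 0) \<psi> z, dir_deriv (0, 1) \<psi> z)"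
    have int: "integrable ?M (\<lambda>z. ?dF (j z) (jet \<psi> z))" using conv[OF bounded_measurable_jet[OF \<psi>]] by simp
    have ae: "AE z in ?M. ?dF (j z) (jet \<psi> z) = ?h z"
      using weak_deriv_AE_eq[OF open_Omega wdq(1)] weak_deriv_AE_eq[OF open_Omega wdq(2)]
    proof eventually_elim
      case (elim z)
      have "j z = (q z, weak_deriv ?\<Omega> (1, 0) q z, weak_deriv ?\<Omega> (0, 1) q z)"
        by (simp add: elim q_def qx_def qy_def)
      then show ?case
        by (simp add: jet_def frechet_derivative_at[OF energy_density_has_derivative, symmetric])
    qed
    have hm: "?h \<in> borel_measurable ?M"
      by (rule borel_measurable_lebesgue_on_AE[OF Omega_sets(1) borel_measurable_integrable[OF int] ae])
    have "integrable ?M ?h"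
      using int integrable_cong_AE[OF borel_measurable_integrable[OF int] hm ae] by simp
    moreover have "(LINT z|?M. ?h z) = 0"
      using integral_cong_AE[OF borel_measurable_integrable[OF int] hm ae] EL[OF \<psi>] by simp
    ultimately show "integrable ?M ?h \<and> (LINT z|?M. ?h z) = 0" ..
  qed
  with adm diag ax show "\<exists>q :: real \<times> real \<Rightarrow> real ^ 3. critical_point_J A B C L L2 lam \<epsilon> q \<and>
    has_trace ?\<Omega> (diagonals \<epsilon>) (\<lambda>z. q z $ 1) (\<lambda>_. 0) \<and> has_trace ?\<Omega> axes (\<lambda>z. q z $ 2) (\<lambda>_. 0)"
    unfolding critical_point_J_def s_def by blast
qed

end
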